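(* Let $M$ be a model of $T$ (an elementary substructure of $\mathbb{M}$), and let $\varphi(x,y)$ be an $L$-formula which is $I$-stable of ladder $k$. Then the Cantor–Bendixson rank of the topological space $\mathfrak{X}_{\varphi,M}$ is strictly less than $2^{k+1}-2$.
   Context: Fix a complete first-order theory $T$ in a language $L$ with infinite models and work in a monster model $\mathbb{M}$ of $T$; $x,y$ are finite tuples of variables. An ideal $I_x$ of $L_x(\mathbb{M})$-formulas is a family of formulas in $x$ with parameters in $\mathbb{M}$ closed under implication and finite disjunctions and containing the empty formula. A partial type is $I_x$-wide if it implies no formula of $I_x$; a tuple $a$ is $I_x$-wide over $A$ if $\mathrm{tp}(a/A)$ is $I_x$-wide. $I_x$ is $A$-invariant if $\psi(x,a)\in I_x$ and $a\equiv_A a'$ imply $\psi(x,a')\in I_x$. An $A$-invariant ideal $I_x$ is $S_1$ if for every $L$-formula $\psi(x,z)$ and every $A$-indiscernible sequence $(a_i)_{i\in\mathbb{N}}$ with $\psi(x,a_0)\wedge\psi(x,a_1)\in I_x$ one has $\psi(x,a_0)\in I_x$. Fix $\emptyset$-invariant $S_1$-ideals $I_x$ (in $x$) and $I_y$ (in $y$), and write $I=(I_x,I_y)$. A finite sequence of tuples, each in the sort of $x$ or of $y$, is $M$-independent if the type of each entry over $M$ together with all previous entries is wide with respect to the corresponding ideal ($I_x$ for entries in the sort of $x$, $I_y$ for entries in the sort of $y$). $\varphi(x,y)$ is $I$-stable of ladder $k$ if there are no model $M$ and no tuple $(a_1,b_1,\ldots,a_k,b_k)$ such that either $(a_1,b_1,\ldots,a_k,b_k)$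 or $(b_k,a_k,\ldots,b_1,a_1)$ is $M$-independent and $\varphi(a_i,b_j)$ holds iff $i\leq j$. The space $\mathfrak{X}_{\varphi,M}$ is the set of $I_x$-wide partial types which are maximal consistent sets of Boolean combinations of formulas $\varphi(x,b)$ with $b$ ranging over tuples that are $I_y$-wide over $M$; its topology has as basis the sets $[\psi(x)]_M=\{\mathfrak{p}\in\mathfrak{X}_{\varphi,M}:\psi\in\mathfrak{p}\}$ for such Boolean combinations $\psi$. *)

theory Defs
  imports "HOL-Analysis.Analysis"
begin

unbundle cardinal_syntax

section \<open>First-order formulas with parameters\<close>

text \<open>Variables are named by natural numbers. Elements of a structure occur in formulas as
  constants \<open>Par m\<close>; the formulas of the language itself are those without such constants.\<close>

datatype ('f, trm_params: 'm) trm =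
  Var nat | Par 'm | Fn 'f "('f, 'm) trm list"

datatype ('f, 'r, params: 'm) fml =
  Bot
| Eq "('f, 'm) trm" "('f, 'm) trm"
| Rel 'r "('f, 'm) trm list"
| Neg "('f, 'r, 'm) fml"
| Conj "('f, 'r, 'm) fml" "('f, 'r, 'm) fml"
| Ex nat "('f, 'r, 'm) fml"

definition Disj :: "('f, 'r, 'm) fml \<Rightarrow> ('f, 'r, 'm) fml \<Rightarrow> ('f, 'r, 'm) fml" where
  "Disj \<phi> \<psi> = Neg (Conj (Neg \<phi>) (Neg \<psi>))"

primrec fv_trm :: "('f, 'm) trm \<Rightarrow> nat set" where
  "fv_trm (Var v) = {v}"
| "fv_trm (Par m) = {}"
| "fv_trm (Fn f ts) = \<Union> (set (map fv_trm ts))"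

primrec fv :: "('f, 'r, 'm) fml \<Rightarrow> nat set" where
  "fv Bot = {}"
| "fv (Eq s t) = fv_trm s \<union> fv_trm t"
| "fv (Rel r ts) = \<Union> (fv_trm ` set ts)"
| "fv (Neg \<phi>) = fv \<phi>"
| "fv (Conj \<phi> \<psi>) = fv \<phi> \<union> fv \<psi>"
| "fv (Ex v \<phi>) = fv \<phi> - {v}"

text \<open>Since only constants are substituted for (free) variables, no variable is ever captured.\<close>

primrec subst_trm :: "(nat \<Rightarrow> 'm option) \<Rightarrow> ('f, 'm) trm \<Rightarrow> ('f, 'm) trm" where
  "subst_trm s (Var v) = (case s v of None \<Rightarrow> Var v | Some m \<Rightarrow> Par m)"
| "subst_trm s (Par m) = Par m"
| "subst_trm s (Fn f ts) = Fn f (map (subst_trm s) ts)"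

primrec subst :: "(nat \<Rightarrow> 'm option) \<Rightarrow> ('f, 'r, 'm) fml \<Rightarrow> ('f, 'r, 'm) fml" where
  "subst s Bot = Bot"
| "subst s (Eq t u) = Eq (subst_trm s t) (subst_trm s u)"
| "subst s (Rel r ts) = Rel r (map (subst_trm s) ts)"
| "subst s (Neg \<phi>) = Neg (subst s \<phi>)"
| "subst s (Conj \<phi> \<psi>) = Conj (subst s \<phi>) (subst s \<psi>)"
| "subst s (Ex v \<phi>) = Ex v (subst (s(v := None)) \<phi>)"

text \<open>\<open>inst z a \<psi>\<close> is \<open>\<psi>(x, a)\<close> for \<open>\<psi>(x, z)\<close>.\<close>

definition inst :: "nat list \<Rightarrow> 'm list \<Rightarrow> ('f, 'r, 'm) fml \<Rightarrow> ('f, 'r, 'm) fml" where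
  "inst z a \<psi> = subst (map_of (zip z a)) \<psi>"


section \<open>Structures and satisfaction\<close>

text \<open>The universe is the whole type \<open>'m\<close>. The symbols of the language are those in
  \<open>fun_syms\<close> (constants having arity 0) and \<open>rel_syms\<close>; explicit sets allow either to be
  empty. Interpretations are only relevant on argument lists
  whose length is the arity.\<close>

record ('f, 'r, 'm) fo_structure =
  fun_syms :: "'f set"
  rel_syms :: "'r set"
  fun_arity :: "'f \<Rightarrow> nat"
  rel_arity :: "'r \<Rightarrow> nat"
  fun_int :: "'f \<Rightarrow> 'm list \<Rightarrow> 'm"
  rel_int :: "'r \<Rightarrow> 'm list \<Rightarrow> bool"

primrec wf_trm :: "('f, 'r, 'm) fo_structure \<Rightarrow> ('f, 'm) trm \<Rightarrow> bool" where
  "wf_trm S (Var v) = True"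
| "wf_trm S (Par m) = True"
| "wf_trm S (Fn f ts) = (f \<in> fun_syms S \<and> length ts = fun_arity S f \<and> list_all (wf_trm S) ts)"

primrec wf_fml :: "('f, 'r, 'm) fo_structure \<Rightarrow> ('f, 'r, 'm) fml \<Rightarrow> bool" where
  "wf_fml S Bot = True"
| "wf_fml S (Eq s t) = (wf_trm S s \<and> wf_trm S t)"
| "wf_fml S (Rel r ts) = (r \<in> rel_syms S \<and> length ts = rel_arity S r \<and> list_all (wf_trm S) ts)"
| "wf_fml S (Neg \<phi>) = wf_fml S \<phi>"
| "wf_fml S (Conj \<phi> \<psi>) = (wf_fml S \<phi> \<and> wf_fml S \<psi>)"
| "wf_fml S (Ex v \<phi>) = wf_fml S \<phi>"

text \<open>\<open>formulas S X A\<close>: formulas with free variables in \<open>X\<close> and parameters in \<open>A\<close>.\<close>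

definition formulas ::
    "('f, 'r, 'm) fo_structure \<Rightarrow> nat set \<Rightarrow> 'm set \<Rightarrow> ('f, 'r, 'm) fml set" where
  "formulas S X A = {\<phi>. wf_fml S \<phi> \<and> fv \<phi> \<subseteq> X \<and> params \<phi> \<subseteq> A}"

primrec eval :: "('f, 'r, 'm) fo_structure \<Rightarrow> (nat \<Rightarrow> 'm) \<Rightarrow> ('f, 'm) trm \<Rightarrow> 'm" where
  "eval S e (Var v) = e v"
| "eval S e (Par m) = m"
| "eval S e (Fn f ts) = fun_int S f (map (eval S e) ts)"

text \<open>The second argument is the range of the quantifiers, so that satisfaction in a substructure
  can be expressed.\<close>

primrec sat_in ::
    "('f, 'r, 'm) fo_structure \<Rightarrow> 'm set \<Rightarrow> (nat \<Rightarrow> 'm) \<Rightarrow> ('f, 'r, 'm) fml \<Rightarrow> bool" where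
  "sat_in S D e Bot = False"
| "sat_in S D e (Eq s t) = (eval S e s = eval S e t)"
| "sat_in S D e (Rel r ts) = rel_int S r (map (eval S e) ts)"
| "sat_in S D e (Neg \<phi>) = (\<not> sat_in S D e \<phi>)"
| "sat_in S D e (Conj \<phi> \<psi>) = (sat_in S D e \<phi> \<and> sat_in S D e \<psi>)"
| "sat_in S D e (Ex v \<phi>) = (\<exists>d\<in>D. sat_in S D (e(v := d)) \<phi>)"

definition env :: "nat list \<Rightarrow> 'm list \<Rightarrow> nat \<Rightarrow> 'm" where
  "env x a v = (case map_of (zip x a) v of None \<Rightarrow> undefined | Some m \<Rightarrow> m)"

text \<open>\<open>holds S x a \<psi>\<close>: \<open>\<psi>(a)\<close> is true in \<open>S\<close>, where \<open>\<psi>\<close> is a formula in \<open>x\<close>.\<close>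

definition holds ::
    "('f, 'r, 'm) fo_structure \<Rightarrow> nat list \<Rightarrow> 'm list \<Rightarrow> ('f, 'r, 'm) fml \<Rightarrow> bool" where
  "holds S x a \<psi> = sat_in S UNIV (env x a) \<psi>"

definition elementary_substructure :: "('f, 'r, 'm) fo_structure \<Rightarrow> 'm set \<Rightarrow> bool" where
  "elementary_substructure S M \<longleftrightarrow>
     M \<noteq> {} \<and>
     (\<forall>f\<in>fun_syms S. \<forall>as. length as = fun_arity S f \<and> set as \<subseteq> M \<longrightarrow> fun_int S f as \<in> M) \<and>
     (\<forall>\<psi>\<in>formulas S UNIV {}. \<forall>e. range e \<subseteq> M \<longrightarrow> (sat_in S M e \<psi> \<longleftrightarrow> sat_in S UNIV e \<psi>))"


section \<open>Types, indiscernible sequences and monster models\<close>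

definition tp ::
    "('f, 'r, 'm) fo_structure \<Rightarrow> nat list \<Rightarrow> 'm list \<Rightarrow> 'm set \<Rightarrow> ('f, 'r, 'm) fml set" where
  "tp S x a A = {\<psi> \<in> formulas S (set x) A. holds S x a \<psi>}"

definition equiv_over :: "('f, 'r, 'm) fo_structure \<Rightarrow> 'm set \<Rightarrow> 'm list \<Rightarrow> 'm list \<Rightarrow> bool" where
  "equiv_over S A a a' \<longleftrightarrow>
     length a = length a' \<and> tp S [0..<length a] a A = tp S [0..<length a'] a' A"

definition indiscernible :: "('f, 'r, 'm) fo_structure \<Rightarrow> 'm set \<Rightarrow> (nat \<Rightarrow> 'm list) \<Rightarrow> bool" where
  "indiscernible S A a \<longleftrightarrow>
     (\<forall>i j. length (a i) = length (a j)) \<and>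
     (\<forall>is js. sorted_wrt (<) is \<and> sorted_wrt (<) js \<and> length is = length js \<longrightarrow>
        equiv_over S A (concat (map a is)) (concat (map a js)))"

text \<open>Consistency and implication are relative to the elementary diagram of \<open>S\<close>; by compactness
  they only involve finite subsets of \<open>p\<close>, and for those they can be checked in \<open>S\<close> itself.\<close>

definition consistent ::
    "('f, 'r, 'm) fo_structure \<Rightarrow> nat list \<Rightarrow> ('f, 'r, 'm) fml set \<Rightarrow> bool" where
  "consistent S x p \<longleftrightarrow>
     (\<forall>q. finite q \<and> q \<subseteq> p \<longrightarrow> (\<exists>a. length a = length x \<and> (\<forall>\<psi>\<in>q. holds S x a \<psi>)))"

definition implies ::
    "('f, 'r, 'm) fo_structure \<Rightarrow> nat list \<Rightarrow> ('f, 'r, 'm) fml set \<Rightarrow> ('f, 'r, 'm) fml \<Rightarrow> bool" where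
  "implies S x p \<theta> \<longleftrightarrow>
     (\<exists>q. finite q \<and> q \<subseteq> p \<and>
       (\<forall>a. length a = length x \<and> (\<forall>\<psi>\<in>q. holds S x a \<psi>) \<longrightarrow> holds S x a \<theta>))"

definition saturated :: "('f, 'r, 'm) fo_structure \<Rightarrow> 'k rel \<Rightarrow> bool" where
  "saturated S \<kappa> \<longleftrightarrow>
     (\<forall>A n p. |A| <o \<kappa> \<and> p \<subseteq> formulas S {..<n} A \<and> consistent S [0..<n] p \<longrightarrow>
       (\<exists>a. length a = n \<and> (\<forall>\<psi>\<in>p. holds S [0..<n] a \<psi>)))"

definition elementary_map :: "('f, 'r, 'm) fo_structure \<Rightarrow> 'm set \<Rightarrow> ('m \<Rightarrow> 'm) \<Rightarrow> bool" where
  "elementary_map S A g \<longleftrightarrow> (\<forall>a. set a \<subseteq> A \<longrightarrow> equiv_over S {} a (map g a))"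

definition automorphism :: "('f, 'r, 'm) fo_structure \<Rightarrow> ('m \<Rightarrow> 'm) \<Rightarrow> bool" where
  "automorphism S \<sigma> \<longleftrightarrow>
     bij \<sigma> \<and>
     (\<forall>f\<in>fun_syms S. \<forall>as. length as = fun_arity S f \<longrightarrow>
        \<sigma> (fun_int S f as) = fun_int S f (map \<sigma> as)) \<and>
     (\<forall>r\<in>rel_syms S. \<forall>as. length as = rel_arity S r \<longrightarrow>
        (rel_int S r as \<longleftrightarrow> rel_int S r (map \<sigma> as)))"

definition strongly_homogeneous :: "('f, 'r, 'm) fo_structure \<Rightarrow> 'k rel \<Rightarrow> bool" where
  "strongly_homogeneous S \<kappa> \<longleftrightarrow>
     (\<forall>A g. |A| <o \<kappa> \<and> elementary_map S A g \<longrightarrow>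
       (\<exists>\<sigma>. automorphism S \<sigma> \<and> (\<forall>m\<in>A. \<sigma> m = g m)))"

text \<open>A complete theory is taken to be deductively closed, so that it contains exactly one of
  \<open>\<sigma>\<close> and its negation for each sentence \<open>\<sigma>\<close>; it has an infinite model as soon as it
  has a monster model in the following sense.\<close>

definition complete_theory ::
    "('f, 'r, 'm) fo_structure \<Rightarrow> ('f, 'r, 'm) fml set \<Rightarrow> bool" where
  "complete_theory S T \<longleftrightarrow>
     T \<subseteq> formulas S {} {} \<and> (\<forall>\<sigma>\<in>formulas S {} {}. \<sigma> \<in> T \<longleftrightarrow> Neg \<sigma> \<notin> T)"

definition monster_model ::
    "('f, 'r, 'm) fo_structure \<Rightarrow> ('f, 'r, 'm) fml set \<Rightarrow> 'k rel \<Rightarrow> bool" where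
  "monster_model S T \<kappa> \<longleftrightarrow>
     infinite (UNIV :: 'm set) \<and> (\<forall>\<sigma>\<in>T. holds S [] [] \<sigma>) \<and>
     Card_order \<kappa> \<and> natLeq <o \<kappa> \<and> |fun_syms S| <o \<kappa> \<and> |rel_syms S| <o \<kappa> \<and>
     saturated S \<kappa> \<and> strongly_homogeneous S \<kappa>"


section \<open>Ideals of formulas and wide types\<close>

definition formula_ideal ::
    "('f, 'r, 'm) fo_structure \<Rightarrow> nat list \<Rightarrow> ('f, 'r, 'm) fml set \<Rightarrow> bool" where
  "formula_ideal S x I \<longleftrightarrow>
     I \<subseteq> formulas S (set x) UNIV \<and> Bot \<in> I \<and>
     (\<forall>\<phi>\<in>I. \<forall>\<psi>\<in>I. Disj \<phi> \<psi> \<in> I) \<and>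
     (\<forall>\<psi>\<in>I. \<forall>\<theta>\<in>formulas S (set x) UNIV. implies S x {\<theta>} \<psi> \<longrightarrow> \<theta> \<in> I)"

definition invariant_ideal ::
    "('f, 'r, 'm) fo_structure \<Rightarrow> nat list \<Rightarrow> 'm set \<Rightarrow> ('f, 'r, 'm) fml set \<Rightarrow> bool" where
  "invariant_ideal S x A I \<longleftrightarrow>
     formula_ideal S x I \<and>
     (\<forall>z \<psi> a a'. distinct z \<and> set z \<inter> set x = {} \<and> \<psi> \<in> formulas S (set x \<union> set z) {} \<and>
        length a = length z \<and> equiv_over S A a a' \<and> inst z a \<psi> \<in> I \<longrightarrow> inst z a' \<psi> \<in> I)"

definition S1_ideal ::
    "('f, 'r, 'm) fo_structure \<Rightarrow> nat list \<Rightarrow> 'm set \<Rightarrow> ('f, 'r, 'm) fml set \<Rightarrow> bool" where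
  "S1_ideal S x A I \<longleftrightarrow>
     invariant_ideal S x A I \<and>
     (\<forall>z \<psi> a. distinct z \<and> set z \<inter> set x = {} \<and> \<psi> \<in> formulas S (set x \<union> set z) {} \<and>
        (\<forall>i. length (a i) = length z) \<and> indiscernible S A a \<and>
        Conj (inst z (a 0) \<psi>) (inst z (a 1) \<psi>) \<in> I \<longrightarrow> inst z (a 0) \<psi> \<in> I)"

definition wide_type ::
    "('f, 'r, 'm) fo_structure \<Rightarrow> nat list \<Rightarrow> ('f, 'r, 'm) fml set \<Rightarrow> ('f, 'r, 'm) fml set \<Rightarrow> bool"
  where
  "wide_type S x I p \<longleftrightarrow> (\<forall>\<theta>\<in>I. \<not> implies S x p \<theta>)"

definition wide_tuple ::
    "('f, 'r, 'm) fo_structure \<Rightarrow> nat list \<Rightarrow> ('f, 'r, 'm) fml set \<Rightarrow> 'm set \<Rightarrow> 'm list \<Rightarrow> bool"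
  where
  "wide_tuple S x I A a \<longleftrightarrow> length a = length x \<and> wide_type S x I (tp S x a A)"


section \<open>Independent sequences and stability\<close>

text \<open>An entry \<open>Inl a\<close> is a tuple in the sort of \<open>x\<close>, an entry \<open>Inr b\<close> one in the sort of \<open>y\<close>
  (the tags matter when both sorts have the same length).\<close>

definition entries :: "('m list + 'm list) list \<Rightarrow> 'm set" where
  "entries s = (\<Union>t\<in>set s. case t of Inl a \<Rightarrow> set a | Inr b \<Rightarrow> set b)"

definition independent ::
    "('f, 'r, 'm) fo_structure \<Rightarrow> nat list \<Rightarrow> nat list \<Rightarrow> ('f, 'r, 'm) fml set \<Rightarrow>
     ('f, 'r, 'm) fml set \<Rightarrow> 'm set \<Rightarrow> ('m list + 'm list) list \<Rightarrow> bool" where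
  "independent S x y Ix Iy M s \<longleftrightarrow>
     (\<forall>i<length s. case s ! i of
        Inl a \<Rightarrow> wide_tuple S x Ix (M \<union> entries (take i s)) a
      | Inr b \<Rightarrow> wide_tuple S y Iy (M \<union> entries (take i s)) b)"

text \<open>The sequence \<open>(a\<^sub>1, b\<^sub>1, \<dots>, a\<^sub>k, b\<^sub>k)\<close>.\<close>

definition ladder_seq ::
    "nat \<Rightarrow> (nat \<Rightarrow> 'm list) \<Rightarrow> (nat \<Rightarrow> 'm list) \<Rightarrow> ('m list + 'm list) list" where
  "ladder_seq k a b = concat (map (\<lambda>i. [Inl (a i), Inr (b i)]) [1..<Suc k])"

definition stable_of_ladder ::
    "('f, 'r, 'm) fo_structure \<Rightarrow> nat list \<Rightarrow> nat list \<Rightarrow> ('f, 'r, 'm) fml set \<Rightarrow>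
     ('f, 'r, 'm) fml set \<Rightarrow> ('f, 'r, 'm) fml \<Rightarrow> nat \<Rightarrow> bool" where
  "stable_of_ladder S x y Ix Iy \<phi> k \<longleftrightarrow>
     \<not> (\<exists>M a b. elementary_substructure S M \<and>
          (\<forall>i\<in>{1..k}. length (a i) = length x \<and> length (b i) = length y) \<and>
          (independent S x y Ix Iy M (ladder_seq k a b) \<or>
           independent S x y Ix Iy M (rev (ladder_seq k a b))) \<and>
          (\<forall>i\<in>{1..k}. \<forall>j\<in>{1..k}. holds S (x @ y) (a i @ b j) \<phi> \<longleftrightarrow> i \<le> j))"


section \<open>The space of wide types and its Cantor--Bendixson rank\<close>

inductive_set boolean_combinations :: "('f, 'r, 'm) fml set \<Rightarrow> ('f, 'r, 'm) fml set"
  for B :: "('f, 'r, 'm) fml set" where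
  base: "\<psi> \<in> B \<Longrightarrow> \<psi> \<in> boolean_combinations B"
| bot: "Bot \<in> boolean_combinations B"
| neg: "\<psi> \<in> boolean_combinations B \<Longrightarrow> Neg \<psi> \<in> boolean_combinations B"
| conj: "\<psi> \<in> boolean_combinations B \<Longrightarrow> \<theta> \<in> boolean_combinations B \<Longrightarrow>
    Conj \<psi> \<theta> \<in> boolean_combinations B"

definition wide_instances ::
    "('f, 'r, 'm) fo_structure \<Rightarrow> nat list \<Rightarrow> ('f, 'r, 'm) fml set \<Rightarrow> ('f, 'r, 'm) fml \<Rightarrow>
     'm set \<Rightarrow> ('f, 'r, 'm) fml set" where
  "wide_instances S y Iy \<phi> M = {inst y b \<phi> | b. wide_tuple S y Iy M b}"

definition wide_points ::
    "('f, 'r, 'm) fo_structure \<Rightarrow> nat list \<Rightarrow> nat list \<Rightarrow> ('f, 'r, 'm) fml set \<Rightarrow>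
     ('f, 'r, 'm) fml set \<Rightarrow> ('f, 'r, 'm) fml \<Rightarrow> 'm set \<Rightarrow> ('f, 'r, 'm) fml set set" where
  "wide_points S x y Ix Iy \<phi> M =
     {p. p \<subseteq> boolean_combinations (wide_instances S y Iy \<phi> M) \<and> consistent S x p \<and>
         (\<forall>q. p \<subseteq> q \<and> q \<subseteq> boolean_combinations (wide_instances S y Iy \<phi> M) \<and>
              consistent S x q \<longrightarrow> q = p) \<and>
         wide_type S x Ix p}"

text \<open>The generating sets are closed under finite intersections and cover the set of points, hence
  they form a basis.\<close>

definition wide_space ::
    "('f, 'r, 'm) fo_structure \<Rightarrow> nat list \<Rightarrow> nat list \<Rightarrow> ('f, 'r, 'm) fml set \<Rightarrow>
     ('f, 'r, 'm) fml set \<Rightarrow> ('f, 'r, 'm) fml \<Rightarrow> 'm set \<Rightarrow> ('f, 'r, 'm) fml set topology" where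
  "wide_space S x y Ix Iy \<phi> M =
     topology_generated_by
       {{p \<in> wide_points S x y Ix Iy \<phi> M. \<psi> \<in> p} | \<psi>.
         \<psi> \<in> boolean_combinations (wide_instances S y Iy \<phi> M)}"

definition cb_derivative :: "'a topology \<Rightarrow> 'a set \<Rightarrow> 'a set" where
  "cb_derivative X C = C \<inter> X derived_set_of C"

text \<open>The rank of a point is the largest \<open>\<alpha>\<close> such that the point lies in the \<open>\<alpha>\<close>-th derivative
  (isolated points have rank 0), and the rank of the space is the supremum of the ranks of its
  points. All infinite ranks, including that of a point in the perfect kernel, are identified with
  \<open>\<infinity>\<close>; the empty space gets rank 0.\<close>

definition cb_rank_at :: "'a topology \<Rightarrow> 'a \<Rightarrow> enat" where
  "cb_rank_at X p = Sup {enat n | n. p \<in> (cb_derivative X ^^ n) (topspace X)}"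

definition cb_rank :: "'a topology \<Rightarrow> enat" where
  "cb_rank X = (SUP p\<in>topspace X. cb_rank_at X p)"

end

theory Submission
  imports Defs
begin

text \<open>Fix a small model \<open>M\<close>. For an ideal with S1, a coheir argument shows that \<open>\<psi>(y, b) \<and> \<theta>(y, c)\<close>
  stays wide when \<open>c\<close> is replaced by any \<open>c' \<equiv>\<^sub>M c\<close> that is wide over \<open>M b\<close>. This allows one to build long
  independent sequences with prescribed types of pairs, so an independent ladder arises unless the truth
  value of \<open>\<phi>(a, b)\<close> on independent pairs depends only on \<open>tp(a/M)\<close> and \<open>tp(b/M)\<close>. A point of large
  Cantor--Bendixson rank gives a binary tree of instances of \<open>\<phi>\<close> all of whose branches are wide. By
  stationarity it becomes a tree for the relation induced by \<open>\<phi>\<close> on types over \<open>M\<close>; Hodges'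
  argument extracts a ladder from it, whose types can be realized independently, in any order.\<close>

section \<open>Renaming variables and abstracting parameters\<close>

text \<open>Saturation realizes types over small sets only, while the given model may be as large as
  the monster. The arguments therefore run over a small elementary \<open>M0\<close> inside it:
  tuples wide over the larger model are wide over \<open>M0\<close>, and ladders are forbidden over
  every model. The obstacle is that S1 concerns one formula along one indiscernible sequence,
  whereas amalgamation is about a conjunction with two unrelated parameters. Hence both parameters
  are coded in one tuple, and a sequence is built whose diagonal pairs make the conjunction wide
  although its off-diagonal pairs would make it small. Both orders forbidden by stability are
  needed, because the member of a disagreeing couple of independent pairs that satisfies
  \<open>\<phi>\<close> decides whether the ladder starts in the sort of \<open>x\<close> or of
  \<open>y\<close>. The bound solves h(0) = 0, h(k + 1) = 2 h(k) + 2: one level is the root, and of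
  the remaining ones h + 1 or h survive a partition of the nodes. Formulas are replaced by definable
  relations on lists and ideals by families of sets of tuples, so that renaming of variables stays
  out of these arguments.\<close>

lemma eval_cong: "(\<And>v. v \<in> fv_trm t \<Longrightarrow> e v = e' v) \<Longrightarrow> eval S e t = eval S e' t"
proof (induction t)
  case (Fn f ts)
  have "map (eval S e) ts = map (eval S e') ts"
    using Fn by (intro map_cong) auto
  then show ?case by (simp del: map_eq_conv)
qed auto

lemma sat_in_cong:
  "(\<And>v. v \<in> fv \<psi> \<Longrightarrow> e v = e' v) \<Longrightarrow> sat_in S D e \<psi> = sat_in S D e' \<psi>"
proof (induction \<psi> arbitrary: e e')
  case (Eq s t)
  then show ?case using eval_cong[of s e e' S] eval_cong[of t e e' S] by simp
next
  case (Rel r ts)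
  have "map (eval S e) ts = map (eval S e') ts"
    using Rel by (intro map_cong eval_cong) auto
  then show ?case by (simp del: map_eq_conv)
next
  case (Neg p)
  have "sat_in S D e p = sat_in S D e' p" by (rule Neg.IH) (simp add: Neg.prems)
  then show ?case by simp
next
  case (Conj p q)
  have "sat_in S D e p = sat_in S D e' p" "sat_in S D e q = sat_in S D e' q"
    using Conj.prems by (intro Conj.IH; simp)+
  then show ?case by simp
next
  case (Ex v p)
  have "sat_in S D (e(v := d)) p = sat_in S D (e'(v := d)) p" for d
    using Ex.prems by (intro Ex.IH) auto
  then show ?case by simp
qed simp

lemma finite_fv_trm: "finite (fv_trm t)"
  by (induction t) auto

lemma finite_fv: "finite (fv \<psi>)"
  by (induction \<psi>) (auto simp: finite_fv_trm)

lemma finite_trm_params: "finite (trm_params t)"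
  by (induction t) auto

lemma finite_params: "finite (params \<psi>)"
  by (induction \<psi>) (auto simp: finite_trm_params)

text \<open>\<open>abstr f g\<close> renames every variable, bound ones included, by \<open>f\<close>, and turns a parameter \<open>m\<close>
  into the variable \<open>g m\<close>; captures are excluded when \<open>f\<close> is injective and \<open>g\<close> avoids its range.\<close>

primrec abstr_trm :: "(nat \<Rightarrow> nat) \<Rightarrow> ('m \<Rightarrow> nat) \<Rightarrow> ('f, 'm) trm \<Rightarrow> ('f, 'm) trm" where
  "abstr_trm f g (Var v) = Var (f v)"
| "abstr_trm f g (Par m) = Var (g m)"
| "abstr_trm f g (Fn h ts) = Fn h (map (abstr_trm f g) ts)"

primrec abstr :: "(nat \<Rightarrow> nat) \<Rightarrow> ('m \<Rightarrow> nat) \<Rightarrow> ('f, 'r, 'm) fml \<Rightarrow> ('f, 'r, 'm) fml" where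
  "abstr f g Bot = Bot"
| "abstr f g (Eq s t) = Eq (abstr_trm f g s) (abstr_trm f g t)"
| "abstr f g (Rel r ts) = Rel r (map (abstr_trm f g) ts)"
| "abstr f g (Neg \<phi>) = Neg (abstr f g \<phi>)"
| "abstr f g (Conj \<phi> \<psi>) = Conj (abstr f g \<phi>) (abstr f g \<psi>)"
| "abstr f g (Ex v \<phi>) = Ex (f v) (abstr f g \<phi>)"

lemma eval_abstr:
  "(\<And>m. m \<in> trm_params t \<Longrightarrow> e (g m) = m) \<Longrightarrow>
    eval S e (abstr_trm f g t) = eval S (\<lambda>u. e (f u)) t"
proof (induction t)
  case (Fn h ts)
  have "map (eval S e) (map (abstr_trm f g) ts) = map (eval S (\<lambda>u. e (f u))) ts"
    unfolding map_map comp_def using Fn.prems by (intro map_cong refl Fn.IH) auto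
  then show ?case by (simp del: map_eq_conv map_map)
qed auto

lemma sat_in_abstr:
  assumes "inj f"
  shows "(\<And>m. m \<in> params \<psi> \<Longrightarrow> e (g m) = m) \<Longrightarrow> (\<And>m v. m \<in> params \<psi> \<Longrightarrow> g m \<noteq> f v) \<Longrightarrow>
    sat_in S D e (abstr f g \<psi>) = sat_in S D (\<lambda>u. e (f u)) \<psi>"
proof (induction \<psi> arbitrary: e)
  case (Eq s t)
  then show ?case using eval_abstr[of s e g S f] eval_abstr[of t e g S f] by simp
next
  case (Rel r ts)
  have "map (eval S e) (map (abstr_trm f g) ts) = map (eval S (\<lambda>u. e (f u))) ts"
    unfolding map_map comp_def using Rel by (intro map_cong refl eval_abstr) auto
  then show ?case by (simp del: map_eq_conv map_map)
next
  case (Ex v p)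
  have "sat_in S D (e(f v := d)) (abstr f g p) = sat_in S D ((\<lambda>u. e (f u))(v := d)) p" for d
  proof -
    have "sat_in S D (e(f v := d)) (abstr f g p) = sat_in S D (\<lambda>u. (e(f v := d)) (f u)) p"
      using Ex.prems by (intro Ex.IH) auto
    also have "(\<lambda>u. (e(f v := d)) (f u)) = (\<lambda>u. e (f u))(v := d)"
      using assms(1) by (auto simp: fun_eq_iff inj_eq)
    finally show ?thesis .
  qed
  then show ?case by simp
qed auto

lemma fv_abstr_trm: "fv_trm (abstr_trm f g t) = f ` fv_trm t \<union> g ` trm_params t"
  by (induction t) auto

lemma fv_abstr:
  assumes "inj f"
  shows "(\<And>m v. m \<in> params \<psi> \<Longrightarrow> g m \<noteq> f v) \<Longrightarrow> fv (abstr f g \<psi>) = f ` fv \<psi> \<union> g ` params \<psi>"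
proof (induction \<psi>)
  case (Eq t u)
  then show ?case by (simp add: fv_abstr_trm image_Un Un_ac)
next
  case (Rel r ts)
  then show ?case by (simp add: fv_abstr_trm image_UN UN_Un_distrib)
next
  case (Conj p q)
  then show ?case by (simp add: image_Un Un_ac)
next
  case (Ex v p)
  then have IH: "fv (abstr f g p) = f ` fv p \<union> g ` params p" by simp
  have "f ` (fv p - {v}) = f ` fv p - {f v}"
    using image_set_diff[OF assms, of "fv p" "{v}"] by simp
  moreover have "f v \<notin> g ` params p"
  proof
    assume "f v \<in> g ` params p"
    then obtain m where "m \<in> params p" "g m = f v" by auto
    then show False using Ex.prems[of m v] by simp
  qed
  ultimately show ?case using IH by auto
qed auto

lemma wf_abstr_trm: "wf_trm S t \<Longrightarrow> wf_trm S (abstr_trm f g t)"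
  by (induction t) (auto simp: list_all_iff)

lemma wf_abstr: "wf_fml S \<psi> \<Longrightarrow> wf_fml S (abstr f g \<psi>)"
  by (induction \<psi>) (auto simp: list_all_iff wf_abstr_trm)

lemma params_abstr_trm: "trm_params (abstr_trm f g t) = {}"
  by (induction t) auto

lemma params_abstr: "params (abstr f g \<psi>) = {}"
  by (induction \<psi>) (auto simp: params_abstr_trm)

lemma env_nth:
  assumes "distinct x" "length a = length x" "i < length x"
  shows "env x a (x ! i) = a ! i"
proof -
  have "map_of (zip x a) (x ! i) = Some (a ! i)"
    using assms by (simp add: map_of_zip_nth)
  then show ?thesis by (simp add: env_def)
qed

lemma env_upt: "length a = n \<Longrightarrow> i < n \<Longrightarrow> env [0..<n] a i = a ! i"
  using env_nth[of "[0..<n]" a i] by simp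

text \<open>Injectivity is demanded on all variables and not just on \<open>w\<close>, since
  \<open>abstr\<close> also renames bound variables. Variables outside \<open>w\<close> are shifted
  beyond every member of \<open>w'\<close>.\<close>

lemma ex_inj_map_eq:
  fixes w w' :: "nat list"
  assumes "distinct w" "distinct w'" "length w = length w'"
  obtains f where "inj f" "map f w = w'"
proof -
  define K where "K = Suc (Max (insert 0 (set w')))"
  define h where "h = the_inv_into {..<length w} ((!) w)"
  have injw: "inj_on ((!) w) {..<length w}"
    using assms(1) by (simp add: inj_on_nth)
  have h: "h (w ! i) = i" if "i < length w" for i
    unfolding h_def using the_inv_into_f_f[OF injw] that by simp
  define f where "f v = (if v \<in> set w then w' ! h v else v + K)" for v
  have K: "u < K" if "u \<in> set w'" for u
    using that by (simp add: K_def less_Suc_eq_le)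
  have hlt: "h v < length w \<and> w ! h v = v" if v: "v \<in> set w" for v
  proof -
    obtain i where "i < length w" "w ! i = v" using v by (auto simp: in_set_conv_nth)
    then show ?thesis using h by auto
  qed
  have "inj f"
  proof (rule injI)
    fix u v assume e: "f u = f v"
    show "u = v"
    proof (cases "u \<in> set w")
      case u: True
      then have wu: "f u \<in> set w'" using hlt[OF u] assms(3) by (simp add: f_def)
      have v: "v \<in> set w"
      proof (rule ccontr)
        assume "v \<notin> set w"
        then have "f v = v + K" by (simp add: f_def)
        then show False using K[OF wu] e by simp
      qed
      have "w' ! h u = w' ! h v" using e u v by (simp add: f_def)
      then have "h u = h v"
        using hlt[OF u] hlt[OF v] assms(2,3) nth_eq_iff_index_eq by metis
      then show ?thesis using hlt[OF u] hlt[OF v] by metis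
    next
      case u: False
      have "v \<notin> set w"
      proof
        assume v: "v \<in> set w"
        then have "f v \<in> set w'" using hlt[OF v] assms(3) by (simp add: f_def)
        then show False using K u e by (fastforce simp: f_def)
      qed
      then show ?thesis using e u by (simp add: f_def)
    qed
  qed
  moreover have "map f w = w'"
    using assms(3) h by (intro nth_equalityI) (auto simp: f_def)
  ultimately show thesis using that by blast
qed

lemma holds_rename:
  assumes "distinct w" "distinct w'" "length w = length w'" "\<psi> \<in> formulas S (set w) {}"
  obtains \<psi>' where "\<psi>' \<in> formulas S (set w') {}"
    "\<And>a. length a = length w \<Longrightarrow> holds S w' a \<psi>' \<longleftrightarrow> holds S w a \<psi>"
proof -
  obtain f where f: "inj f" "map f w = w'"
    using ex_inj_map_eq assms(1-3) by blast
  have par: "params \<psi> = {}" "fv \<psi> \<subseteq> set w" "wf_fml S \<psi>"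
    using assms(4) by (auto simp: formulas_def)
  define \<psi>' where "\<psi>' = abstr f (\<lambda>_. 0) \<psi>"
  have "fv \<psi>' = f ` fv \<psi>" unfolding \<psi>'_def using fv_abstr[OF f(1), of \<psi> "\<lambda>_. 0"] par(1) by simp
  then have "fv \<psi>' \<subseteq> set w'" using f(2) par(2) by (metis image_mono set_map)
  then have 1: "\<psi>' \<in> formulas S (set w') {}"
    using par(3) by (simp add: \<psi>'_def formulas_def wf_abstr params_abstr)
  have "holds S w' a \<psi>' \<longleftrightarrow> holds S w a \<psi>" if a: "length a = length w" for a
  proof -
    have "sat_in S UNIV (env w' a) \<psi>' = sat_in S UNIV (\<lambda>u. env w' a (f u)) \<psi>"
      unfolding \<psi>'_def using f par by (intro sat_in_abstr) auto
    also have "\<dots> = sat_in S UNIV (env w a) \<psi>"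
    proof (rule sat_in_cong)
      fix v assume "v \<in> fv \<psi>"
      then obtain i where i: "i < length w" "v = w ! i"
        using assms(4) by (auto simp: formulas_def subset_iff in_set_conv_nth)
      then have "f v = w' ! i" using f(2) by (metis nth_map)
      then show "env w' a (f v) = env w a v"
        using i a assms env_nth[of w' a i] env_nth[of w a i] by simp
    qed
    finally show ?thesis by (simp add: holds_def)
  qed
  then show thesis using 1 that by blast
qed

lemma holds_abstract_params:
  assumes "distinct w" "\<psi> \<in> formulas S (set w) A"
  obtains c \<psi>' where "set c \<subseteq> A" "\<psi>' \<in> formulas S {..<length w + length c} {}"
    "\<And>a. length a = length w \<Longrightarrow> holds S [0..<length w + length c] (a @ c) \<psi>' \<longleftrightarrow> holds S w a \<psi>"
proof -
  obtain c where c: "set c = params \<psi>" "distinct c"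
    using finite_distinct_list[OF finite_params[of \<psi>]] by metis
  define idx where "idx = the_inv_into {..<length c} ((!) c)"
  have idx: "idx (c ! i) = i" if "i < length c" for i
  proof -
    have "inj_on ((!) c) {..<length c}" using c(2) by (simp add: inj_on_nth)
    then show ?thesis unfolding idx_def using the_inv_into_f_f[of "(!) c" "{..<length c}" i] that by simp
  qed
  \<comment> \<open>Variables become even and parameters odd, which excludes captures. A second
    renaming then brings the variables to an initial segment.\<close>
  define f :: "nat \<Rightarrow> nat" where "f v = 2 * v" for v
  define g where "g p = Suc (2 * idx p)" for p
  have fg: "inj f" "g m \<noteq> f v" for m v
    by (simp_all add: inj_def f_def g_def) presburger
  define w' where "w' = map f w @ map g c"
  have "inj_on g (set c)"
  proof (rule inj_onI)
    fix m m' assume "m \<in> set c" "m' \<in> set c" "g m = g m'"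
    then show "m = m'" using idx by (auto simp: g_def in_set_conv_nth)
  qed
  then have "distinct (map g c)" "distinct (map f w)"
    using assms(1) c(2) by (simp_all add: distinct_map f_def inj_on_def)
  moreover have "set (map f w) \<inter> set (map g c) = {}"
    by (auto simp: f_def g_def) presburger
  ultimately have w': "distinct w'" by (simp add: w'_def)
  have "fv (abstr f g \<psi>) = f ` fv \<psi> \<union> g ` params \<psi>" by (rule fv_abstr[OF fg])
  also have "\<dots> \<subseteq> set w'"
    using assms(2) c(1) by (auto simp: w'_def formulas_def)
  finally have fm: "abstr f g \<psi> \<in> formulas S (set w') {}"
    using assms(2) by (simp add: formulas_def wf_abstr params_abstr)
  have "length w' = length [0..<length w + length c]" by (simp add: w'_def)
  then obtain \<psi>' where \<psi>': "\<psi>' \<in> formulas S (set [0..<length w + length c]) {}"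
    "\<And>a. length a = length w' \<Longrightarrow>
      holds S [0..<length w + length c] a \<psi>' \<longleftrightarrow> holds S w' a (abstr f g \<psi>)"
    using holds_rename[OF w' distinct_upt _ fm] by metis
  have "holds S w' (a @ c) (abstr f g \<psi>) \<longleftrightarrow> holds S w a \<psi>" if a: "length a = length w" for a
  proof -
    have "env w' (a @ c) (g m) = m" if "m \<in> params \<psi>" for m
    proof -
      obtain i where i: "i < length c" "m = c ! i"
        using \<open>m \<in> params \<psi>\<close> c(1) by (metis in_set_conv_nth)
      then have "w' ! (length w + i) = g m" "(a @ c) ! (length w + i) = m"
        using a by (auto simp: w'_def nth_append)
      moreover have "env w' (a @ c) (w' ! (length w + i)) = (a @ c) ! (length w + i)"
        using w' a i by (intro env_nth) (auto simp: w'_def)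
      ultimately show ?thesis by simp
    qed
    then have "sat_in S UNIV (env w' (a @ c)) (abstr f g \<psi>) =
        sat_in S UNIV (\<lambda>u. env w' (a @ c) (f u)) \<psi>"
      by (intro sat_in_abstr fg) auto
    also have "\<dots> = sat_in S UNIV (env w a) \<psi>"
    proof (rule sat_in_cong)
      fix v assume "v \<in> fv \<psi>"
      then obtain i where i: "i < length w" "v = w ! i"
        using assms(2) by (auto simp: formulas_def subset_iff in_set_conv_nth)
      then have "w' ! i = f v" "(a @ c) ! i = a ! i"
        using a by (auto simp: w'_def nth_append)
      moreover have "env w' (a @ c) (w' ! i) = (a @ c) ! i"
        using w' a i by (intro env_nth) (auto simp: w'_def)
      ultimately show "env w' (a @ c) (f v) = env w a v"
        using i a assms(1) env_nth[of w a i] by simp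
    qed
    finally show ?thesis by (simp add: holds_def)
  qed
  moreover have "set c \<subseteq> A" using c assms(2) by (auto simp: formulas_def)
  moreover have "\<psi>' \<in> formulas S {..<length w + length c} {}"
    using \<psi>'(1) by (simp add: atLeast0LessThan)
  moreover have "holds S [0..<length w + length c] (a @ c) \<psi>' \<longleftrightarrow> holds S w' (a @ c) (abstr f g \<psi>)"
    if "length a = length w" for a
    using \<psi>'(2)[of "a @ c"] that by (simp add: w'_def)
  ultimately show thesis
    by (intro that[of c \<psi>']) (assumption, assumption, blast)
qed

section \<open>Substitution of parameters\<close>

lemma eval_subst:
  "eval S e (subst_trm s t) = eval S (\<lambda>v. case s v of None \<Rightarrow> e v | Some m \<Rightarrow> m) t"
proof (induction t)
  case (Fn h ts)
  have "map (eval S e) (map (subst_trm s) ts) =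
      map (eval S (\<lambda>v. case s v of None \<Rightarrow> e v | Some m \<Rightarrow> m)) ts"
    unfolding map_map using Fn by (intro map_cong) auto
  then show ?case by (simp del: map_eq_conv map_map)
qed (auto split: option.split)

lemma sat_in_subst:
  "sat_in S D e (subst s \<psi>) = sat_in S D (\<lambda>v. case s v of None \<Rightarrow> e v | Some m \<Rightarrow> m) \<psi>"
proof (induction \<psi> arbitrary: e s)
  case (Rel r ts)
  have "map (eval S e) (map (subst_trm s) ts) =
      map (eval S (\<lambda>v. case s v of None \<Rightarrow> e v | Some m \<Rightarrow> m)) ts"
    unfolding map_map by (intro map_cong) (auto simp: eval_subst)
  then show ?case by (simp del: map_eq_conv map_map)
next
  case (Ex v p)
  have "(\<lambda>u. case (s(v := None)) u of None \<Rightarrow> (e(v := d)) u | Some m \<Rightarrow> m) =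
      (\<lambda>u. case s u of None \<Rightarrow> e u | Some m \<Rightarrow> m)(v := d)" for d
    by (auto simp: fun_eq_iff split: option.split)
  then show ?case by (simp add: Ex.IH)
qed (auto simp: eval_subst)

lemma fv_subst_trm: "fv_trm (subst_trm s t) = fv_trm t - dom s"
proof (induction t)
  case (Var v)
  then show ?case by (cases "s v") auto
next
  case (Fn h ts)
  then show ?case by auto
qed simp

lemma fv_subst: "fv (subst s \<psi>) = fv \<psi> - dom s"
proof (induction \<psi> arbitrary: s)
  case (Rel r ts)
  then show ?case by (simp add: fv_subst_trm)
next
  case (Ex v p)
  then show ?case by (simp del: fun_upd_apply) blast
qed (simp_all add: fv_subst_trm Un_Diff)

lemma params_subst_trm: "trm_params (subst_trm s t) \<subseteq> trm_params t \<union> ran s"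
proof (induction t)
  case (Var v)
  then show ?case by (auto split: option.split intro: ranI)
next
  case (Fn h ts)
  have "trm_params (subst_trm s t) \<subseteq> \<Union> (trm_params ` set ts) \<union> ran s" if "t \<in> set ts" for t
    using Fn[OF that] that by blast
  then show ?case by (simp add: UN_subset_iff)
qed auto

lemma params_subst: "params (subst s \<psi>) \<subseteq> params \<psi> \<union> ran s"
proof (induction \<psi> arbitrary: s)
  case (Eq t u)
  then show ?case using params_subst_trm[of s t] params_subst_trm[of s u] by auto
next
  case (Rel r ts)
  have "trm_params (subst_trm s t) \<subseteq> trm_params t \<union> ran s" for t :: "('b, 'a) trm"
    by (rule params_subst_trm)
  then show ?case by (simp add: UN_subset_iff) blast
next
  case (Conj p q)
  then show ?case using Conj.IH(1)[of s] Conj.IH(2)[of s] by auto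
next
  case (Ex v p)
  have "ran (s(v := None)) \<subseteq> ran s" by (auto simp: ran_def)
  then show ?case using Ex.IH[of "s(v := None)"] by (simp del: fun_upd_apply) blast
qed auto

lemma wf_subst_trm: "wf_trm S t \<Longrightarrow> wf_trm S (subst_trm s t)"
  by (induction t) (auto simp: list_all_iff split: option.split)

lemma wf_subst: "wf_fml S \<psi> \<Longrightarrow> wf_fml S (subst s \<psi>)"
  by (induction \<psi> arbitrary: s) (auto simp: list_all_iff wf_subst_trm)

lemma inst_in_formulas:
  assumes "\<psi> \<in> formulas S (X \<union> set z) {}" "length b = length z"
  shows "inst z b \<psi> \<in> formulas S X (set b)"
proof -
  have "ran (map_of (zip z b)) \<subseteq> set b"
    by (auto simp: ran_def dest!: map_of_SomeD set_zip_rightD)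
  then show ?thesis
    using assms params_subst[of "map_of (zip z b)" \<psi>]
    by (auto simp: inst_def formulas_def wf_subst fv_subst)
qed

lemma holds_inst:
  assumes "set x \<inter> set z = {}" "length a = length x" "length b = length z" "distinct x" "distinct z"
  shows "holds S x a (inst z b \<psi>) = holds S (x @ z) (a @ b) \<psi>"
proof -
  have "(\<lambda>v. case map_of (zip z b) v of None \<Rightarrow> env x a v | Some m \<Rightarrow> m) = env (x @ z) (a @ b)"
  proof
    fix v
    have 1: "map_of (zip (x @ z) (a @ b)) v =
        (case map_of (zip x a) v of None \<Rightarrow> map_of (zip z b) v | Some m \<Rightarrow> Some m)"
      using assms by (simp add: map_add_def)
    have 2: "map_of (zip x a) v = None \<or> map_of (zip z b) v = None"
      using assms by (auto simp: map_of_zip_is_None)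
    show "(case map_of (zip z b) v of None \<Rightarrow> env x a v | Some m \<Rightarrow> m) = env (x @ z) (a @ b) v"
      unfolding env_def 1 using 2 by (auto split: option.split)
  qed
  then show ?thesis by (simp add: holds_def inst_def sat_in_subst)
qed

section \<open>Definable relations\<close>

text \<open>Definability without parameters, as a property of the relation itself; outside lists of
  length \<open>n\<close> the relation is arbitrary. Parameters will always be the final block of
  the argument list.\<close>

definition dfn :: "('f, 'r, 'm) fo_structure \<Rightarrow> nat \<Rightarrow> ('m list \<Rightarrow> bool) \<Rightarrow> bool" where
  "dfn S n P \<longleftrightarrow> (\<exists>\<psi>\<in>formulas S {..<n} {}. \<forall>a. length a = n \<longrightarrow> (P a \<longleftrightarrow> holds S [0..<n] a \<psi>))"

lemma dfn_cong: "(\<And>a. length a = n \<Longrightarrow> P a \<longleftrightarrow> Q a) \<Longrightarrow> dfn S n P \<longleftrightarrow> dfn S n Q"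
  by (auto simp: dfn_def)

lemma dfn_neg: "dfn S n P \<Longrightarrow> dfn S n (\<lambda>a. \<not> P a)"
proof -
  assume "dfn S n P"
  then obtain \<psi> where "\<psi> \<in> formulas S {..<n} {}"
    "\<And>a. length a = n \<Longrightarrow> P a \<longleftrightarrow> holds S [0..<n] a \<psi>"
    by (auto simp: dfn_def)
  then show ?thesis unfolding dfn_def
    by (intro bexI[of _ "Neg \<psi>"]) (auto simp: formulas_def holds_def)
qed

lemma dfn_conj: "dfn S n P \<Longrightarrow> dfn S n Q \<Longrightarrow> dfn S n (\<lambda>a. P a \<and> Q a)"
proof -
  assume "dfn S n P" "dfn S n Q"
  then obtain \<psi> \<theta> where "\<psi> \<in> formulas S {..<n} {}" "\<theta> \<in> formulas S {..<n} {}"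
    "\<And>a. length a = n \<Longrightarrow> P a \<longleftrightarrow> holds S [0..<n] a \<psi>"
    "\<And>a. length a = n \<Longrightarrow> Q a \<longleftrightarrow> holds S [0..<n] a \<theta>"
    by (auto simp: dfn_def)
  then show ?thesis unfolding dfn_def
    by (intro bexI[of _ "Conj \<psi> \<theta>"]) (auto simp: formulas_def holds_def)
qed

lemma dfn_True: "dfn S n (\<lambda>_. True)"
  unfolding dfn_def by (intro bexI[of _ "Neg Bot"]) (auto simp: formulas_def holds_def)

text \<open>The simultaneous update of an environment that a block of existential quantifiers
  performs.\<close>

definition ovr :: "(nat \<Rightarrow> 'm) \<Rightarrow> nat list \<Rightarrow> 'm list \<Rightarrow> nat \<Rightarrow> 'm" where
  "ovr e vs d v = (case map_of (zip vs d) v of None \<Rightarrow> e v | Some m \<Rightarrow> m)"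

lemma ovr_nth: "distinct vs \<Longrightarrow> length d = length vs \<Longrightarrow> i < length vs \<Longrightarrow> ovr e vs d (vs ! i) = d ! i"
  by (simp add: ovr_def map_of_zip_nth)

lemma ovr_out: "length d = length vs \<Longrightarrow> v \<notin> set vs \<Longrightarrow> ovr e vs d v = e v"
proof -
  assume "length d = length vs" "v \<notin> set vs"
  then have "map_of (zip vs d) v = None" by (simp add: map_of_zip_is_None)
  then show ?thesis unfolding ovr_def by (simp only: option.case)
qed

lemma sat_in_Exs:
  "distinct vs \<Longrightarrow> sat_in S D e (foldr Ex vs \<psi>) \<longleftrightarrow>
    (\<exists>d. length d = length vs \<and> set d \<subseteq> D \<and> sat_in S D (ovr e vs d) \<psi>)"
proof (induction vs arbitrary: e)
  case Nil
  have "ovr e [] [] = e" by (simp add: ovr_def fun_eq_iff)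
  then show ?case by simp
next
  case (Cons v vs)
  have *: "ovr (e(v := m)) vs d = ovr e (v # vs) (m # d)" if "length d = length vs" for m d
  proof
    fix u
    show "ovr (e(v := m)) vs d u = ovr e (v # vs) (m # d) u"
    proof (cases "u = v")
      case True
      then show ?thesis using Cons.prems that ovr_out[of d vs v "e(v := m)"] by (simp add: ovr_def)
    next
      case False
      then show ?thesis by (auto simp: ovr_def split: option.split)
    qed
  qed
  have "sat_in S D e (foldr Ex (v # vs) \<psi>) \<longleftrightarrow> (\<exists>m\<in>D. \<exists>d. length d = length vs \<and> set d \<subseteq> D \<and>
      sat_in S D (ovr (e(v := m)) vs d) \<psi>)"
    using Cons by simp
  also have "\<dots> \<longleftrightarrow> (\<exists>m\<in>D. \<exists>d. length d = length vs \<and> set d \<subseteq> D \<and>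
      sat_in S D (ovr e (v # vs) (m # d)) \<psi>)"
    using * by metis
  also have "\<dots> \<longleftrightarrow> (\<exists>d. length d = length (v # vs) \<and> set d \<subseteq> D \<and> sat_in S D (ovr e (v # vs) d) \<psi>)"
    (is "?L \<longleftrightarrow> ?R")
  proof
    assume ?L
    then obtain m d where "m \<in> D" "length d = length vs" "set d \<subseteq> D"
      "sat_in S D (ovr e (v # vs) (m # d)) \<psi>" by blast
    then show ?R by (intro exI[of _ "m # d"]) simp
  next
    assume ?R
    then obtain d where d: "length d = length (v # vs)" "set d \<subseteq> D" "sat_in S D (ovr e (v # vs) d) \<psi>"
      by blast
    then obtain m d' where "d = m # d'" by (cases d) auto
    then show ?L using d by auto
  qed
  finally show ?case .
qed

lemma fv_Exs: "fv (foldr Ex vs \<psi>) = fv \<psi> - set vs"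
  by (induction vs) auto

lemma wf_Exs: "wf_fml S (foldr Ex vs \<psi>) \<longleftrightarrow> wf_fml S \<psi>"
  by (induction vs) auto

lemma params_Exs: "params (foldr Ex vs \<psi>) = params \<psi>"
  by (induction vs) auto

lemma sat_in_Conjs: "sat_in S D e (foldr Conj \<theta>s \<psi>) \<longleftrightarrow> (\<forall>\<theta>\<in>set \<theta>s. sat_in S D e \<theta>) \<and> sat_in S D e \<psi>"
  by (induction \<theta>s) auto

lemma Conjs_in_formulas:
  "foldr Conj \<theta>s \<psi> \<in> formulas S X A \<longleftrightarrow> set \<theta>s \<subseteq> formulas S X A \<and> \<psi> \<in> formulas S X A"
  by (induction \<theta>s) (auto simp: formulas_def)

text \<open>Since indices may repeat, a renaming of variables is not enough. A fresh block of
  variables is quantified existentially and equated with the selected coordinates, and the formula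
  is evaluated on that block.\<close>

lemma dfn_reindex:
  assumes "dfn S n P" "length is = n" "set is \<subseteq> {..<m}"
  shows "dfn S m (\<lambda>a. P (map ((!) a) is))"
proof -
  obtain \<psi> where \<psi>: "\<psi> \<in> formulas S {..<n} {}"
    "\<And>a. length a = n \<Longrightarrow> P a \<longleftrightarrow> holds S [0..<n] a \<psi>"
    using assms(1) by (auto simp: dfn_def)
  let ?w = "[m..<m + n]"
  have "\<psi> \<in> formulas S (set [0..<n]) {}" using \<psi>(1) by (simp add: atLeast0LessThan)
  then obtain \<psi>' where \<psi>': "\<psi>' \<in> formulas S (set ?w) {}"
    "\<And>a. length a = length [0..<n] \<Longrightarrow> holds S ?w a \<psi>' \<longleftrightarrow> holds S [0..<n] a \<psi>"
    using holds_rename[of "[0..<n]" ?w \<psi> S] by auto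
  define eqs :: "('a, 'b, 'c) fml list" where "eqs = map (\<lambda>i. Eq (Var (m + i)) (Var (is ! i))) [0..<n]"
  define \<xi> where "\<xi> = foldr Ex ?w (foldr Conj eqs \<psi>')"
  have "set eqs \<subseteq> formulas S ({..<m} \<union> set ?w) {}"
    using assms(2,3) by (auto simp: eqs_def formulas_def subset_iff)
  moreover have "\<psi>' \<in> formulas S ({..<m} \<union> set ?w) {}" using \<psi>'(1) by (auto simp: formulas_def)
  ultimately have "foldr Conj eqs \<psi>' \<in> formulas S ({..<m} \<union> set ?w) {}"
    by (simp add: Conjs_in_formulas)
  then have 1: "\<xi> \<in> formulas S {..<m} {}"
    by (auto simp: \<xi>_def formulas_def fv_Exs wf_Exs params_Exs)
  have "P (map ((!) a) is) \<longleftrightarrow> holds S [0..<m] a \<xi>" if a: "length a = m" for a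
  proof -
    let ?e = "env [0..<m] a"
    have *: "sat_in S UNIV (ovr ?e ?w d) (foldr Conj eqs \<psi>') \<longleftrightarrow> d = map ((!) a) is \<and> P d"
      if d: "length d = n" for d
    proof -
      have e1: "ovr ?e ?w d (m + i) = d ! i" if "i < n" for i
        using ovr_nth[of ?w d i ?e] that d by simp
      have e2: "ovr ?e ?w d (is ! i) = a ! (is ! i)" if "i < n" for i
      proof -
        have "is ! i < m" using assms(2,3) that by (auto simp: subset_iff)
        then show ?thesis using ovr_out[of d ?w "is ! i" ?e] d a env_upt by auto
      qed
      have "(\<forall>\<theta>\<in>set eqs. sat_in S UNIV (ovr ?e ?w d) \<theta>) \<longleftrightarrow> (\<forall>i<n. d ! i = a ! (is ! i))"
        using e1 e2 by (auto simp: eqs_def)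
      also have "\<dots> \<longleftrightarrow> d = map ((!) a) is"
        using d assms(2) by (auto simp: list_eq_iff_nth_eq)
      finally have 1: "(\<forall>\<theta>\<in>set eqs. sat_in S UNIV (ovr ?e ?w d) \<theta>) \<longleftrightarrow> d = map ((!) a) is" .
      have "sat_in S UNIV (ovr ?e ?w d) \<psi>' = sat_in S UNIV (env ?w d) \<psi>'"
      proof (rule sat_in_cong)
        fix v assume "v \<in> fv \<psi>'"
        then have "v \<in> set ?w" using \<psi>'(1) unfolding formulas_def by blast
        then obtain i where "i < n" "v = m + i" by (auto simp: le_iff_add)
        then show "ovr ?e ?w d v = env ?w d v"
          using e1 env_nth[of ?w d i] d by simp
      qed
      then have "sat_in S UNIV (ovr ?e ?w d) \<psi>' \<longleftrightarrow> P d"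
        using \<psi>'(2)[of d] \<psi>(2)[of d] d by (simp add: holds_def)
      then show ?thesis using 1 by (simp add: sat_in_Conjs)
    qed
    have "holds S [0..<m] a \<xi> \<longleftrightarrow> (\<exists>d. length d = n \<and> d = map ((!) a) is \<and> P d)"
      unfolding holds_def \<xi>_def by (subst sat_in_Exs) (simp_all add: * cong: conj_cong)
    also have "\<dots> \<longleftrightarrow> P (map ((!) a) is)" using assms(2) by (metis length_map)
    finally show ?thesis ..
  qed
  then show ?thesis using 1 by (auto simp: dfn_def)
qed

section \<open>Selections of coordinates\<close>

definition seln :: "nat \<Rightarrow> nat \<Rightarrow> ('m list \<Rightarrow> 'm list) \<Rightarrow> bool" where
  "seln m n f \<longleftrightarrow> (\<exists>is. length is = n \<and> set is \<subseteq> {..<m} \<and> (\<forall>a. length a = m \<longrightarrow> f a = map ((!) a) is))"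

lemma seln_id: "seln m m (\<lambda>a. a)"
  unfolding seln_def by (intro exI[of _ "[0..<m]"]) (auto simp: map_nth)

lemma seln_map: "length is = n \<Longrightarrow> set is \<subseteq> {..<k} \<Longrightarrow> seln m k f \<Longrightarrow> seln m n (\<lambda>a. map ((!) (f a)) is)"
proof -
  assume i: "length is = n" "set is \<subseteq> {..<k}" and "seln m k f"
  then obtain js where js: "length js = k" "set js \<subseteq> {..<m}" "\<And>a. length a = m \<Longrightarrow> f a = map ((!) a) js"
    by (auto simp: seln_def)
  have "set (map ((!) js) is) \<subseteq> {..<m}" using js(1,2) i by (force simp: subset_iff)
  moreover have "map ((!) (f a)) is = map ((!) a) (map ((!) js) is)" if "length a = m" for a
    using js i that by (auto simp: subset_iff)
  ultimately show ?thesis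
    unfolding seln_def using i by (intro exI[of _ "map ((!) js) is"]) auto
qed

lemma seln_cong: "(\<And>a. length a = m \<Longrightarrow> f a = g a) \<Longrightarrow> seln m n f = seln m n g"
  by (auto simp: seln_def)

lemma seln_length: "seln m n f \<Longrightarrow> length a = m \<Longrightarrow> length (f a) = n"
  by (auto simp: seln_def)

lemma seln_take: "seln m n f \<Longrightarrow> k \<le> n \<Longrightarrow> seln m k (\<lambda>a. take k (f a))"
proof -
  assume f: "seln m n f" and "k \<le> n"
  then have "seln m k (\<lambda>a. map ((!) (f a)) [0..<k])" by (intro seln_map[where k = n]) auto
  moreover have "seln m k (\<lambda>a. map ((!) (f a)) [0..<k]) = seln m k (\<lambda>a. take k (f a))"
    using seln_length[OF f] \<open>k \<le> n\<close> by (intro seln_cong nth_equalityI) auto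
  ultimately show ?thesis by blast
qed

lemma seln_drop: "seln m n f \<Longrightarrow> seln m (n - k) (\<lambda>a. drop k (f a))"
proof -
  assume f: "seln m n f"
  then have "seln m (n - k) (\<lambda>a. map ((!) (f a)) [k..<n])" by (intro seln_map[where k = n]) auto
  moreover have "seln m (n - k) (\<lambda>a. map ((!) (f a)) [k..<n]) = seln m (n - k) (\<lambda>a. drop k (f a))"
    using seln_length[OF f] by (intro seln_cong nth_equalityI) auto
  ultimately show ?thesis by blast
qed

lemma seln_append: "seln m n f \<Longrightarrow> seln m n' g \<Longrightarrow> seln m (n + n') (\<lambda>a. f a @ g a)"
proof -
  assume "seln m n f" "seln m n' g"
  then obtain "is" js where "length is = n" "set is \<subseteq> {..<m}" "\<And>a. length a = m \<Longrightarrow> f a = map ((!) a) is"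
    "length js = n'" "set js \<subseteq> {..<m}" "\<And>a. length a = m \<Longrightarrow> g a = map ((!) a) js"
    by (auto simp: seln_def)
  then show ?thesis unfolding seln_def by (intro exI[of _ "is @ js"]) auto
qed

lemmas seln_intros = seln_id seln_append seln_take seln_drop

text \<open>With \<open>seln_intros\<close>, the definability of a relation on rearranged blocks of
  a list reduces to arithmetic of lengths.\<close>

lemma dfn_sel: "dfn S n P \<Longrightarrow> seln m n' f \<Longrightarrow> n' = n \<Longrightarrow> dfn S m (\<lambda>a. P (f a))"
proof -
  assume P: "dfn S n P" and "seln m n' f" "n' = n"
  then obtain "is" where i: "length is = n" "set is \<subseteq> {..<m}" "\<And>a. length a = m \<Longrightarrow> f a = map ((!) a) is"
    by (auto simp: seln_def)
  then have "dfn S m (\<lambda>a. P (f a)) \<longleftrightarrow> dfn S m (\<lambda>a. P (map ((!) a) is))"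
    by (intro dfn_cong) auto
  then show ?thesis using dfn_reindex[OF P i(1,2)] by blast
qed

lemma formula_dfn:
  assumes "distinct x" "\<psi> \<in> formulas S (set x) A"
  obtains c P where "set c \<subseteq> A" "dfn S (length x + length c) P"
    "\<And>a. length a = length x \<Longrightarrow> holds S x a \<psi> \<longleftrightarrow> P (a @ c)"
proof -
  obtain c \<psi>' where "set c \<subseteq> A" "\<psi>' \<in> formulas S {..<length x + length c} {}"
    "\<And>a. length a = length x \<Longrightarrow> holds S [0..<length x + length c] (a @ c) \<psi>' \<longleftrightarrow> holds S x a \<psi>"
    using holds_abstract_params[OF assms] by metis
  then show thesis
    by (intro that[of c "\<lambda>a. holds S [0..<length x + length c] a \<psi>'"]) (auto simp: dfn_def)
qed

lemma dfn_inst: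
  assumes "dfn S (length x + length z) P" "distinct x" "distinct z" "set x \<inter> set z = {}"
  obtains \<psi> where "\<psi> \<in> formulas S (set x \<union> set z) {}"
    "\<And>a b. length a = length x \<Longrightarrow> length b = length z \<Longrightarrow> holds S x a (inst z b \<psi>) \<longleftrightarrow> P (a @ b)"
proof -
  let ?n = "length x + length z"
  obtain \<psi> where \<psi>: "\<psi> \<in> formulas S {..<?n} {}" "\<And>a. length a = ?n \<Longrightarrow> P a \<longleftrightarrow> holds S [0..<?n] a \<psi>"
    using assms(1) by (auto simp: dfn_def)
  have 1: "\<psi> \<in> formulas S (set [0..<?n]) {}" using \<psi>(1) by (simp add: atLeast0LessThan)
  have 2: "distinct (x @ z)" using assms by simp
  obtain \<psi>' where \<psi>': "\<psi>' \<in> formulas S (set (x @ z)) {}"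
    "\<And>a. length a = length [0..<?n] \<Longrightarrow> holds S (x @ z) a \<psi>' \<longleftrightarrow> holds S [0..<?n] a \<psi>"
    using holds_rename[OF distinct_upt 2 _ 1] by auto
  show thesis
  proof (rule that)
    show "\<psi>' \<in> formulas S (set x \<union> set z) {}" using \<psi>'(1) by simp
    fix a b :: "'c list" assume "length a = length x" "length b = length z"
    then show "holds S x a (inst z b \<psi>') \<longleftrightarrow> P (a @ b)"
      using \<psi>'(2)[of "a @ b"] \<psi>(2)[of "a @ b"] holds_inst[OF assms(4), where S = S and a = a and b = b and \<psi> = \<psi>'] assms(2,3) by simp
  qed
qed

lemma ex_fresh_vars:
  fixes x :: "nat list"
  obtains z where "distinct z" "length z = m" "set x \<inter> set z = {}"
proof -
  define K where "K = Suc (Max (insert 0 (set x)))"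
  have "v < K" if "v \<in> set x" for v
    using that by (simp add: K_def less_Suc_eq_le)
  then show thesis by (intro that[of "[K..<K + m]"]) fastforce+
qed

lemma dfn_formula:
  assumes "dfn S (length x + length c) P" "distinct x"
  obtains \<psi> where "\<psi> \<in> formulas S (set x) (set c)"
    "\<And>a. length a = length x \<Longrightarrow> holds S x a \<psi> \<longleftrightarrow> P (a @ c)"
proof -
  obtain z where z: "distinct z" "length z = length c" "set x \<inter> set z = {}"
    using ex_fresh_vars by blast
  have "dfn S (length x + length z) P" using assms(1) z(2) by simp
  then obtain \<psi> where \<psi>: "\<psi> \<in> formulas S (set x \<union> set z) {}"
    "\<And>a b. length a = length x \<Longrightarrow> length b = length z \<Longrightarrow> holds S x a (inst z b \<psi>) \<longleftrightarrow> P (a @ b)"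
    using dfn_inst[OF _ assms(2) z(1,3)] by metis
  show thesis
    using inst_in_formulas[OF \<psi>(1), of c] \<psi>(2)[of _ c] z(2) by (intro that[of "inst z c \<psi>"]) auto
qed

section \<open>Types as families of definable relations\<close>

definition eqv :: "('f, 'r, 'm) fo_structure \<Rightarrow> 'm set \<Rightarrow> 'm list \<Rightarrow> 'm list \<Rightarrow> bool" where
  "eqv S A a b \<longleftrightarrow> length a = length b \<and>
    (\<forall>c P. set c \<subseteq> A \<and> dfn S (length a + length c) P \<longrightarrow> (P (a @ c) \<longleftrightarrow> P (b @ c)))"

lemma equiv_over_iff_eqv: "equiv_over S A a b \<longleftrightarrow> eqv S A a b"
proof
  assume e: "equiv_over S A a b"
  let ?x = "[0..<length a]"
  have l: "length a = length b" using e by (simp add: equiv_over_def)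
  have "P (a @ c) \<longleftrightarrow> P (b @ c)" if c: "set c \<subseteq> A" "dfn S (length a + length c) P" for c P
  proof -
    obtain \<psi> where \<psi>: "\<psi> \<in> formulas S (set ?x) (set c)"
      "\<And>a'. length a' = length a \<Longrightarrow> holds S ?x a' \<psi> \<longleftrightarrow> P (a' @ c)"
      using dfn_formula[of S ?x c P] c(2) by auto
    then have "\<psi> \<in> formulas S (set ?x) A" using c(1) by (auto simp: formulas_def)
    then have "holds S ?x a \<psi> \<longleftrightarrow> holds S ?x b \<psi>"
      using e l by (auto simp: equiv_over_def tp_def)
    then show ?thesis using \<psi>(2) l by simp
  qed
  then show "eqv S A a b" using l by (simp add: eqv_def)
next
  assume e: "eqv S A a b"
  let ?x = "[0..<length a]"
  have l: "length a = length b" using e by (simp add: eqv_def)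
  have "holds S ?x a \<psi> \<longleftrightarrow> holds S ?x b \<psi>" if "\<psi> \<in> formulas S (set ?x) A" for \<psi>
  proof -
    obtain c P where c: "set c \<subseteq> A" "dfn S (length ?x + length c) P"
      "\<And>a. length a = length ?x \<Longrightarrow> holds S ?x a \<psi> \<longleftrightarrow> P (a @ c)"
      using formula_dfn[OF distinct_upt \<open>\<psi> \<in> _\<close>] by metis
    then show ?thesis using e l by (simp add: eqv_def)
  qed
  then show "equiv_over S A a b" using l by (auto simp: equiv_over_def tp_def)
qed

text \<open>The ideal carried over from formulas to arbitrary sets of tuples: a set is small if a
  formula of the ideal covers it. For definable sets nothing changes, because an ideal is closed
  under implication.\<close>

definition small_of ::
    "('f, 'r, 'm) fo_structure \<Rightarrow> nat list \<Rightarrow> ('f, 'r, 'm) fml set \<Rightarrow> ('m list \<Rightarrow> bool) \<Rightarrow> bool" where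
  "small_of S x I P \<longleftrightarrow> (\<exists>\<theta>\<in>I. \<forall>a. length a = length x \<and> P a \<longrightarrow> holds S x a \<theta>)"

text \<open>The sort enters only through \<open>n\<close> and \<open>\<sigma>\<close>, so that one
  development serves both \<open>x\<close> and \<open>y\<close>.\<close>

definition wide ::
    "('f, 'r, 'm) fo_structure \<Rightarrow> nat \<Rightarrow> (('m list \<Rightarrow> bool) \<Rightarrow> bool) \<Rightarrow> 'm set \<Rightarrow> 'm list \<Rightarrow> bool" where
  "wide S n \<sigma> A a \<longleftrightarrow> length a = n \<and>
    (\<forall>c P. set c \<subseteq> A \<and> dfn S (n + length c) P \<and> P (a @ c) \<longrightarrow> \<not> \<sigma> (\<lambda>a'. P (a' @ c)))"

text \<open>A complete type is closed under finite conjunctions, so implying a formula of the ideal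
  amounts to containing a single formula that defines a small set.\<close>

lemma wide_tuple_iff:
  assumes "distinct x"
  shows "wide_tuple S x I A a \<longleftrightarrow> wide S (length x) (small_of S x I) A a"
proof
  assume w: "wide_tuple S x I A a"
  have "\<not> small_of S x I (\<lambda>a'. P (a' @ c))"
    if c: "set c \<subseteq> A" "dfn S (length x + length c) P" "P (a @ c)" for c P
  proof
    assume "small_of S x I (\<lambda>a'. P (a' @ c))"
    then obtain \<theta> where \<theta>: "\<theta> \<in> I" "\<And>a. length a = length x \<Longrightarrow> P (a @ c) \<Longrightarrow> holds S x a \<theta>"
      by (auto simp: small_of_def)
    obtain \<psi> where \<psi>: "\<psi> \<in> formulas S (set x) (set c)"
      "\<And>a. length a = length x \<Longrightarrow> holds S x a \<psi> \<longleftrightarrow> P (a @ c)"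
      using dfn_formula[OF c(2) assms] by metis
    have "\<psi> \<in> tp S x a A" using \<psi> c w by (auto simp: tp_def formulas_def wide_tuple_def)
    then have "implies S x (tp S x a A) \<theta>"
      unfolding implies_def using \<psi>(2) \<theta>(2) by (intro exI[of _ "{\<psi>}"]) auto
    then show False using w \<theta>(1) by (auto simp: wide_tuple_def wide_type_def)
  qed
  then show "wide S (length x) (small_of S x I) A a" using w by (auto simp: wide_def wide_tuple_def)
next
  assume w: "wide S (length x) (small_of S x I) A a"
  have "\<not> implies S x (tp S x a A) \<theta>" if "\<theta> \<in> I" for \<theta>
  proof
    assume "implies S x (tp S x a A) \<theta>"
    then obtain q where q: "finite q" "q \<subseteq> tp S x a A"
      "\<And>a. length a = length x \<Longrightarrow> \<forall>\<psi>\<in>q. holds S x a \<psi> \<Longrightarrow> holds S x a \<theta>"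
      by (auto simp: implies_def)
    obtain \<psi>s where \<psi>s: "set \<psi>s = q" using finite_list[OF q(1)] by blast
    define \<xi> where "\<xi> = foldr Conj \<psi>s (Neg Bot)"
    have \<xi>: "\<xi> \<in> formulas S (set x) A"
      unfolding \<xi>_def Conjs_in_formulas using q(2) \<psi>s by (auto simp: tp_def formulas_def)
    have h: "holds S x a \<xi> \<longleftrightarrow> (\<forall>\<psi>\<in>q. holds S x a \<psi>)" for a
      using \<psi>s by (simp add: holds_def \<xi>_def sat_in_Conjs)
    obtain c P where c: "set c \<subseteq> A" "dfn S (length x + length c) P"
      "\<And>a. length a = length x \<Longrightarrow> holds S x a \<xi> \<longleftrightarrow> P (a @ c)"
      using formula_dfn[OF assms \<xi>] by metis
    have "holds S x a \<xi>" using h q(2) by (auto simp: tp_def)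
    then have "P (a @ c)" using c(3) w by (simp add: wide_def)
    then have "\<not> small_of S x I (\<lambda>a'. P (a' @ c))" using w c by (auto simp: wide_def)
    moreover have "small_of S x I (\<lambda>a'. P (a' @ c))"
      unfolding small_of_def using \<open>\<theta> \<in> I\<close> q(3) h c(3) by (intro bexI[of _ \<theta>]) auto
    ultimately show False by blast
  qed
  then show "wide_tuple S x I A a" using w by (auto simp: wide_tuple_def wide_type_def wide_def)
qed

section \<open>Saturation and elementarity for definable relations\<close>

lemma saturated_realizes:
  assumes "saturated S \<kappa>" "|A| <o \<kappa>"
    and \<Gamma>: "\<And>P c. (P, c) \<in> \<Gamma> \<Longrightarrow> set c \<subseteq> A \<and> dfn S (n + length c) P"
    and fin: "\<And>\<Delta>. finite \<Delta> \<Longrightarrow> \<Delta> \<subseteq> \<Gamma> \<Longrightarrow> \<exists>a. length a = n \<and> (\<forall>(P, c)\<in>\<Delta>. P (a @ c))"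
  shows "\<exists>a. length a = n \<and> (\<forall>(P, c)\<in>\<Gamma>. P (a @ c))"
proof -
  let ?x = "[0..<n]"
  define expr where "expr \<psi> Pc \<longleftrightarrow> (\<forall>a. length a = n \<longrightarrow> (holds S ?x a \<psi> \<longleftrightarrow> fst Pc (a @ snd Pc)))" for \<psi> Pc
  define p where "p = {\<psi> \<in> formulas S {..<n} A. \<exists>Pc\<in>\<Gamma>. expr \<psi> Pc}"
  have "consistent S ?x p"
    unfolding consistent_def
  proof (intro allI impI)
    fix q assume q: "finite q \<and> q \<subseteq> p"
    then have "\<forall>\<psi>\<in>q. \<exists>Pc. Pc \<in> \<Gamma> \<and> expr \<psi> Pc" by (force simp: p_def)
    then obtain f where f: "\<And>\<psi>. \<psi> \<in> q \<Longrightarrow> f \<psi> \<in> \<Gamma> \<and> expr \<psi> (f \<psi>)" by metis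
    have "finite (f ` q)" "f ` q \<subseteq> \<Gamma>" using q f by auto
    then obtain a where a: "length a = n" "\<And>Pc. Pc \<in> f ` q \<Longrightarrow> fst Pc (a @ snd Pc)"
      using fin[of "f ` q"] unfolding case_prod_unfold by blast
    have "holds S ?x a \<psi>" if "\<psi> \<in> q" for \<psi>
      using f[OF that] a(1) a(2)[of "f \<psi>"] that by (auto simp: expr_def)
    then show "\<exists>a. length a = length ?x \<and> (\<forall>\<psi>\<in>q. holds S ?x a \<psi>)" using a(1) by auto
  qed
  moreover have "p \<subseteq> formulas S {..<n} A" by (auto simp: p_def)
  ultimately obtain a where a: "length a = n" "\<forall>\<psi>\<in>p. holds S ?x a \<psi>"
    using assms(1,2) unfolding saturated_def by blast
  have "P (a @ c)" if Pc: "(P, c) \<in> \<Gamma>" for P c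
  proof -
    obtain \<psi> where \<psi>: "\<psi> \<in> formulas S (set ?x) (set c)"
      "\<And>a. length a = length ?x \<Longrightarrow> holds S ?x a \<psi> \<longleftrightarrow> P (a @ c)"
      using dfn_formula[of S ?x c P] \<Gamma>[OF Pc] by auto
    have "expr \<psi> (P, c)" using \<psi>(2) by (simp add: expr_def)
    moreover have "\<psi> \<in> formulas S {..<n} A"
      using \<Gamma>[OF Pc] \<psi>(1) by (auto simp: formulas_def)
    ultimately have "\<psi> \<in> p" using Pc by (auto simp: p_def)
    then show ?thesis using a \<psi>(2) by auto
  qed
  then show ?thesis using a(1) by auto
qed

text \<open>The Tarski-Vaught property for tuples: the existential closure over the first block is
  true in the monster, hence in \<open>M\<close>, and the witnesses found in \<open>M\<close>
  satisfy the matrix in the monster again.\<close>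

lemma elementary_realizes:
  assumes M: "elementary_substructure S M" and P: "dfn S (length b + length c) P"
    and c: "set c \<subseteq> M" and b: "P (b @ c)"
  obtains d where "length d = length b" "set d \<subseteq> M" "P (d @ c)"
proof -
  let ?n = "length b" and ?N = "length b + length c"
  obtain m0 where m0: "m0 \<in> M" using M by (auto simp: elementary_substructure_def)
  obtain \<psi> where \<psi>: "\<psi> \<in> formulas S {..<?N} {}" "\<And>a. length a = ?N \<Longrightarrow> P a \<longleftrightarrow> holds S [0..<?N] a \<psi>"
    using P by (auto simp: dfn_def)
  \<comment> \<open>Outside the parameter block the value does not matter; the default
    \<open>m0\<close> only keeps the environment inside \<open>M\<close>.\<close>
  define e where "e v = (if v \<ge> ?n \<and> v < ?N then c ! (v - ?n) else m0)" for v
  have el: "sat_in S M e' \<theta> \<longleftrightarrow> sat_in S UNIV e' \<theta>" if "\<theta> \<in> formulas S UNIV {}" "range e' \<subseteq> M" for e' \<theta>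
    using M that unfolding elementary_substructure_def by blast
  have re: "range e \<subseteq> M" using m0 c by (auto simp: e_def subset_iff)
  let ?\<xi> = "foldr Ex [0..<?n] \<psi>"
  have fm: "\<psi> \<in> formulas S UNIV {}" "?\<xi> \<in> formulas S UNIV {}"
    using \<psi>(1) by (auto simp: formulas_def wf_Exs params_Exs)
  have o: "sat_in S UNIV (ovr e [0..<?n] d) \<psi> \<longleftrightarrow> P (d @ c)" if d: "length d = ?n" for d
  proof -
    have "sat_in S UNIV (ovr e [0..<?n] d) \<psi> = sat_in S UNIV (env [0..<?N] (d @ c)) \<psi>"
    proof (rule sat_in_cong)
      fix v assume "v \<in> fv \<psi>"
      then have v: "v < ?N" using \<psi>(1) by (auto simp: formulas_def)
      show "ovr e [0..<?n] d v = env [0..<?N] (d @ c) v"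
      proof (cases "v < ?n")
        case True
        then show ?thesis
          using ovr_nth[of "[0..<?n]" d v e] env_upt[of "d @ c" ?N v] d v by (simp add: nth_append)
      next
        case False
        then show ?thesis
          using ovr_out[of d "[0..<?n]" v e] env_upt[of "d @ c" ?N v] d v by (simp add: nth_append e_def)
      qed
    qed
    then show ?thesis using \<psi>(2)[of "d @ c"] d by (simp add: holds_def)
  qed
  have "sat_in S UNIV e ?\<xi>"
    using o[of b] b by (subst sat_in_Exs) auto
  then have "sat_in S M e ?\<xi>" using el[OF fm(2) re] by blast
  then obtain d where d: "length d = ?n" "set d \<subseteq> M" "sat_in S M (ovr e [0..<?n] d) \<psi>"
    by (subst (asm) sat_in_Exs) auto
  have "range (ovr e [0..<?n] d) \<subseteq> M"
  proof
    fix u assume "u \<in> range (ovr e [0..<?n] d)"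
    then obtain v where u: "u = ovr e [0..<?n] d v" by auto
    show "u \<in> M"
    proof (cases "v < ?n")
      case True
      then show ?thesis using ovr_nth[of "[0..<?n]" d v e] d(1,2) u by auto
    next
      case False
      then show ?thesis using ovr_out[of d "[0..<?n]" v e] d(1) u re by auto
    qed
  qed
  then have "sat_in S UNIV (ovr e [0..<?n] d) \<psi>" using el[OF fm(1)] d(3) by blast
  then show thesis using that d o by blast
qed

section \<open>Calculus of types\<close>

lemma eqv_refl: "eqv S A a a"
  by (simp add: eqv_def)

lemma eqv_sym: "eqv S A a b \<Longrightarrow> eqv S A b a"
  unfolding eqv_def by metis

lemma eqv_trans: "eqv S A a b \<Longrightarrow> eqv S A b c \<Longrightarrow> eqv S A a c"
  unfolding eqv_def by metis

lemma eqv_length: "eqv S A a b \<Longrightarrow> length a = length b"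
  by (simp add: eqv_def)

lemma eqv_mono: "eqv S B a b \<Longrightarrow> A \<subseteq> B \<Longrightarrow> eqv S A a b"
  unfolding eqv_def by (meson order_trans)

lemma eqvD: "eqv S A a b \<Longrightarrow> set c \<subseteq> A \<Longrightarrow> dfn S (length a + length c) P \<Longrightarrow> P (a @ c) \<longleftrightarrow> P (b @ c)"
  by (simp add: eqv_def)

lemma eqvD0: "eqv S A a b \<Longrightarrow> dfn S (length a) P \<Longrightarrow> P a \<longleftrightarrow> P b"
  using eqvD[of S A a b "[]" P] by simp

text \<open>Since definable relations are closed under negation, an inclusion of types is an equality.\<close>

lemma eqvI:
  assumes "length a = length b"
    and imp: "\<And>c P. set c \<subseteq> A \<Longrightarrow> dfn S (length a + length c) P \<Longrightarrow> P (a @ c) \<Longrightarrow> P (b @ c)"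
  shows "eqv S A a b"
  unfolding eqv_def
proof (intro conjI allI impI)
  fix c P assume c: "set c \<subseteq> A \<and> dfn S (length a + length c) P"
  show "P (a @ c) \<longleftrightarrow> P (b @ c)"
    using imp[of c P] imp[of c "\<lambda>l. \<not> P l"] c dfn_neg by blast
qed (rule assms(1))

lemma eqv_append_params: "eqv S A a b \<Longrightarrow> set w \<subseteq> A \<Longrightarrow> eqv S A (a @ w) (b @ w)"
proof (rule eqvI)
  fix c P assume *: "eqv S A a b" "set w \<subseteq> A" "set c \<subseteq> A"
    "dfn S (length (a @ w) + length c) P" "P ((a @ w) @ c)"
  then show "P ((b @ w) @ c)"
    using eqvD[of S A a b "w @ c" P] by (simp add: add.assoc)
qed (simp add: eqv_def)

lemma eqv_sel:
  assumes "eqv S A a b" "seln (length a) n f"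
  shows "eqv S A (f a) (f b)"
proof (rule eqvI)
  have l: "length (f a) = n" "length (f b) = n" "length b = length a"
    using assms seln_length eqv_length by metis+
  then show "length (f a) = length (f b)" by simp
  fix c P assume *: "set c \<subseteq> A" "dfn S (length (f a) + length c) P" "P (f a @ c)"
  let ?k = "length a" and ?m = "length c"
  have s: "seln (?k + ?m) n (\<lambda>l. f (take ?k l))"
  proof -
    obtain "is" where i: "length is = n" "set is \<subseteq> {..<?k}" "\<And>a'. length a' = ?k \<Longrightarrow> f a' = map ((!) a') is"
      using assms(2) by (auto simp: seln_def)
    have "seln (?k + ?m) n (\<lambda>l :: 'c list. map ((!) (take ?k l)) is)"
      by (rule seln_map[OF i(1,2) seln_take[OF seln_id]]) simp
    moreover have "seln (?k + ?m) n (\<lambda>l :: 'c list. map ((!) (take ?k l)) is) = seln (?k + ?m) n (\<lambda>l. f (take ?k l))"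
      by (rule seln_cong) (simp add: i(3))
    ultimately show ?thesis by blast
  qed
  have "dfn S (?k + ?m) (\<lambda>l. P (f (take ?k l) @ drop ?k l))"
    by (rule dfn_sel[OF *(2)], (rule s seln_intros | simp add: l)+)
  from eqvD[OF assms(1) *(1) this] show "P (f b @ c)" using *(3) l by simp
qed

text \<open>Concatenating the parameter lists merges finitely many conditions into one, which is the
  form in which compactness arguments use them.\<close>

lemma finite_conj_dfn:
  assumes "finite \<Delta>" "\<And>P c. (P, c) \<in> \<Delta> \<Longrightarrow> set c \<subseteq> A \<and> dfn S (n + length c) P"
  shows "\<exists>d R. set d \<subseteq> A \<and> dfn S (n + length d) R \<and>
    (\<forall>y. length y = n \<longrightarrow> (R (y @ d) \<longleftrightarrow> (\<forall>(P, c)\<in>\<Delta>. P (y @ c))))"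
  using assms
proof (induction \<Delta> rule: finite_induct)
  case empty
  show ?case by (intro exI[of _ "[]"] exI[of _ "\<lambda>_. True"]) (simp add: dfn_True)
next
  case (insert Pc \<Delta>)
  obtain P c where Pc: "Pc = (P, c)" by fastforce
  obtain d R where d: "set d \<subseteq> A" "dfn S (n + length d) R"
    "\<And>y. length y = n \<Longrightarrow> R (y @ d) \<longleftrightarrow> (\<forall>(P, c)\<in>\<Delta>. P (y @ c))"
    using insert by blast
  have c: "set c \<subseteq> A" "dfn S (n + length c) P" using insert.prems Pc by auto
  let ?R = "\<lambda>l. P (take (n + length c) l) \<and> R (take n l @ drop (n + length c) l)"
  have "dfn S (n + length (c @ d)) ?R"
    by (rule dfn_conj dfn_sel[OF c(2)] dfn_sel[OF d(2)] seln_intros | simp)+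
  moreover have "?R (y @ c @ d) \<longleftrightarrow> (\<forall>(P, c)\<in>insert Pc \<Delta>. P (y @ c))" if "length y = n" for y
    using d(3)[OF that] that Pc by simp
  ultimately show ?case using c d by (intro exI[of _ "c @ d"] exI[of _ ?R]) auto
qed

lemma wide_mono: "wide S n \<sigma> B a \<Longrightarrow> A \<subseteq> B \<Longrightarrow> wide S n \<sigma> A a"
  unfolding wide_def by (meson order_trans)

lemma wide_length: "wide S n \<sigma> A a \<Longrightarrow> length a = n"
  by (simp add: wide_def)

lemma wideD: "wide S n \<sigma> A a \<Longrightarrow> set c \<subseteq> A \<Longrightarrow> dfn S (n + length c) P \<Longrightarrow> P (a @ c) \<Longrightarrow> \<not> \<sigma> (\<lambda>a'. P (a' @ c))"
  by (simp add: wide_def)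

section \<open>S1 ideals, semantically\<close>

text \<open>The properties of an S1 ideal that the proof works with. Smallness passes to arbitrary
  subsets, whereas invariance and S1 are about definable sets only.\<close>

locale S1_small =
  fixes S :: "('f, 'r, 'm) fo_structure" and n :: nat and \<sigma> :: "('m list \<Rightarrow> bool) \<Rightarrow> bool"
  assumes small_empty: "\<sigma> (\<lambda>_. False)"
    and small_un: "\<sigma> P \<Longrightarrow> \<sigma> Q \<Longrightarrow> \<sigma> (\<lambda>a. P a \<or> Q a)"
    and small_mono: "\<sigma> P \<Longrightarrow> (\<And>a. length a = n \<Longrightarrow> Q a \<Longrightarrow> P a) \<Longrightarrow> \<sigma> Q"
    and small_inv: "dfn S (n + length b) P \<Longrightarrow> eqv S {} b b' \<Longrightarrow>
      \<sigma> (\<lambda>a. P (a @ b)) \<Longrightarrow> \<sigma> (\<lambda>a. P (a @ b'))"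
    and small_S1: "dfn S (n + m) P \<Longrightarrow> (\<And>i. length (c i) = m) \<Longrightarrow> indiscernible S {} c \<Longrightarrow>
      \<sigma> (\<lambda>a. P (a @ c 0) \<and> P (a @ c 1)) \<Longrightarrow> \<sigma> (\<lambda>a. P (a @ c 0))"
begin

lemma small_cong: "(\<And>a. length a = n \<Longrightarrow> P a \<longleftrightarrow> Q a) \<Longrightarrow> \<sigma> P \<longleftrightarrow> \<sigma> Q"
  using small_mono by blast

lemma small_finite_union: "finite \<Delta> \<Longrightarrow> (\<And>t. t \<in> \<Delta> \<Longrightarrow> \<sigma> (Q t)) \<Longrightarrow> \<sigma> (\<lambda>a. \<exists>t\<in>\<Delta>. Q t a)"
proof (induction \<Delta> rule: finite_induct)
  case empty
  then show ?case using small_empty by simp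
next
  case (insert t \<Delta>)
  have "\<sigma> (\<lambda>a. Q t a \<or> (\<exists>t\<in>\<Delta>. Q t a))" using insert by (intro small_un) auto
  then show ?case by simp
qed

text \<open>Iterating S1 along the blocks \<open>c\<^sub>2\<^sub>i c\<^sub>2\<^sub>i\<^sub>+\<^sub>1\<close> doubles the number of conjuncts.\<close>

lemma S1_pow:
  assumes "dfn S (n + m) P" "\<And>i. length (c i) = m" "indiscernible S {} c" "\<not> \<sigma> (\<lambda>a. P (a @ c 0))"
  shows "\<not> \<sigma> (\<lambda>a. \<forall>j<2 ^ k. P (a @ c j))"
  using assms
proof (induction k arbitrary: m P c)
  case 0
  then show ?case by simp
next
  case (Suc k)
  define c' where "c' i = c (2 * i) @ c (2 * i + 1)" for i
  define P' where "P' l \<longleftrightarrow> P (take (n + m) l) \<and> P (take n l @ drop (n + m) l)" for l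
  have P': "dfn S (n + (m + m)) P'"
    unfolding P'_def
    by (rule dfn_conj dfn_sel[OF Suc.prems(1)] seln_intros | simp)+
  have P'_iff: "P' (a @ c' i) \<longleftrightarrow> P (a @ c (2 * i)) \<and> P (a @ c (2 * i + 1))" if "length a = n" for a i
    using that Suc.prems(2) by (simp add: P'_def c'_def)
  have "indiscernible S {} c'"
    unfolding indiscernible_def
  proof (intro conjI allI impI)
    show "length (c' i) = length (c' j)" for i j by (simp add: c'_def Suc.prems(2))
    fix "is" js :: "nat list"
    define dbl :: "nat list \<Rightarrow> nat list" where "dbl l = concat (map (\<lambda>i. [2 * i, 2 * i + 1]) l)" for l
    have dbl: "concat (map c' l) = concat (map c (dbl l))" for l
      by (induction l) (auto simp: dbl_def c'_def)
    have "sorted_wrt (<) (dbl l)" if "sorted_wrt (<) l" for l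
      using that by (induction l) (fastforce simp: dbl_def)+
    moreover have "length (dbl l) = 2 * length l" for l
      by (induction l) (auto simp: dbl_def)
    moreover assume "sorted_wrt (<) is \<and> sorted_wrt (<) js \<and> length is = length js"
    ultimately show "equiv_over S {} (concat (map c' is)) (concat (map c' js))"
      using Suc.prems(3) unfolding indiscernible_def dbl by simp
  qed
  moreover have "\<not> \<sigma> (\<lambda>a. P' (a @ c' 0))"
  proof
    assume "\<sigma> (\<lambda>a. P' (a @ c' 0))"
    then have "\<sigma> (\<lambda>a. P (a @ c 0) \<and> P (a @ c 1))"
      by (rule small_mono) (use P'_iff[of _ 0] in auto)
    then show False using small_S1 Suc.prems by blast
  qed
  moreover have "length (c' i) = m + m" for i by (simp add: c'_def Suc.prems(2))
  ultimately have "\<not> \<sigma> (\<lambda>a. \<forall>j<2 ^ k. P' (a @ c' j))"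
    using Suc.IH[OF P'] by blast
  moreover have "P (a @ c j)" if a: "length a = n" "\<forall>j<2 ^ k. P' (a @ c' j)" and j: "j < 2 ^ Suc k" for a j
  proof -
    have "j div 2 < 2 ^ k" using j by auto
    then have "P (a @ c (2 * (j div 2))) \<and> P (a @ c (2 * (j div 2) + 1))"
      using a P'_iff[OF a(1)] by blast
    moreover have "j = 2 * (j div 2) \<or> j = 2 * (j div 2) + 1" by presburger
    ultimately show ?thesis by metis
  qed
  ultimately show ?case
    using small_mono[of "\<lambda>a. \<forall>j<2 ^ Suc k. P (a @ c j)" "\<lambda>a. \<forall>j<2 ^ k. P' (a @ c' j)"] by blast
qed

text \<open>\<open>N\<close> lies below \<open>2 ^ N\<close>, and adding conjuncts only shrinks the
  set.\<close>

lemma S1_conj: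
  assumes "dfn S (n + m) P" "\<And>i. length (c i) = m" "indiscernible S {} c" "\<not> \<sigma> (\<lambda>a. P (a @ c 0))"
  shows "\<not> \<sigma> (\<lambda>a. \<forall>j<N. P (a @ c j))"
proof
  assume "\<sigma> (\<lambda>a. \<forall>j<N. P (a @ c j))"
  then have "\<sigma> (\<lambda>a. \<forall>j<2 ^ N. P (a @ c j))"
    by (rule small_mono) (meson less_exp less_trans)
  then show False using S1_pow[OF assms] by blast
qed

end

text \<open>A formula belongs to the ideal exactly when the set that it defines is small. Each axiom
  is therefore transferred by writing the definable relation as a formula with fresh variables for
  the parameters.\<close>

lemma S1_ideal_small:
  assumes I: "S1_ideal S x {} I" and x: "distinct x"
  shows "S1_small S (length x) (small_of S x I)"
proof -
  have inv: "invariant_ideal S x {} I" using I by (simp add: S1_ideal_def)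
  then have fi: "formula_ideal S x I" by (simp add: invariant_ideal_def)
  have in_I: "\<theta> \<in> I \<longleftrightarrow> small_of S x I (\<lambda>a. holds S x a \<theta>)" if "\<theta> \<in> formulas S (set x) UNIV" for \<theta>
  proof
    assume "small_of S x I (\<lambda>a. holds S x a \<theta>)"
    then obtain \<psi> where "\<psi> \<in> I" "implies S x {\<theta>} \<psi>"
      unfolding small_of_def implies_def by blast
    then show "\<theta> \<in> I" using fi that unfolding formula_ideal_def by blast
  qed (auto simp: small_of_def)
  have cong: "small_of S x I P \<longleftrightarrow> small_of S x I Q" if "\<And>a. length a = length x \<Longrightarrow> P a \<longleftrightarrow> Q a" for P Q
    unfolding small_of_def using that by auto
  have formula: "\<exists>z \<psi>. distinct z \<and> set z \<inter> set x = {} \<and> \<psi> \<in> formulas S (set x \<union> set z) {} \<and> length z = m \<and>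
      (\<forall>b. length b = m \<longrightarrow> inst z b \<psi> \<in> formulas S (set x) UNIV \<and>
        (\<forall>a. length a = length x \<longrightarrow> (holds S x a (inst z b \<psi>) \<longleftrightarrow> P (a @ b))))"
    if P: "dfn S (length x + m) P" for m P
  proof -
    obtain z where z: "distinct z" "length z = m" "set x \<inter> set z = {}"
      using ex_fresh_vars by blast
    obtain \<psi> where \<psi>: "\<psi> \<in> formulas S (set x \<union> set z) {}"
      "\<And>a b. length a = length x \<Longrightarrow> length b = length z \<Longrightarrow> holds S x a (inst z b \<psi>) \<longleftrightarrow> P (a @ b)"
      using dfn_inst[of S x z P] P x z by metis
    have "inst z b \<psi> \<in> formulas S (set x) UNIV" if "length b = m" for b
      using inst_in_formulas[OF \<psi>(1), of b] that z by (auto simp: formulas_def)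
    then show ?thesis using z \<psi> by (intro exI[of _ z] exI[of _ \<psi>]) auto
  qed
  show ?thesis
  proof
    show "small_of S x I (\<lambda>_. False)"
      using fi by (auto simp: small_of_def formula_ideal_def)
    fix P Q :: "'c list \<Rightarrow> bool"
    assume "small_of S x I P"
    then obtain \<theta> where \<theta>: "\<theta> \<in> I" "\<And>a. length a = length x \<Longrightarrow> P a \<Longrightarrow> holds S x a \<theta>"
      by (auto simp: small_of_def)
    show "small_of S x I (\<lambda>a. P a \<or> Q a)" if Q: "small_of S x I Q"
    proof -
      obtain \<theta>' where "\<theta>' \<in> I" "\<And>a. length a = length x \<Longrightarrow> Q a \<Longrightarrow> holds S x a \<theta>'"
        using Q unfolding small_of_def by blast
      then show ?thesis
        using \<theta> fi unfolding small_of_def formula_ideal_def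
        by (intro bexI[of _ "Disj \<theta> \<theta>'"]) (auto simp: Disj_def holds_def)
    qed
    show "small_of S x I Q" if "\<And>a. length a = length x \<Longrightarrow> Q a \<Longrightarrow> P a"
      using \<theta> that by (auto simp: small_of_def)
  next
    fix b b' P assume P: "dfn S (length x + length b) P" and bb': "eqv S {} b b'"
      and sm: "small_of S x I (\<lambda>a. P (a @ b))"
    obtain z \<psi> where z: "distinct z" "set z \<inter> set x = {}" "\<psi> \<in> formulas S (set x \<union> set z) {}" "length z = length b"
      and \<psi>: "\<And>b'. length b' = length b \<Longrightarrow> inst z b' \<psi> \<in> formulas S (set x) UNIV"
        "\<And>b' a. length b' = length b \<Longrightarrow> length a = length x \<Longrightarrow> holds S x a (inst z b' \<psi>) \<longleftrightarrow> P (a @ b')"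
      using formula[OF P] by metis
    have l: "length b' = length b" using bb' by (simp add: eqv_def)
    have "inst z b \<psi> \<in> I"
      using in_I[OF \<psi>(1)] sm cong[of "\<lambda>a. holds S x a (inst z b \<psi>)" "\<lambda>a. P (a @ b)"] \<psi>(2) by blast
    then have "inst z b' \<psi> \<in> I"
      using inv z bb' unfolding invariant_ideal_def equiv_over_iff_eqv by metis
    then show "small_of S x I (\<lambda>a. P (a @ b'))"
      using in_I[OF \<psi>(1)] cong[of "\<lambda>a. holds S x a (inst z b' \<psi>)" "\<lambda>a. P (a @ b')"] \<psi>(2) l by blast
  next
    fix m P and c :: "nat \<Rightarrow> 'c list"
    assume P: "dfn S (length x + m) P" and c: "\<And>i. length (c i) = m" "indiscernible S {} c"
      and sm: "small_of S x I (\<lambda>a. P (a @ c 0) \<and> P (a @ c 1))"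
    obtain z \<psi> where z: "distinct z" "set z \<inter> set x = {}" "\<psi> \<in> formulas S (set x \<union> set z) {}" "length z = m"
      and \<psi>: "\<And>b'. length b' = m \<Longrightarrow> inst z b' \<psi> \<in> formulas S (set x) UNIV"
        "\<And>b' a. length b' = m \<Longrightarrow> length a = length x \<Longrightarrow> holds S x a (inst z b' \<psi>) \<longleftrightarrow> P (a @ b')"
      using formula[OF P] by metis
    let ?\<theta> = "Conj (inst z (c 0) \<psi>) (inst z (c 1) \<psi>)"
    have "?\<theta> \<in> formulas S (set x) UNIV" using \<psi>(1)[OF c(1)] by (simp add: formulas_def)
    moreover have "holds S x a ?\<theta> \<longleftrightarrow> P (a @ c 0) \<and> P (a @ c 1)" if "length a = length x" for a
      using \<psi>(2)[OF c(1) that] by (simp add: holds_def)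
    ultimately have "?\<theta> \<in> I"
      using in_I sm cong[of "\<lambda>a. holds S x a ?\<theta>" "\<lambda>a. P (a @ c 0) \<and> P (a @ c 1)"] by blast
    then have "inst z (c 0) \<psi> \<in> I"
      using I z c unfolding S1_ideal_def by metis
    then show "small_of S x I (\<lambda>a. P (a @ c 0))"
      using in_I[OF \<psi>(1)] cong[of "\<lambda>a. holds S x a (inst z (c 0) \<psi>)" "\<lambda>a. P (a @ c 0)"] \<psi>(2) c by blast
  qed
qed

section \<open>Ultrafilters\<close>

definition ultra :: "'a filter \<Rightarrow> bool" where
  "ultra U \<longleftrightarrow> U \<noteq> bot \<and> (\<forall>P. eventually P U \<or> eventually (\<lambda>x. \<not> P x) U)"

lemma ultra_neg: "ultra U \<Longrightarrow> eventually (\<lambda>x. \<not> P x) U \<longleftrightarrow> \<not> eventually P U"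
proof -
  assume U: "ultra U"
  have "\<not> (eventually P U \<and> eventually (\<lambda>x. \<not> P x) U)"
  proof
    assume "eventually P U \<and> eventually (\<lambda>x. \<not> P x) U"
    then have "eventually (\<lambda>x. P x \<and> \<not> P x) U" by (auto intro: eventually_elim2)
    then show False using U by (simp add: ultra_def eventually_False)
  qed
  then show ?thesis using U by (auto simp: ultra_def)
qed

lemma ultra_filtermap: "ultra U \<Longrightarrow> ultra (filtermap f U)"
  by (auto simp: ultra_def filtermap_bot_iff eventually_filtermap)

text \<open>Zorn's lemma for proper filters ordered downwards. The infimum of a chain is proper
  because each of its sets already belongs to a member of the chain, and a minimal proper filter
  decides every predicate.\<close>

lemma ex_ultra:
  assumes "F \<noteq> bot"
  obtains U where "U \<le> F" "ultra U"
proof -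
  define \<A> where "\<A> = {G. G \<noteq> bot \<and> G \<le> F}"
  have "\<exists>m\<in>\<A>. \<forall>a\<in>\<A>. a \<le> m \<longrightarrow> a = m"
  proof (rule predicate_Zorn)
    show "partial_order_on \<A> (relation_of (\<lambda>G H. H \<le> G) \<A>)"
      by (auto simp: relation_of_def partial_order_on_def preorder_on_def refl_on_def trans_def antisym_def)
    fix C assume C: "C \<in> Chains (relation_of (\<lambda>G H. H \<le> G) \<A>)"
    then have CA: "C \<subseteq> \<A>" and lin: "\<And>G H. G \<in> C \<Longrightarrow> H \<in> C \<Longrightarrow> G \<le> H \<or> H \<le> G"
      by (auto simp: Chains_def relation_of_def)
    show "\<exists>u\<in>\<A>. \<forall>a\<in>C. u \<le> a"
    proof (cases "C = {}")
      case True
      then show ?thesis using assms by (auto simp: \<A>_def)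
    next
      case False
      then obtain G where G: "G \<in> C" by blast
      have "\<exists>x\<in>C. x \<le> inf G H" if "G \<in> C" "H \<in> C" for G H
        using lin[OF that] that by (metis inf.absorb1 inf.absorb2 order_refl)
      then have "eventually P (Inf C) \<longleftrightarrow> (\<exists>b\<in>C. eventually P b)" for P
        using eventually_Inf_base[OF False] by blast
      from this[of "\<lambda>_. False"] have "Inf C \<noteq> bot"
        using CA unfolding eventually_False by (auto simp: \<A>_def)
      moreover have "Inf C \<le> F" using Inf_lower[OF G] G CA by (auto simp: \<A>_def)
      ultimately show ?thesis by (intro bexI[of _ "Inf C"]) (auto simp: \<A>_def Inf_lower)
    qed
  qed
  then obtain U where U: "U \<in> \<A>" "\<And>G. G \<in> \<A> \<Longrightarrow> G \<le> U \<Longrightarrow> G = U" by blast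
  have "eventually P U \<or> eventually (\<lambda>x. \<not> P x) U" for P
  proof (cases "inf U (principal {x. P x}) = bot")
    case True
    then have "eventually (\<lambda>_. False) (inf U (principal {x. P x}))" by simp
    then show ?thesis by (simp add: eventually_inf_principal)
  next
    case False
    then have "inf U (principal {x. P x}) = U" using U by (auto simp: \<A>_def intro: le_infI1)
    moreover have "eventually P (inf U (principal {x. P x}))"
      by (simp add: eventually_inf_principal)
    ultimately show ?thesis by simp
  qed
  then show thesis using that U by (auto simp: \<A>_def ultra_def)
qed

lemma ex_ultra_fip:
  assumes "\<And>X. finite X \<Longrightarrow> X \<subseteq> \<G> \<Longrightarrow> \<Inter>X \<noteq> {}"
  obtains U where "ultra U" "\<And>G. G \<in> \<G> \<Longrightarrow> eventually (\<lambda>x. x \<in> G) U"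
proof -
  define F where "F = (INF G\<in>\<G>. principal G)"
  have "F \<noteq> bot"
  proof
    assume "F = bot"
    then have "eventually (\<lambda>_. False) F" by simp
    then have "\<exists>X\<subseteq>\<G>. finite X \<and> eventually (\<lambda>_. False) (INF G\<in>X. principal G)"
      unfolding F_def by (rule iffD1[OF eventually_INF])
    then obtain X where X: "X \<subseteq> \<G>" "finite X" "eventually (\<lambda>_. False) (INF G\<in>X. principal G)"
      by blast
    have "(INF G\<in>X. principal G) = principal (\<Inter>X)"
      using INF_principal_finite[OF X(2), of "\<lambda>G. G"] by simp
    then have "\<forall>x\<in>\<Inter>X. False" using X(3) by (simp only: eventually_principal)
    then show False using assms[OF X(2,1)] by blast
  qed
  then obtain U where U: "U \<le> F" "ultra U" using ex_ultra by blast
  have "eventually (\<lambda>x. x \<in> G) U" if "G \<in> \<G>" for G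
  proof -
    have "U \<le> principal G" using U(1) that unfolding F_def by (meson INF_lower order_trans)
    then show ?thesis by (simp add: le_principal)
  qed
  then show thesis using that U(2) by blast
qed

section \<open>Average types along an ultrafilter\<close>

text \<open>An ultrafilter on tuples determines a global type, its average type; \<open>e\<close>
  realizes the restriction of this type to \<open>A\<close>.\<close>

definition avg :: "('f, 'r, 'm) fo_structure \<Rightarrow> nat \<Rightarrow> 'm list filter \<Rightarrow> 'm set \<Rightarrow> 'm list \<Rightarrow> bool" where
  "avg S n U A e \<longleftrightarrow> length e = n \<and>
    (\<forall>c P. set c \<subseteq> A \<and> dfn S (n + length c) P \<longrightarrow> (P (e @ c) \<longleftrightarrow> eventually (\<lambda>d. P (d @ c)) U))"

lemma avg_length: "avg S n U A e \<Longrightarrow> length e = n"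
  by (simp add: avg_def)

lemma avgD: "avg S n U A e \<Longrightarrow> set c \<subseteq> A \<Longrightarrow> dfn S (n + length c) P \<Longrightarrow>
    P (e @ c) \<longleftrightarrow> eventually (\<lambda>d. P (d @ c)) U"
  by (simp add: avg_def)

lemma avg_mono: "avg S n U B e \<Longrightarrow> A \<subseteq> B \<Longrightarrow> avg S n U A e"
  unfolding avg_def by (meson order_trans)

lemma avg_append: "avg S n U A e \<Longrightarrow> set w \<subseteq> A \<Longrightarrow> avg S (n + length w) (filtermap (\<lambda>d. d @ w) U) A (e @ w)"
  using avgD[of S n U A e "w @ c" for c]
  by (auto simp: avg_def eventually_filtermap add.assoc)

lemma avg_take:
  assumes "avg S (k + l) U A e" "eventually (\<lambda>d. length d = k + l) U"
  shows "avg S k (filtermap (take k) U) A (take k e)"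
  unfolding avg_def
proof (intro conjI allI impI)
  show "length (take k e) = k" using avg_length[OF assms(1)] by simp
  fix c P assume c: "set c \<subseteq> A \<and> dfn S (k + length c) P"
  then have P: "dfn S (k + length c) P" by blast
  have D: "dfn S (k + l + length c) (\<lambda>q. P (take k q @ drop (k + l) q))"
    by (rule dfn_sel[OF P] seln_intros | simp)+
  then have "P (take k e @ c) \<longleftrightarrow> eventually (\<lambda>d. P (take k (d @ c) @ drop (k + l) (d @ c))) U"
    using avgD[OF assms(1) _ D] c avg_length[OF assms(1)] by simp
  also have "\<dots> \<longleftrightarrow> eventually (\<lambda>d. P (take k d @ c)) U"
    by (rule eventually_cong[OF assms(2)]) auto
  finally show "P (take k e @ c) \<longleftrightarrow> eventually (\<lambda>d. P (d @ c)) (filtermap (take k) U)"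
    by (simp add: eventually_filtermap)
qed

text \<open>This is a Morley sequence of the average type. Truth at the last entry is decided by
  tuples \<open>d\<close> from \<open>C\<close>; with such a \<open>d\<close> as a parameter, the
  induction hypothesis exchanges the initial segments.\<close>

lemma avg_indiscernible:
  assumes "ultra U" "eventually (\<lambda>d. length d = n \<and> set d \<subseteq> C) U"
    and e: "\<And>i. avg S n U (C \<union> (\<Union>j<i. set (e j))) (e i)"
  shows "indiscernible S C e"
proof -
  have len: "length (e i) = n" for i using avg_length[OF e] .
  have "eqv S C (concat (map e is)) (concat (map e js))"
    if "sorted_wrt (<) is" "sorted_wrt (<) js" "length is = length js" for "is" js
    using that
  proof (induction "is" arbitrary: js rule: rev_induct)
    case Nil
    then show ?case by (simp add: eqv_refl)
  next
    case (snoc i "is")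
    then obtain j js' where js: "js = js' @ [j]" by (cases js rule: rev_cases) auto
    let ?E = "concat (map e is)" and ?F = "concat (map e js')"
    have EF: "eqv S C ?E ?F" using snoc js by (simp add: sorted_wrt_append)
    have E: "set ?E \<subseteq> (\<Union>j<i. set (e j))" "set ?F \<subseteq> (\<Union>i<j. set (e i))"
      using snoc.prems js by (auto simp: sorted_wrt_append)
    have l: "length ?F = length ?E" using EF by (simp add: eqv_def)
    have "eqv S C (?E @ e i) (?F @ e j)"
      unfolding eqv_def
    proof (intro conjI allI impI)
      show "length (?E @ e i) = length (?F @ e j)" using l len by simp
      fix c P assume c: "set c \<subseteq> C \<and> dfn S (length (?E @ e i) + length c) P"
      let ?k = "length ?E"
      define Q where "Q l = P (take ?k (drop n l) @ take n l @ drop (n + ?k) l)" for l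
      have Q: "dfn S (n + (?k + length c)) Q" unfolding Q_def
        by (rule dfn_sel[of S "?k + n + length c" P])
            (use c len in simp, (rule seln_intros | simp)+)
      have QP: "Q (d @ G @ c) \<longleftrightarrow> P (G @ d @ c)" if "length d = n" "length G = ?k" for d G
        using that by (simp add: Q_def)
      have c': "set (?E @ c) \<subseteq> C \<union> (\<Union>j<i. set (e j))" "set (?F @ c) \<subseteq> C \<union> (\<Union>i<j. set (e i))"
        using E c by auto
      have "P (?E @ e i @ c) \<longleftrightarrow> Q (e i @ ?E @ c)" using QP len by simp
      also have "\<dots> \<longleftrightarrow> eventually (\<lambda>d. Q (d @ ?E @ c)) U"
        using avgD[OF e c'(1), of Q] Q by simp
      also have "\<dots> \<longleftrightarrow> eventually (\<lambda>d. Q (d @ ?F @ c)) U"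
      proof (rule eventually_cong[OF assms(2)])
        fix d assume d: "length d = n \<and> set d \<subseteq> C"
        then have "P (?E @ d @ c) \<longleftrightarrow> P (?F @ d @ c)"
          using eqvD[OF EF, of "d @ c" P] c len by (simp add: add.assoc)
        then show "Q (d @ ?E @ c) \<longleftrightarrow> Q (d @ ?F @ c)" using QP d l by simp
      qed
      also have "\<dots> \<longleftrightarrow> Q (e j @ ?F @ c)"
        using avgD[OF e c'(2), of Q] Q l by simp
      also have "\<dots> \<longleftrightarrow> P (?F @ e j @ c)" using QP len l by simp
      finally show "P ((?E @ e i) @ c) \<longleftrightarrow> P ((?F @ e j) @ c)" by simp
    qed
    then show ?case using js by simp
  qed
  then show ?thesis
    using len unfolding indiscernible_def equiv_over_iff_eqv by auto
qed

text \<open>Every formula over \<open>M\<close> true of \<open>b\<close> has a solution in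
  \<open>M\<close>, also after finite conjunction, so the solution sets inside \<open>M\<close> have
  the finite intersection property.\<close>

lemma ex_coheir:
  assumes M: "elementary_substructure S M"
  obtains U where "ultra U" "eventually (\<lambda>d. length d = length b \<and> set d \<subseteq> M) U"
    "\<And>c P. set c \<subseteq> M \<Longrightarrow> dfn S (length b + length c) P \<Longrightarrow> P (b @ c) \<Longrightarrow> eventually (\<lambda>d. P (d @ c)) U"
proof -
  let ?n = "length b"
  define \<Gamma> where "\<Gamma> = {(P, c). set c \<subseteq> M \<and> dfn S (?n + length c) P \<and> P (b @ c)}"
  define G where "G Pc = {d. length d = ?n \<and> set d \<subseteq> M \<and> fst Pc (d @ snd Pc)}" for Pc :: "('c list \<Rightarrow> bool) \<times> 'c list"
  have fip: "\<Inter>X \<noteq> {}" if X: "finite X" "X \<subseteq> G ` \<Gamma>" for X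
  proof -
    obtain \<Delta> where \<Delta>: "finite \<Delta>" "\<Delta> \<subseteq> \<Gamma>" "X = G ` \<Delta>" using finite_subset_image[OF X] by blast
    have "\<exists>d R. set d \<subseteq> M \<and> dfn S (?n + length d) R \<and>
        (\<forall>y. length y = ?n \<longrightarrow> (R (y @ d) \<longleftrightarrow> (\<forall>(P, c)\<in>\<Delta>. P (y @ c))))"
      using \<Delta> by (intro finite_conj_dfn) (auto simp: \<Gamma>_def)
    then obtain d R where d: "set d \<subseteq> M" "dfn S (?n + length d) R"
        "\<And>y. length y = ?n \<Longrightarrow> R (y @ d) \<longleftrightarrow> (\<forall>(P, c)\<in>\<Delta>. P (y @ c))" by blast
    have "R (b @ d)" using d(3) \<Delta>(2) by (auto simp: \<Gamma>_def)
    then obtain d' where "length d' = ?n" "set d' \<subseteq> M" "R (d' @ d)"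
      using elementary_realizes[OF M d(2,1)] by blast
    then have "d' \<in> \<Inter>X" using d(3) \<Delta>(3) by (auto simp: G_def case_prod_unfold)
    then show ?thesis by blast
  qed
  obtain U where U: "ultra U" "\<And>H. H \<in> G ` \<Gamma> \<Longrightarrow> eventually (\<lambda>x. x \<in> H) U"
    using ex_ultra_fip[OF fip] by blast
  have ev: "eventually (\<lambda>d. length d = ?n \<and> set d \<subseteq> M \<and> P (d @ c)) U"
    if "set c \<subseteq> M" "dfn S (?n + length c) P" "P (b @ c)" for c P
  proof -
    have "G (P, c) \<in> G ` \<Gamma>" using that by (auto simp: \<Gamma>_def)
    from U(2)[OF this] show ?thesis by (simp add: G_def)
  qed
  show thesis
  proof (rule that[OF U(1)])
    show "eventually (\<lambda>d. length d = ?n \<and> set d \<subseteq> M) U"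
      using ev[of "[]" "\<lambda>_. True"] by (simp add: dfn_True)
    show "eventually (\<lambda>d. P (d @ c)) U"
      if "set c \<subseteq> M" "dfn S (?n + length c) P" "P (b @ c)" for c P
      using ev[OF that] by (rule eventually_mono) blast
  qed
qed

section \<open>Realizing wide types\<close>

locale monster =
  fixes S :: "('f, 'r, 'm) fo_structure" and \<kappa> :: "'k rel"
  assumes sat: "saturated S \<kappa>" and Card_\<kappa>: "Card_order \<kappa>" and natLeq_\<kappa>: "natLeq <o \<kappa>"
begin

definition sm :: "'m set \<Rightarrow> bool" where
  "sm A \<longleftrightarrow> |A| <o \<kappa>"

lemma infinite_Field: "infinite (Field \<kappa>)"
proof -
  have "natLeq \<le>o |Field \<kappa>|"
    using ordLess_imp_ordLeq[OF natLeq_\<kappa>] ordIso_symmetric[OF card_of_Field_ordIso[OF Card_\<kappa>]]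
      ordLeq_ordIso_trans by blast
  then show ?thesis using infinite_iff_natLeq_ordLeq by blast
qed

lemma sm_Un: "sm A \<Longrightarrow> sm B \<Longrightarrow> sm (A \<union> B)"
  unfolding sm_def by (rule card_of_Un_ordLess_infinite_Field[OF infinite_Field Card_\<kappa>])

lemma sm_countable: "countable A \<Longrightarrow> sm A"
proof -
  assume "countable A"
  then have "|A| \<le>o |UNIV :: nat set|"
    unfolding countable_def card_of_ordLeq[symmetric] by blast
  then have "|A| \<le>o natLeq" using card_of_nat ordLeq_ordIso_trans by blast
  then show ?thesis unfolding sm_def using natLeq_\<kappa> ordLeq_ordLess_trans by blast
qed

lemma sm_finite: "finite A \<Longrightarrow> sm A"
  by (simp add: sm_countable countable_finite)

text \<open>The complements of all small sets over \<open>A\<close> are added to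
  \<open>\<Gamma>\<close>. If a finite part were inconsistent, its share of \<open>\<Gamma>\<close>
  would be covered by finitely many small sets, against \<open>fin\<close>.\<close>

lemma ext:
  assumes "S1_small S n \<sigma>" "sm A"
    and \<Gamma>: "\<And>P c. (P, c) \<in> \<Gamma> \<Longrightarrow> set c \<subseteq> A \<and> dfn S (n + length c) P"
    and fin: "\<And>\<Delta>. finite \<Delta> \<Longrightarrow> \<Delta> \<subseteq> \<Gamma> \<Longrightarrow> \<not> \<sigma> (\<lambda>a. \<forall>(P, c)\<in>\<Delta>. P (a @ c))"
  shows "\<exists>a. wide S n \<sigma> A a \<and> (\<forall>P c. (P, c) \<in> \<Gamma> \<longrightarrow> P (a @ c))"
proof -
  interpret S1_small S n \<sigma> by fact
  define N where "N = {(\<lambda>l. \<not> P l, c) | P c. set c \<subseteq> A \<and> dfn S (n + length c) P \<and> \<sigma> (\<lambda>a. P (a @ c))}"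
  have N: "set c \<subseteq> A \<and> dfn S (n + length c) P \<and> \<sigma> (\<lambda>a. \<not> P (a @ c))" if "(P, c) \<in> N" for P c
    using that by (auto simp: N_def intro: dfn_neg)
  have "\<exists>a. length a = n \<and> (\<forall>(P, c)\<in>\<Gamma> \<union> N. P (a @ c))"
  proof (rule saturated_realizes[OF sat assms(2)[unfolded sm_def]])
    show "set c \<subseteq> A \<and> dfn S (n + length c) P" if "(P, c) \<in> \<Gamma> \<union> N" for P c
      using that \<Gamma> N by blast
    fix \<Delta> assume \<Delta>: "finite \<Delta>" "\<Delta> \<subseteq> \<Gamma> \<union> N"
    show "\<exists>a. length a = n \<and> (\<forall>(P, c)\<in>\<Delta>. P (a @ c))"
    proof (rule ccontr)
      assume no: "\<not> ?thesis"
      have "\<sigma> (\<lambda>a. \<exists>Pc\<in>\<Delta> \<inter> N. \<not> fst Pc (a @ snd Pc))"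
        using \<Delta>(1) N by (intro small_finite_union) auto
      then have "\<sigma> (\<lambda>a. \<forall>(P, c)\<in>\<Delta> \<inter> \<Gamma>. P (a @ c))"
      proof (rule small_mono)
        fix a :: "'m list" assume a: "length a = n" "\<forall>(P, c)\<in>\<Delta> \<inter> \<Gamma>. P (a @ c)"
        obtain P c where Pc: "(P, c) \<in> \<Delta>" "\<not> P (a @ c)" using no a(1) by blast
        then have "(P, c) \<in> \<Delta> \<inter> N" using a(2) \<Delta>(2) by blast
        then show "\<exists>Pc\<in>\<Delta> \<inter> N. \<not> fst Pc (a @ snd Pc)" using Pc(2) by force
      qed
      then show False using fin[of "\<Delta> \<inter> \<Gamma>"] \<Delta>(1) by blast
    qed
  qed
  then obtain a where a: "length a = n" "\<And>P c. (P, c) \<in> \<Gamma> \<union> N \<Longrightarrow> P (a @ c)" by blast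
  have "wide S n \<sigma> A a"
    unfolding wide_def
  proof (intro conjI allI impI notI)
    fix c P assume "set c \<subseteq> A \<and> dfn S (n + length c) P \<and> P (a @ c)" "\<sigma> (\<lambda>a'. P (a' @ c))"
    then show False using a(2)[of "\<lambda>l. \<not> P l" c] by (auto simp: N_def)
  qed (rule a(1))
  then show ?thesis using a(2) by blast
qed

text \<open>No finite part of the type of a wide tuple defines a small set, so \<open>ext\<close>
  applies to the whole type.\<close>

lemma wide_extension:
  assumes "S1_small S n \<sigma>" "wide S n \<sigma> A a" "A \<subseteq> B" "sm B"
  obtains a' where "wide S n \<sigma> B a'" "eqv S A a' a"
proof -
  interpret S1_small S n \<sigma> by fact
  define \<Gamma> where "\<Gamma> = {(P, c). set c \<subseteq> A \<and> dfn S (n + length c) P \<and> P (a @ c)}"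
  have "\<exists>a. wide S n \<sigma> B a \<and> (\<forall>P c. (P, c) \<in> \<Gamma> \<longrightarrow> P (a @ c))"
  proof (rule ext[OF assms(1,4), of \<Gamma>])
    show "set c \<subseteq> B \<and> dfn S (n + length c) P" if "(P, c) \<in> \<Gamma>" for P c
      using that assms(3) by (auto simp: \<Gamma>_def)
    fix \<Delta> assume \<Delta>: "finite \<Delta>" "\<Delta> \<subseteq> \<Gamma>"
    have "\<exists>d R. set d \<subseteq> A \<and> dfn S (n + length d) R \<and>
        (\<forall>y. length y = n \<longrightarrow> (R (y @ d) \<longleftrightarrow> (\<forall>(P, c)\<in>\<Delta>. P (y @ c))))"
      using \<Delta> by (intro finite_conj_dfn) (auto simp: \<Gamma>_def)
    then obtain d R where d: "set d \<subseteq> A" "dfn S (n + length d) R"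
        "\<And>y. length y = n \<Longrightarrow> R (y @ d) \<longleftrightarrow> (\<forall>(P, c)\<in>\<Delta>. P (y @ c))" by blast
    have "R (a @ d)" using d(3)[OF wide_length[OF assms(2)]] \<Delta>(2) by (auto simp: \<Gamma>_def)
    then have "\<not> \<sigma> (\<lambda>y. R (y @ d))" using wideD[OF assms(2) d(1,2)] by blast
    then show "\<not> \<sigma> (\<lambda>y. \<forall>(P, c)\<in>\<Delta>. P (y @ c))"
      using small_cong[of "\<lambda>y. R (y @ d)", OF d(3)] by blast
  qed
  then obtain a' where a': "wide S n \<sigma> B a'" "\<And>P c. (P, c) \<in> \<Gamma> \<Longrightarrow> P (a' @ c)" by blast
  have "eqv S A a a'"
  proof (rule eqvI)
    show "length a = length a'" using wide_length[OF assms(2)] wide_length[OF a'(1)] by simp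
    fix c P assume "set c \<subseteq> A" "dfn S (length a + length c) P" "P (a @ c)"
    then have "(P, c) \<in> \<Gamma>" using wide_length[OF assms(2)] by (simp add: \<Gamma>_def)
    then show "P (a' @ c)" by (rule a'(2))
  qed
  then show thesis using that a'(1) eqv_sym by blast
qed

text \<open>Finitely many of the required conditions, possibly on different \<open>b'\<close>, are
  all implied by one conjunction \<open>R\<close> from the type of \<open>a @ b\<close> demanded at
  every \<open>b'\<close> in \<open>X\<close>. The hypothesis \<open>conj\<close> says that this
  demand is not small.\<close>

lemma wide_extension_pairs:
  assumes "S1_small S n \<sigma>" "wide S n \<sigma> A a" "A \<subseteq> B" "sm B"
    and X: "\<And>b'. b' \<in> X \<Longrightarrow> length b' = length b \<and> set b' \<subseteq> B"
    and conj: "\<And>P w. set w \<subseteq> A \<Longrightarrow> dfn S (n + length b + length w) P \<Longrightarrow> P (a @ b @ w) \<Longrightarrow>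
      \<not> \<sigma> (\<lambda>y. \<forall>b'\<in>X. P (y @ b' @ w))"
  obtains a' where "wide S n \<sigma> B a'" "eqv S A a' a" "\<And>b'. b' \<in> X \<Longrightarrow> eqv S A (a' @ b') (a @ b)"
proof (cases "X = {}")
  \<comment> \<open>Without pairs, nothing in the condition on pairs controls the type of
    \<open>a'\<close> over \<open>A\<close>; plain extension does.\<close>
  case True
  then show thesis using wide_extension[OF assms(1-4)] that by blast
next
  case False
  interpret S1_small S n \<sigma> by fact
  have la: "length a = n" using wide_length[OF assms(2)] .
  define G where "G = {(P, w). set w \<subseteq> A \<and> dfn S (n + length b + length w) P \<and> P (a @ b @ w)}"
  define \<Gamma> where "\<Gamma> = {(P, b' @ w) | P w b'. (P, w) \<in> G \<and> b' \<in> X}"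
  have "\<exists>a. wide S n \<sigma> B a \<and> (\<forall>P c. (P, c) \<in> \<Gamma> \<longrightarrow> P (a @ c))"
  proof (rule ext[OF assms(1,4), of \<Gamma>])
    show "set c \<subseteq> B \<and> dfn S (n + length c) P" if "(P, c) \<in> \<Gamma>" for P c
      using that assms(3) X unfolding \<Gamma>_def G_def by (fastforce simp: add.assoc)
    fix \<Delta> assume \<Delta>: "finite \<Delta>" "\<Delta> \<subseteq> \<Gamma>"
    have "\<exists>Pw b'. t = (fst Pw, b' @ snd Pw) \<and> Pw \<in> G \<and> b' \<in> X" if t: "t \<in> \<Delta>" for t
    proof -
      have "t \<in> \<Gamma>" using t \<Delta>(2) by blast
      then obtain P w b' where "t = (P, b' @ w)" "(P, w) \<in> G" "b' \<in> X"
        unfolding \<Gamma>_def by blast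
      then show ?thesis by (intro exI[of _ "(P, w)"] exI[of _ b']) simp
    qed
    then obtain f g where fg: "\<And>t. t \<in> \<Delta> \<Longrightarrow> t = (fst (f t), g t @ snd (f t))"
      and fG: "\<And>t. t \<in> \<Delta> \<Longrightarrow> f t \<in> G" and gX: "\<And>t. t \<in> \<Delta> \<Longrightarrow> g t \<in> X"
      by metis
    have fGs: "f ` \<Delta> \<subseteq> G" using fG by auto
    have "\<exists>d R. set d \<subseteq> A \<and> dfn S (n + length b + length d) R \<and>
        (\<forall>y. length y = n + length b \<longrightarrow> (R (y @ d) \<longleftrightarrow> (\<forall>(P, c)\<in>f ` \<Delta>. P (y @ c))))"
    proof (rule finite_conj_dfn)
      show "finite (f ` \<Delta>)" using \<Delta> by simp
      show "set c \<subseteq> A \<and> dfn S (n + length b + length c) P" if "(P, c) \<in> f ` \<Delta>" for P c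
      proof -
        have "(P, c) \<in> G" by (rule subsetD[OF fGs that])
        then show ?thesis by (simp add: G_def)
      qed
    qed
    then obtain d R where d: "set d \<subseteq> A" "dfn S (n + length b + length d) R"
      "\<And>y. length y = n + length b \<Longrightarrow> R (y @ d) \<longleftrightarrow> (\<forall>(P, c)\<in>f ` \<Delta>. P (y @ c))" by blast
    have "P (a @ b @ c)" if "(P, c) \<in> f ` \<Delta>" for P c
    proof -
      have "(P, c) \<in> G" by (rule subsetD[OF fGs that])
      then show ?thesis by (simp add: G_def)
    qed
    then have "\<forall>(P, c)\<in>f ` \<Delta>. P ((a @ b) @ c)" unfolding append_assoc by blast
    then have "R (a @ b @ d)" using d(3)[of "a @ b"] la by (metis append_assoc length_append)
    then have ns: "\<not> \<sigma> (\<lambda>y. \<forall>b'\<in>X. R (y @ b' @ d))" using conj d by blast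
    show "\<not> \<sigma> (\<lambda>y. \<forall>(P, c)\<in>\<Delta>. P (y @ c))"
    proof
      assume "\<sigma> (\<lambda>y. \<forall>(P, c)\<in>\<Delta>. P (y @ c))"
      then have "\<sigma> (\<lambda>y. \<forall>b'\<in>X. R (y @ b' @ d))"
      proof (rule small_mono)
        fix y :: "'m list" assume y: "length y = n" "\<forall>b'\<in>X. R (y @ b' @ d)"
        have "fst t (y @ snd t)" if t: "t \<in> \<Delta>" for t
        proof -
          have g: "g t \<in> X" and e: "t = (fst (f t), g t @ snd (f t))" by (rule gX[OF t], rule fg[OF t])
          have "R ((y @ g t) @ d)" using y g by simp
          then have "fst (f t) ((y @ g t) @ snd (f t))"
            using d(3)[of "y @ g t"] X[OF g] y(1) t by (auto simp: case_prod_unfold)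
          moreover have "fst t = fst (f t)" "snd t = g t @ snd (f t)" using e by (metis fst_conv, metis snd_conv)
          ultimately show ?thesis by simp
        qed
        then show "\<forall>(P, c)\<in>\<Delta>. P (y @ c)" by auto
      qed
      then show False using ns by blast
    qed
  qed
  then obtain a' where a': "wide S n \<sigma> B a'" "\<And>P c. (P, c) \<in> \<Gamma> \<Longrightarrow> P (a' @ c)" by blast
  have la': "length a' = n" using wide_length[OF a'(1)] .
  have pair: "eqv S A (a @ b) (a' @ b')" if b': "b' \<in> X" for b'
  proof (rule eqvI)
    show "length (a @ b) = length (a' @ b')" using X[OF b'] la la' by simp
    fix c P assume "set c \<subseteq> A" "dfn S (length (a @ b) + length c) P" "P ((a @ b) @ c)"
    then have "(P, c) \<in> G" using la by (simp add: G_def)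
    then have "(P, b' @ c) \<in> \<Gamma>" using b' unfolding \<Gamma>_def by blast
    then show "P ((a' @ b') @ c)" using a'(2)[of P "b' @ c"] by simp
  qed
  obtain b' where "b' \<in> X" using False by blast
  have "eqv S A a a'"
    using eqv_sel[OF pair[OF \<open>b' \<in> X\<close>], of n "take n"] la la' by (simp add: seln_take[OF seln_id])
  then show thesis using that a'(1) pair eqv_sym by blast
qed

lemma ex_avg:
  assumes "ultra U" "eventually (\<lambda>d. length d = n) U" "sm A"
  obtains e where "avg S n U A e"
proof -
  define \<Gamma> where "\<Gamma> = {(P, c). set c \<subseteq> A \<and> dfn S (n + length c) P \<and> eventually (\<lambda>d. P (d @ c)) U}"
  have "\<exists>a. length a = n \<and> (\<forall>(P, c)\<in>\<Gamma>. P (a @ c))"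
  proof (rule saturated_realizes[OF sat assms(3)[unfolded sm_def]])
    show "set c \<subseteq> A \<and> dfn S (n + length c) P" if "(P, c) \<in> \<Gamma>" for P c
      using that by (auto simp: \<Gamma>_def)
    fix \<Delta> assume \<Delta>: "finite \<Delta>" "\<Delta> \<subseteq> \<Gamma>"
    have "\<forall>t\<in>\<Delta>. eventually (\<lambda>d. fst t (d @ snd t)) U" using \<Delta>(2) by (auto simp: \<Gamma>_def)
    then have "eventually (\<lambda>d. \<forall>t\<in>\<Delta>. fst t (d @ snd t)) U" using \<Delta>(1) by (simp add: eventually_ball_finite)
    then have "eventually (\<lambda>d. length d = n \<and> (\<forall>t\<in>\<Delta>. fst t (d @ snd t))) U"
      using assms(2) by (simp add: eventually_conj_iff)
    then have "\<exists>d. length d = n \<and> (\<forall>t\<in>\<Delta>. fst t (d @ snd t))"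
      using assms(1) eventually_happens' unfolding ultra_def by blast
    then show "\<exists>a. length a = n \<and> (\<forall>(P, c)\<in>\<Delta>. P (a @ c))" by (simp add: case_prod_unfold)
  qed
  then obtain e where e: "length e = n" "\<And>P c. (P, c) \<in> \<Gamma> \<Longrightarrow> P (e @ c)" by blast
  have "P (e @ c) \<longleftrightarrow> eventually (\<lambda>d. P (d @ c)) U" if c: "set c \<subseteq> A" "dfn S (n + length c) P" for c P
  proof
    assume P: "P (e @ c)"
    show "eventually (\<lambda>d. P (d @ c)) U"
    proof (rule ccontr)
      assume "\<not> ?thesis"
      then have "eventually (\<lambda>d. \<not> P (d @ c)) U" using ultra_neg[OF assms(1)] by blast
      then have "(\<lambda>l. \<not> P l, c) \<in> \<Gamma>" using c dfn_neg by (auto simp: \<Gamma>_def)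
      then show False using e(2) P by blast
    qed
  qed (use c e(2) in \<open>auto simp: \<Gamma>_def\<close>)
  then show thesis using that[of e] e(1) by (auto simp: avg_def)
qed

text \<open>S1 speaks of infinite sequences, whereas a recursive construction has only finitely many
  entries at hand; these are prolonged to a full Morley sequence.\<close>

lemma avg_sequence_extension:
  assumes U: "ultra U" "eventually (\<lambda>d. length d = n) U" "sm C"
    and g: "\<And>j. j < (i :: nat) \<Longrightarrow> avg S n U (C \<union> (\<Union>t<j. set (g t))) (g j)"
  obtains h where "\<And>j. j < i \<Longrightarrow> h j = g j" "\<And>j. avg S n U (C \<union> (\<Union>t<j. set (h t))) (h j)"
proof -
  define Q where "Q f j r \<longleftrightarrow> (if j < i then r = g j else avg S n U (C \<union> (\<Union>t<j. set (f t))) r)"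
    for f :: "nat \<Rightarrow> 'm list" and j :: nat and r
  have "\<exists>h. \<forall>j. Q h j (h j)"
  \<comment> \<open>The condition on an entry depends only on the entries before it, which is what
    choice along a well-order asks for. The later recursive constructions have the same
    shape.\<close>
  proof (rule dependent_wellorder_choice)
    fix r and f f' :: "nat \<Rightarrow> 'm list" and j :: nat
    assume "\<And>t. t < j \<Longrightarrow> f t = f' t"
    then have "(\<Union>t<j. set (f t)) = (\<Union>t<j. set (f' t))" by simp
    then show "Q f j r = Q f' j r" by (simp add: Q_def)
  next
    fix j and f :: "nat \<Rightarrow> 'm list"
    have "sm (C \<union> (\<Union>t<j. set (f t)))" by (intro sm_Un[OF U(3)] sm_finite) auto
    then obtain e where "avg S n U (C \<union> (\<Union>t<j. set (f t))) e" using ex_avg[OF U(1,2)] by blast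
    then show "\<exists>r. Q f j r" by (auto simp: Q_def)
  qed
  then obtain h where "\<And>j. Q h j (h j)" by blast
  then have h: "if j < i then h j = g j else avg S n U (C \<union> (\<Union>t<j. set (h t))) (h j)" for j
    by (simp add: Q_def)
  have hg: "h j = g j" if "j < i" for j using h[of j] that by simp
  have "avg S n U (C \<union> (\<Union>t<j. set (h t))) (h j)" for j
  proof (cases "j < i")
    case True
    then have "(\<Union>t<j. set (h t)) = (\<Union>t<j. set (g t))" using hg by simp
    then show ?thesis using g[OF True] hg[OF True] by simp
  next
    case False
    then show ?thesis using h[of j] by simp
  qed
  then show thesis using that hg by blast
qed

end

section \<open>Coheirs\<close>

lemma indiscernible_mono: "indiscernible S B c \<Longrightarrow> A \<subseteq> B \<Longrightarrow> indiscernible S A c"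
  unfolding indiscernible_def equiv_over_iff_eqv using eqv_mono by meson

text \<open>\<open>U\<close> selects a coheir of the type of \<open>b\<close> over \<open>M\<close>:
  its average type extends the type of \<open>b\<close> to all parameters and remains finitely
  satisfiable in \<open>M\<close>.\<close>

definition coheir :: "('f, 'r, 'm) fo_structure \<Rightarrow> 'm set \<Rightarrow> 'm list filter \<Rightarrow> 'm list \<Rightarrow> bool" where
  "coheir S M U b \<longleftrightarrow> ultra U \<and> eventually (\<lambda>d. length d = length b \<and> set d \<subseteq> M) U \<and>
    (\<forall>c P. set c \<subseteq> M \<longrightarrow> dfn S (length b + length c) P \<longrightarrow> P (b @ c) \<longrightarrow> eventually (\<lambda>d. P (d @ c)) U)"

lemma coheir_exists:
  assumes "elementary_substructure S M"
  shows "\<exists>U. coheir S M U b"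
proof (rule ex_coheir[OF assms, of b])
  fix U
  assume U: "ultra U" "eventually (\<lambda>d. length d = length b \<and> set d \<subseteq> M) U"
    "\<And>c P. set c \<subseteq> M \<Longrightarrow> dfn S (length b + length c) P \<Longrightarrow> P (b @ c) \<Longrightarrow> eventually (\<lambda>d. P (d @ c)) U"
  have "coheir S M U b"
    unfolding coheir_def using U(1,2) by (intro conjI allI impI U(3))
  then show ?thesis by blast
qed

lemma coheir_take:
  assumes "coheir S M U (b @ c)"
  shows "coheir S M (filtermap (take (length b)) U) b"
proof -
  have U: "ultra U" "eventually (\<lambda>d. length d = length (b @ c) \<and> set d \<subseteq> M) U"
    using assms by (auto simp: coheir_def)
  have "eventually (\<lambda>d. length d = length b \<and> set d \<subseteq> M) (filtermap (take (length b)) U)"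
    unfolding eventually_filtermap using U(2)
    by (rule eventually_mono) (auto dest: in_set_takeD)
  moreover have "eventually (\<lambda>d. P (d @ v)) (filtermap (take (length b)) U)"
    if v: "set v \<subseteq> M" and P: "dfn S (length b + length v) P" and h: "P (b @ v)" for v P
  proof -
    let ?Q = "\<lambda>q. P (take (length b) q @ drop (length b + length c) q)"
    have "dfn S (length (b @ c) + length v) ?Q"
      by (rule dfn_sel[OF P] seln_intros | simp)+
    moreover have "?Q ((b @ c) @ v)" using h by simp
    ultimately have "eventually (\<lambda>d. ?Q (d @ v)) U"
      using assms v unfolding coheir_def by blast
    with U(2) show ?thesis
      unfolding eventually_filtermap by (rule eventually_elim2) simp
  qed
  ultimately show ?thesis using ultra_filtermap[OF U(1)] by (auto simp: coheir_def)
qed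

lemma coheir_append:
  assumes "coheir S M U b" "set w \<subseteq> M"
  shows "coheir S M (filtermap (\<lambda>d. d @ w) U) (b @ w)"
proof -
  have U: "ultra U" "eventually (\<lambda>d. length d = length b \<and> set d \<subseteq> M) U"
    using assms by (auto simp: coheir_def)
  have "eventually (\<lambda>d. length d = length (b @ w) \<and> set d \<subseteq> M) (filtermap (\<lambda>d. d @ w) U)"
    unfolding eventually_filtermap using U(2)
    by (rule eventually_mono) (use assms(2) in auto)
  moreover have "eventually (\<lambda>d. P (d @ v)) (filtermap (\<lambda>d. d @ w) U)"
    if v: "set v \<subseteq> M" and P: "dfn S (length (b @ w) + length v) P" and h: "P ((b @ w) @ v)" for v P
  proof -
    have "set (w @ v) \<subseteq> M" "dfn S (length b + length (w @ v)) P" "P (b @ w @ v)"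
      using v P h assms(2) by (auto simp: add.assoc)
    then have "eventually (\<lambda>d. P (d @ w @ v)) U"
      using assms(1) unfolding coheir_def by blast
    then show ?thesis unfolding eventually_filtermap by simp
  qed
  ultimately show ?thesis using ultra_filtermap[OF U(1)] unfolding coheir_def by blast
qed

lemma coheir_avg_eqv:
  assumes "coheir S M U b" "avg S (length b) U M e"
  shows "eqv S M b e"
proof (rule eqvI)
  show "length b = length e" using avg_length[OF assms(2)] by simp
  fix c P assume c: "set c \<subseteq> M" "dfn S (length b + length c) P" "P (b @ c)"
  then have "eventually (\<lambda>d. P (d @ c)) U" using assms(1) unfolding coheir_def by blast
  then show "P (e @ c)" using avgD[OF assms(2) c(1,2)] by blast
qed

text \<open>The Morley sequence of the coheir, with \<open>w\<close> appended to every entry, is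
  indiscernible and begins with a copy of \<open>b @ w\<close>. Invariance carries non-smallness to
  this first entry, and \<open>S1_conj\<close> to finitely many entries.\<close>

lemma coheir_seq_conj:
  assumes U: "coheir S M U b" and \<sigma>: "S1_small S n \<sigma>"
    and h: "\<And>j. avg S (length b) U (M \<union> (\<Union>t<j. set (h t))) (h j)"
    and R: "dfn S (n + (length b + length w)) R" and w: "set w \<subseteq> M"
    and ns: "\<not> \<sigma> (\<lambda>y. R (y @ b @ w))"
  shows "\<not> \<sigma> (\<lambda>y. \<forall>j<(N :: nat). R (y @ h j @ w))"
proof -
  interpret S1_small S n \<sigma> by fact
  let ?U = "filtermap (\<lambda>d. d @ w) U" and ?m = "length b + length w"
  have cU: "coheir S M ?U (b @ w)" using coheir_append[OF U w] .
  have "indiscernible S M (\<lambda>j. h j @ w)"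
  proof (rule avg_indiscernible)
    show "ultra ?U" using cU by (simp add: coheir_def)
    show "eventually (\<lambda>d. length d = ?m \<and> set d \<subseteq> M) ?U" using cU by (simp add: coheir_def)
    show "avg S ?m ?U (M \<union> (\<Union>j<i. set (h j @ w))) (h i @ w)" for i
    proof -
      have "avg S ?m ?U (M \<union> (\<Union>j<i. set (h j))) (h i @ w)"
        by (rule avg_append[OF h]) (use w in auto)
      then show ?thesis by (rule avg_mono) (use w in auto)
    qed
  qed
  then have ind: "indiscernible S {} (\<lambda>j. h j @ w)" by (rule indiscernible_mono) simp
  have len: "length (h j @ w) = ?m" for j using avg_length[OF h] by simp
  have "eqv S M b (h 0)" using coheir_avg_eqv[OF U] h[of 0] by simp
  then have e: "eqv S {} (h 0 @ w) (b @ w)"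
    using eqv_sym eqv_append_params[OF _ w] eqv_mono by blast
  have "\<not> \<sigma> (\<lambda>y. R (y @ h 0 @ w))"
  proof
    assume s: "\<sigma> (\<lambda>y. R (y @ h 0 @ w))"
    have "dfn S (n + length (h 0 @ w)) R" unfolding len by (rule R)
    from small_inv[OF this e s] show False using ns by blast
  qed
  then show ?thesis using S1_conj[OF R, of "\<lambda>j. h j @ w", OF len ind] by blast
qed

text \<open>A type averaged over tuples of \<open>M\<close> is \<open>M\<close>-invariant.\<close>

lemma avg_pair:
  assumes U: "eventually (\<lambda>d. length d = l \<and> set d \<subseteq> M) U" and cd: "eqv S M c d"
    and b: "avg S l U (M \<union> set c) b" "avg S l U (M \<union> set d) b'"
  shows "eqv S M (c @ b) (d @ b')"
proof -
  let ?k = "length c"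
  have l: "length d = ?k" "length b = l" "length b' = l"
    using eqv_length[OF cd] avg_length[OF b(1)] avg_length[OF b(2)] by auto
  show ?thesis
  proof (rule eqvI)
    show "length (c @ b) = length (d @ b')" using l by simp
    fix v P assume v: "set v \<subseteq> M" and P0: "dfn S (length (c @ b) + length v) P" and h: "P ((c @ b) @ v)"
    have P: "dfn S (?k + l + length v) P" using P0 l by simp
    let ?Q = "\<lambda>q. P (take ?k (drop l q) @ take l q @ drop (l + ?k) q)"
    have Q: "dfn S (l + (?k + length v)) ?Q"
      by (rule dfn_sel[OF P] seln_intros | simp)+
    have Q1: "dfn S (l + length (c @ v)) ?Q" "dfn S (l + length (d @ v)) ?Q" using Q l by simp_all
    have s: "set (c @ v) \<subseteq> M \<union> set c" "set (d @ v) \<subseteq> M \<union> set d" using v by auto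
    have "?Q (b @ c @ v)" using h l by simp
    then have "eventually (\<lambda>q. ?Q (q @ c @ v)) U" using avgD[OF b(1) s(1) Q1(1)] by blast
    with U have "eventually (\<lambda>q. ?Q (q @ d @ v)) U"
    proof (rule eventually_elim2)
      fix q assume q: "length q = l \<and> set q \<subseteq> M" and "?Q (q @ c @ v)"
      then have "P (c @ q @ v)" by simp
      moreover have "dfn S (?k + length (q @ v)) P" using P q by (simp add: add.assoc)
      ultimately have "P (d @ q @ v)" using eqvD[OF cd, of "q @ v" P] q v by simp
      then show "?Q (q @ d @ v)" using q l by simp
    qed
    then have "?Q (b' @ d @ v)" using avgD[OF b(2) s(2) Q1(2)] by blast
    then show "P ((d @ b') @ v)" using l by simp
  qed
qed

lemma eventually_sequentially_ultra:
  "U \<le> sequentially \<Longrightarrow> (\<And>j. j > (i :: nat) \<Longrightarrow> P j) \<Longrightarrow> eventually P U"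
proof -
  assume "U \<le> sequentially" and P: "\<And>j. j > i \<Longrightarrow> P j"
  moreover have "eventually P sequentially"
    unfolding eventually_sequentially using P by (intro exI[of _ "Suc i"]) auto
  ultimately show ?thesis by (simp add: le_filter_def)
qed

section \<open>Amalgamation of wide types\<close>

text \<open>The parameters accumulated before step \<open>i\<close> of a construction that adds two
  tuples per step.\<close>

definition prv :: "(nat \<Rightarrow> 'm list \<times> 'm list) \<Rightarrow> nat \<Rightarrow> 'm set" where
  "prv f i = (\<Union>t<i. set (fst (f t)) \<union> set (snd (f t)))"

lemma prv_cong: "(\<And>t. t < i \<Longrightarrow> f t = g t) \<Longrightarrow> prv f i = prv g i"
  by (simp add: prv_def)

lemma prv_memb: "t < i \<Longrightarrow> set (fst (f t)) \<union> set (snd (f t)) \<subseteq> prv f i"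
  unfolding prv_def by blast

context monster
begin

lemma ex_avg_sequence:
  assumes "ultra U" "eventually (\<lambda>d. length d = n) U" "sm C"
  shows "\<exists>h. \<forall>j :: nat. avg S n U (C \<union> (\<Union>t<j. set (h t))) (h j)"
  by (rule avg_sequence_extension[OF assms, of 0 "\<lambda>_. []"]) auto

lemma sm_prv: "sm M \<Longrightarrow> sm (M \<union> prv f i)"
  by (rule sm_Un, assumption, rule sm_finite) (simp add: prv_def)

text \<open>With \<open>r\<close> a coheir of \<open>tp(b/M)\<close>, the realizations \<open>c\<^sub>j\<close> are wide over everything before
  them and \<open>c\<^sub>j b\<^sub>t \<equiv>\<^sub>M c' b\<close> for \<open>t < j\<close>, while each \<open>b\<^sub>j\<close> realizes \<open>r\<close> over everything before it.\<close>

lemma coheir_ladder: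
  assumes \<sigma>': "S1_small S n' \<sigma>'" and M: "sm M" and r: "coheir S M r b"
    and w: "wide S n' \<sigma>' (M \<union> set b) c'"
  obtains f :: "nat \<Rightarrow> 'm list \<times> 'm list" where "\<And>j. eqv S M (fst (f j)) c'" "\<And>t j. t < j \<Longrightarrow> eqv S M (fst (f j) @ snd (f t)) (c' @ b)"
    "\<And>j. avg S (length b) r (M \<union> set (fst (f j))) (snd (f j))"
proof -
  let ?l = "length b"
  have ru1: "ultra r" "eventually (\<lambda>d. length d = ?l \<and> set d \<subseteq> M) r"
    using r by (simp_all add: coheir_def)
  have "eventually (\<lambda>d. length d = ?l) r" using ru1(2) by (rule eventually_mono) simp
  note ru = ru1(1) this
  define Q where "Q f j cb \<longleftrightarrow> wide S n' \<sigma>' (M \<union> prv f j) (fst cb) \<and> eqv S M (fst cb) c' \<and>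
      (\<forall>t<j. eqv S M (fst cb @ snd (f t)) (c' @ b)) \<and> avg S ?l r (M \<union> prv f j \<union> set (fst cb)) (snd cb)"
    for f :: "nat \<Rightarrow> 'm list \<times> 'm list" and j :: nat and cb
  have "\<exists>f. \<forall>j. Q f j (f j)"
  proof (rule dependent_wellorder_choice)
    fix cb and f g :: "nat \<Rightarrow> 'm list \<times> 'm list" and j :: nat
    assume "\<And>t. t < j \<Longrightarrow> f t = g t"
    then show "Q f j cb = Q g j cb" using prv_cong[of j f g] by (simp add: Q_def)
  next
    fix j and f :: "nat \<Rightarrow> 'm list \<times> 'm list"
    assume IH: "\<And>t. t < j \<Longrightarrow> Q f t (f t)"
    have a: "avg S ?l r (M \<union> (\<Union>s<t. set (snd (f s)))) (snd (f t))" if "t < j" for t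
      by (rule avg_mono[of S ?l r "M \<union> prv f t \<union> set (fst (f t))"])
        (use IH[OF that] in \<open>auto simp: Q_def prv_def\<close>)
    \<comment> \<open>The second components found so far start a Morley sequence of the coheir. Its
      infinite continuation is what lets S1 make their finite conjunctions non-small.\<close>
    obtain h where h: "\<And>t. t < j \<Longrightarrow> h t = snd (f t)" "\<And>t. avg S ?l r (M \<union> (\<Union>s<t. set (h s))) (h t)"
      using avg_sequence_extension[OF ru M, of j "\<lambda>t. snd (f t)"] a by blast
    let ?X = "(\<lambda>t. snd (f t)) ` {..<j}"
    obtain c where c: "wide S n' \<sigma>' (M \<union> prv f j) c" "eqv S M c c'" "\<And>b'. b' \<in> ?X \<Longrightarrow> eqv S M (c @ b') (c' @ b)"
    proof (rule wide_extension_pairs[OF \<sigma>' wide_mono[OF w, of M], of "M \<union> prv f j" ?X b])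
      show "sm (M \<union> prv f j)" using sm_prv[OF M] .
      show "length b' = ?l \<and> set b' \<subseteq> M \<union> prv f j" if "b' \<in> ?X" for b'
        using that avg_length[OF a] prv_memb[of _ j f] by force
      show "\<not> \<sigma>' (\<lambda>y. \<forall>b'\<in>?X. R (y @ b' @ v))"
        if v: "set v \<subseteq> M" and R: "dfn S (n' + ?l + length v) R" and hold: "R (c' @ b @ v)" for R v
      proof -
        have R': "dfn S (n' + (?l + length v)) R" using R by (simp add: add.assoc)
        have "\<not> \<sigma>' (\<lambda>y. R (y @ b @ v))"
          using wideD[OF w, of "b @ v" R] v R' hold by auto
        then have "\<not> \<sigma>' (\<lambda>y. \<forall>t<j. R (y @ h t @ v))"
          using coheir_seq_conj[OF r \<sigma>' h(2) R' v] by blast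
        moreover have "(\<lambda>y. \<forall>b'\<in>?X. R (y @ b' @ v)) = (\<lambda>y. \<forall>t<j. R (y @ h t @ v))"
          using h(1) by (auto simp: fun_eq_iff)
        ultimately show ?thesis by simp
      qed
    qed auto
    have "sm (M \<union> prv f j \<union> set c)" by (rule sm_Un[OF sm_prv[OF M] sm_finite]) simp
    then obtain b' where "avg S ?l r (M \<union> prv f j \<union> set c) b'" using ex_avg[OF ru] by blast
    then have "Q f j (c, b')" using c by (auto simp: Q_def)
    then show "\<exists>cb. Q f j cb" by blast
  qed
  then obtain f where f: "\<And>j. Q f j (f j)" by blast
  show thesis
  proof (rule that[of f])
    show "avg S ?l r (M \<union> set (fst (f j))) (snd (f j))" for j
      by (rule avg_mono[of S ?l r "M \<union> prv f j \<union> set (fst (f j))"]) (use f[of j] in \<open>auto simp: Q_def\<close>)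
  qed (use f in \<open>auto simp: Q_def\<close>)
qed

text \<open>The ladder of the previous lemma, made indiscernible by averaging along a non-principal
  ultrafilter, would violate S1 if the conclusion failed.\<close>

lemma wide_amalgamation:
  assumes \<sigma>: "S1_small S n \<sigma>" and \<sigma>': "S1_small S n' \<sigma>'"
    and M: "elementary_substructure S M" "sm M"
    and c': "eqv S M c' c" "wide S n' \<sigma>' (M \<union> set b) c'" and w: "set w \<subseteq> M"
    and P: "dfn S (n + length b) P" and Q: "dfn S (n + (n' + length w)) Q"
    and ns: "\<not> \<sigma> (\<lambda>y. P (y @ b) \<and> Q (y @ c @ w))"
  shows "\<not> \<sigma> (\<lambda>y. P (y @ b) \<and> Q (y @ c' @ w))"
proof
  assume small: "\<sigma> (\<lambda>y. P (y @ b) \<and> Q (y @ c' @ w))"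
  interpret S1_small S n \<sigma> by fact
  let ?l = "length b" and ?k = "length w"
  have lc: "length c' = n'" "length c = n'" using wide_length[OF c'(2)] eqv_length[OF c'(1)] by auto
  obtain U where U: "coheir S M U (b @ c)"
    using coheir_exists[OF M(1)] by blast
  have Uu1: "ultra U" "eventually (\<lambda>d. length d = ?l + n' \<and> set d \<subseteq> M) U"
    using U lc by (simp_all add: coheir_def)
  have "eventually (\<lambda>d. length d = ?l + n') U" using Uu1(2) by (rule eventually_mono) simp
  note Uu = Uu1(1) this
  define r where "r = filtermap (take ?l) U"
  have r: "coheir S M r b" unfolding r_def by (rule coheir_take[OF U])
  obtain e where "\<forall>j :: nat. avg S (?l + n') U (M \<union> (\<Union>t<j. set (e t))) (e j)"
    by (rule exE[OF ex_avg_sequence[OF Uu(1,2) M(2)]])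
  then have e: "avg S (?l + n') U (M \<union> (\<Union>t<j. set (e t))) (e j)" for j by (rule spec)
  \<comment> \<open>The two terms are crossed: \<open>b1\<close> is taken from the later one, so
    that it realizes the coheir \<open>r\<close> over \<open>M\<close> and \<open>c0\<close>. The
    diagonal pairs of the ladder below are of exactly this kind.\<close>
  define b1 c0 where "b1 = take ?l (e 1)" and "c0 = drop ?l (e 0)"
  have le: "length (e j) = ?l + n'" for j using avg_length[OF e] .
  have l1: "length b1 = ?l" "length c0 = n'" by (simp_all add: b1_def c0_def le)
  define \<Psi> where "\<Psi> q \<longleftrightarrow> P (take n q @ take ?l (drop (n + n') q)) \<and>
    Q (take (n + n') q @ drop (n + n' + ?l) q)" for q
  have \<Psi>: "dfn S (n + (n' + ?l + ?k)) \<Psi>"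
    unfolding \<Psi>_def by (rule dfn_conj dfn_sel[OF P] dfn_sel[OF Q] seln_intros | simp)+
  have \<Psi>_iff: "\<Psi> (y @ u @ v @ w) \<longleftrightarrow> P (y @ v) \<and> Q (y @ u @ w)"
    if "length y = n" "length u = n'" "length v = ?l" for y u v
    using that by (simp add: \<Psi>_def)
  \<comment> \<open>Wideness survives the crossing: S1 makes the conjunction of both formulas at the
    two terms \<open>e 0\<close> and \<open>e 1\<close> non-small, and this conjunction implies the
    formula at \<open>c0\<close> and \<open>b1\<close>.\<close>
  have F1: "\<not> \<sigma> (\<lambda>y. \<Psi> (y @ c0 @ b1 @ w))"
  proof
    assume "\<sigma> (\<lambda>y. \<Psi> (y @ c0 @ b1 @ w))"
    then have 1: "\<sigma> (\<lambda>y. P (y @ b1) \<and> Q (y @ c0 @ w))"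
      by (rule small_mono) (use \<Psi>_iff l1 in simp)
    define \<Theta> where "\<Theta> q \<longleftrightarrow> P (take (n + ?l) q) \<and> Q (take n q @ drop (n + ?l) q)" for q
    have \<Theta>: "dfn S (n + (?l + n' + ?k)) \<Theta>"
      unfolding \<Theta>_def by (rule dfn_conj dfn_sel[OF P] dfn_sel[OF Q] seln_intros | simp)+
    have \<Theta>_iff: "\<Theta> (y @ u @ w) \<longleftrightarrow> P (y @ take ?l u) \<and> Q (y @ drop ?l u @ w)"
      if "length y = n" "length u = ?l + n'" for y u
      using that by (simp add: \<Theta>_def)
    have "\<not> \<sigma> (\<lambda>y. \<Theta> (y @ (b @ c) @ w))"
    proof
      assume "\<sigma> (\<lambda>y. \<Theta> (y @ (b @ c) @ w))"
      then have "\<sigma> (\<lambda>y. P (y @ b) \<and> Q (y @ c @ w))"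
        by (rule small_mono) (use \<Theta>_iff[of _ "b @ c"] lc in simp)
      then show False using ns by blast
    qed
    then have "\<not> \<sigma> (\<lambda>y. \<forall>j<2. \<Theta> (y @ e j @ w))"
      using coheir_seq_conj[OF U \<sigma>, of e w \<Theta> 2] e \<Theta> w lc by simp
    moreover have "\<sigma> (\<lambda>y. \<forall>j<2. \<Theta> (y @ e j @ w))"
    proof (rule small_mono[OF 1])
      fix y :: "'m list" assume y: "length y = n" and "\<forall>j<2. \<Theta> (y @ e j @ w)"
      then have "\<Theta> (y @ e 0 @ w)" "\<Theta> (y @ e 1 @ w)" by auto
      then show "P (y @ b1) \<and> Q (y @ c0 @ w)" using \<Theta>_iff[OF y le] by (simp add: b1_def c0_def)
    qed
    ultimately show False by blast
  qed
  have avg1: "avg S ?l r (M \<union> set c0) b1"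
    unfolding r_def b1_def
    by (rule avg_mono[OF avg_take[OF e[of 1] Uu(2)]]) (auto simp: c0_def dest: in_set_dropD)
  have cc0: "eqv S M c c0"
  proof -
    have "eqv S M (b @ c) (e 0)" using coheir_avg_eqv[OF U] e[of 0] lc by simp
    from eqv_sel[OF this seln_drop[OF seln_id], of ?l] show ?thesis by (simp add: c0_def)
  qed
  obtain f :: "nat \<Rightarrow> 'm list \<times> 'm list" where f: "\<And>j. eqv S M (fst (f j)) c'" "\<And>t j. t < j \<Longrightarrow> eqv S M (fst (f j) @ snd (f t)) (c' @ b)"
    "\<And>j. avg S ?l r (M \<union> set (fst (f j))) (snd (f j))"
    using coheir_ladder[OF \<sigma>' M(2) r c'(2)] by blast
  have lf: "length (fst (f j)) = n'" "length (snd (f j)) = ?l" for j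
    using eqv_length[OF f(1)] avg_length[OF f(3)] lc by auto
  \<comment> \<open>\<open>c'\<close> and \<open>c0\<close> have the same type over
    \<open>M\<close>, and an average along tuples of \<open>M\<close> is invariant over
    \<open>M\<close>. So the diagonal carries the wide configuration although \<open>c'\<close>
    itself occurs in a small one.\<close>
  have diag: "eqv S M (fst (f j) @ snd (f j)) (c0 @ b1)" for j
  proof (rule avg_pair[OF _ _ f(3) avg1])
    show "eventually (\<lambda>d. length d = ?l \<and> set d \<subseteq> M) r" using r by (simp add: coheir_def)
    show "eqv S M (fst (f j)) c0" using eqv_trans[OF eqv_trans[OF f(1) c'(1)] cc0] .
  qed
  obtain U0 where U0: "U0 \<le> sequentially" "ultra U0"
    by (rule ex_ultra[OF sequentially_bot])
  \<comment> \<open>Along a Morley sequence of \<open>V\<close> the order of the ladder is reversed: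
    \<open>g 0\<close> lies beyond all the pairs in \<open>C\<close> over which the average for
    \<open>g 1\<close> is taken.\<close>
  define V where "V = filtermap (\<lambda>i. fst (f i) @ snd (f i)) U0"
  define C where "C = M \<union> (\<Union>i. set (fst (f i) @ snd (f i)))"
  have V: "ultra V" "eventually (\<lambda>d. length d = n' + ?l \<and> set d \<subseteq> C) V"
    unfolding V_def eventually_filtermap
    using ultra_filtermap[OF U0(2)] lf by (auto simp: C_def intro!: always_eventually)
  have V': "eventually (\<lambda>d. length d = n' + ?l) V" using V(2) by (rule eventually_mono) simp
  have "countable (\<Union>i. set (fst (f i) @ snd (f i)))"
    by (rule countable_UN) (simp_all add: countable_finite)
  then have smC: "sm C" unfolding C_def using M(2) sm_countable sm_Un by blast
  obtain g where "\<forall>j :: nat. avg S (n' + ?l) V (C \<union> (\<Union>t<j. set (g t))) (g j)"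
    by (rule exE[OF ex_avg_sequence[OF V(1) V' smC]])
  then have g: "avg S (n' + ?l) V (C \<union> (\<Union>t<j. set (g t))) (g j)" for j by (rule spec)
  have lg: "length (g j) = n' + ?l" for j using avg_length[OF g] .
  define u0 v1 where "u0 = take n' (g 0)" and "v1 = drop n' (g 1)"
  have l2: "length u0 = n'" "length v1 = ?l" by (simp_all add: u0_def v1_def lg)
  have const: "eventually (\<lambda>_. Z) U0 \<longleftrightarrow> Z" for Z
    using U0(2) by (cases Z) (auto simp: ultra_def eventually_False)
  have MC: "M \<subseteq> C" by (auto simp: C_def)
  have g0: "eqv S M (c0 @ b1) (g 0)"
  proof (rule eqvI)
    show "length (c0 @ b1) = length (g 0)" by (simp add: l1 lg)
    fix v R assume v: "set v \<subseteq> M" and R: "dfn S (length (c0 @ b1) + length v) R" and hold: "R ((c0 @ b1) @ v)"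
    have "R ((fst (f i) @ snd (f i)) @ v)" for i
      using eqvD[OF eqv_sym[OF diag] v R] hold by blast
    then have "eventually (\<lambda>d. R (d @ v)) V"
      unfolding V_def eventually_filtermap by (simp add: always_eventually)
    then show "R (g 0 @ v)" using avgD[OF g[of 0], of v R] v R l1 MC by auto
  qed
  have g01: "eqv S M (c' @ b) (u0 @ v1)"
  proof (rule eqvI)
    show "length (c' @ b) = length (u0 @ v1)" by (simp add: l2 lc)
    fix v R assume v: "set v \<subseteq> M" and R0: "dfn S (length (c' @ b) + length v) R" and hold: "R ((c' @ b) @ v)"
    have R: "dfn S (n' + ?l + length v) R" using R0 lc by simp
    \<comment> \<open>The indices up to \<open>i\<close> are negligible for a non-principal
      ultrafilter; beyond them the pairs have the off-diagonal type, that of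
      \<open>c' @ b\<close>.\<close>
    have in1: "R (u0 @ snd (f i) @ v)" for i
    proof -
      let ?R = "\<lambda>q. R (take n' q @ drop (n' + ?l) q)"
      have R1: "dfn S (n' + ?l + length (snd (f i) @ v)) ?R"
        by (rule dfn_sel[OF R] seln_intros | simp add: lf)+
      have s: "set (snd (f i) @ v) \<subseteq> C \<union> (\<Union>t<0. set (g t))" using v by (auto simp: C_def)
      have "eventually (\<lambda>j. R (fst (f j) @ snd (f i) @ v)) U0"
      proof (rule eventually_sequentially_ultra[OF U0(1), of i])
        fix j assume "i < j"
        from eqvD[OF eqv_sym[OF f(2)[OF this]] v R0] hold
        show "R (fst (f j) @ snd (f i) @ v)" by simp
      qed
      then have "eventually (\<lambda>d. ?R (d @ snd (f i) @ v)) V"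
        unfolding V_def eventually_filtermap by (simp add: lf)
      then have "?R (g 0 @ snd (f i) @ v)" using avgD[OF g[of 0] s R1] by blast
      then show ?thesis by (simp add: lg u0_def)
    qed
    let ?R = "\<lambda>q. R (take n' (drop (n' + ?l) q) @ take ?l (drop n' q) @ drop (n' + ?l + n') q)"
    have R2: "dfn S (n' + ?l + length (u0 @ v)) ?R"
      by (rule dfn_sel[OF R] seln_intros | simp add: l2)+
    have s: "set (u0 @ v) \<subseteq> C \<union> (\<Union>t<1. set (g t))" using v MC by (auto simp: u0_def dest: in_set_takeD)
    have "eventually (\<lambda>d. ?R (d @ u0 @ v)) V"
      unfolding V_def eventually_filtermap using in1 by (simp add: lf l2 always_eventually)
    then have "?R (g 1 @ u0 @ v)" using avgD[OF g[of 1] s R2] by blast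
    then show "R ((u0 @ v1) @ v)" by (simp add: lg l2 v1_def)
  qed
  have "indiscernible S C (\<lambda>j. g j @ w)"
  proof (rule avg_indiscernible)
    show "ultra (filtermap (\<lambda>d. d @ w) V)" using V(1) by (rule ultra_filtermap)
    show "eventually (\<lambda>d. length d = n' + ?l + ?k \<and> set d \<subseteq> C) (filtermap (\<lambda>d. d @ w) V)"
      unfolding eventually_filtermap using V(2) by (rule eventually_mono) (use w MC in auto)
    show "avg S (n' + ?l + ?k) (filtermap (\<lambda>d. d @ w) V) (C \<union> (\<Union>j<i. set (g j @ w))) (g i @ w)" for i
    proof -
      have "avg S (n' + ?l + ?k) (filtermap (\<lambda>d. d @ w) V) (C \<union> (\<Union>j<i. set (g j))) (g i @ w)"
        by (rule avg_append[OF g]) (use w MC in auto)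
      then show ?thesis by (rule avg_mono) (use w MC in auto)
    qed
  qed
  then have ind: "indiscernible S {} (\<lambda>j. g j @ w)" by (rule indiscernible_mono) simp
  have "\<sigma> (\<lambda>y. \<Psi> (y @ c' @ b @ w))"
    by (rule small_mono[OF small]) (use \<Psi>_iff lc in simp)
  moreover have "dfn S (n + length ((c' @ b) @ w)) \<Psi>" using \<Psi> lc by (simp add: add.assoc)
  moreover have "eqv S {} ((c' @ b) @ w) ((u0 @ v1) @ w)"
    using eqv_append_params[OF g01 w] eqv_mono by blast
  ultimately have "\<sigma> (\<lambda>y. \<Psi> (y @ (u0 @ v1) @ w))"
    using small_inv[of "(c' @ b) @ w" \<Psi> "(u0 @ v1) @ w"] by simp
  \<comment> \<open>The conjunction at \<open>g 0\<close> and \<open>g 1\<close> implies the crossed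
    formula at \<open>u0\<close> and \<open>v1\<close>, a copy of the pair assumed to be
    small.\<close>
  then have "\<sigma> (\<lambda>y. \<Psi> (y @ g 0 @ w) \<and> \<Psi> (y @ g 1 @ w))"
  proof (rule small_mono)
    fix y :: "'m list" assume y: "length y = n" and h: "\<Psi> (y @ g 0 @ w) \<and> \<Psi> (y @ g 1 @ w)"
    have "g 0 = u0 @ drop n' (g 0)" "g 1 = take n' (g 1) @ v1" by (simp_all add: u0_def v1_def)
    then have "\<Psi> (y @ u0 @ drop n' (g 0) @ w)" "\<Psi> (y @ take n' (g 1) @ v1 @ w)"
      using h by (metis append_assoc)+
    then show "\<Psi> (y @ (u0 @ v1) @ w)"
      using \<Psi>_iff[OF y l2(1), of "drop n' (g 0)"] \<Psi>_iff[OF y _ l2(2), of "take n' (g 1)"]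
        \<Psi>_iff[OF y l2] by (simp add: lg)
  qed
  \<comment> \<open>S1 now yields smallness at \<open>g 0\<close> alone, a copy of the diagonal
    pair, where \<open>F1\<close> forbids it.\<close>
  then have "\<sigma> (\<lambda>y. \<Psi> (y @ g 0 @ w))"
    using small_S1[OF \<Psi>, of "\<lambda>j. g j @ w"] ind lg by simp
  moreover have "dfn S (n + length (g 0 @ w)) \<Psi>" using \<Psi> lg by (simp add: add.assoc)
  moreover have "eqv S {} (g 0 @ w) ((c0 @ b1) @ w)"
    using eqv_append_params[OF eqv_sym[OF g0] w] eqv_mono by blast
  ultimately have "\<sigma> (\<lambda>y. \<Psi> (y @ (c0 @ b1) @ w))"
    using small_inv[of "g 0 @ w" \<Psi> "(c0 @ b1) @ w"] by blast
  then show False using F1 by simp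
qed

section \<open>Independent sequences with prescribed types of pairs\<close>

lemma conj_along_sequence_dfn:
  assumes "dfn S (n + (n' + length w)) Q" "\<And>i. i < j \<Longrightarrow> length (as i) = n'"
  shows "\<exists>P. dfn S (n + length (concat (map as [0..<j]) @ w)) P \<and>
    (\<forall>y. length y = n \<longrightarrow> (P (y @ concat (map as [0..<j]) @ w) \<longleftrightarrow> (\<forall>i<j. Q (y @ as i @ w))))"
  using assms(2)
proof (induction j)
  case 0
  show ?case by (intro exI[of _ "\<lambda>_. True"]) (simp add: dfn_True)
next
  case (Suc j)
  let ?L = "concat (map as [0..<j])"
  let ?k = "length ?L"
  obtain P where P: "dfn S (n + length (?L @ w)) P"
    "\<And>y. length y = n \<Longrightarrow> P (y @ ?L @ w) \<longleftrightarrow> (\<forall>i<j. Q (y @ as i @ w))"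
    using Suc by auto
  have l: "length (as j) = n'" using Suc.prems by simp
  define P' where "P' q \<longleftrightarrow> P (take (n + ?k) q @ drop (n + ?k + n') q) \<and> Q (take n q @ drop (n + ?k) q)" for q
  have "dfn S (n + (?k + n' + length w)) P'"
    unfolding P'_def by (rule dfn_conj dfn_sel[OF P(1)] dfn_sel[OF assms(1)] seln_intros | simp)+
  moreover have "concat (map as [0..<Suc j]) = ?L @ as j" by simp
  moreover have "P' (y @ ?L @ as j @ w) \<longleftrightarrow> (\<forall>i<Suc j. Q (y @ as i @ w))" if "length y = n" for y
  proof -
    have "P' (y @ ?L @ as j @ w) \<longleftrightarrow> P (y @ ?L @ w) \<and> Q (y @ as j @ w)"
      using that l by (simp add: P'_def del: length_concat)
    then show ?thesis using P(2)[OF that] by (auto simp: less_Suc_eq)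
  qed
  ultimately show ?case using l by (intro exI[of _ P']) (simp add: add.assoc del: length_concat upt_Suc)
qed

text \<open>Repeating the conjunct at \<open>as 0\<close> changes nothing. Amalgamation then
  exchanges the parameter of the repeated conjunct for \<open>as j\<close>, which has the same type
  over \<open>M\<close> and is wide over the earlier entries.\<close>

lemma wide_conj:
  assumes \<sigma>: "S1_small S n \<sigma>" and \<sigma>': "S1_small S n' \<sigma>'"
    and M: "elementary_substructure S M" "sm M"
    and as: "\<And>i. i < (j :: nat) \<Longrightarrow> eqv S M (as i) a \<and> wide S n' \<sigma>' (M \<union> (\<Union>t<i. set (as t))) (as i)"
    and b: "wide S n \<sigma> (M \<union> set a) b" and a: "length a = n'"
    and Q: "set w \<subseteq> M" "dfn S (n + length a + length w) Q" "Q (b @ a @ w)"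
  shows "\<not> \<sigma> (\<lambda>y. \<forall>i<j. Q (y @ as i @ w))"
proof -
  interpret S1_small S n \<sigma> by fact
  have Q': "dfn S (n + (n' + length w)) Q" using Q(2) a by (simp add: add.assoc)
  have base: "\<not> \<sigma> (\<lambda>y. Q (y @ a @ w))"
    using wideD[OF b, of "a @ w" Q] Q Q' a by auto
  show ?thesis
    using as
  proof (induction j)
    case 0
    show ?case
    proof
      assume "\<sigma> (\<lambda>y. \<forall>i<0. Q (y @ as i @ w))"
      then have "\<sigma> (\<lambda>y. Q (y @ a @ w))" by (rule small_mono) simp
      then show False using base by blast
    qed
  next
    case (Suc j)
    have las: "length (as i) = n'" if "i < Suc j" for i
      using Suc.prems[OF that] eqv_length a by metis
    have IH: "\<not> \<sigma> (\<lambda>y. \<forall>i<j. Q (y @ as i @ w))" by (rule Suc.IH) (use Suc.prems in simp)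
    show ?case
    proof (cases "j = 0")
      case True
      have e: "eqv S {} (as 0 @ w) (a @ w)"
        using Suc.prems[of 0] eqv_append_params[OF _ Q(1)] eqv_mono by blast
      have "dfn S (n + length (as 0 @ w)) Q" using Q' las[of 0] by simp
      then show ?thesis using small_inv[OF _ e] base True by auto
    next
      case False
      let ?L = "concat (map as [0..<j])"
      obtain P where P: "dfn S (n + length (?L @ w)) P"
        "\<And>y. length y = n \<Longrightarrow> P (y @ ?L @ w) \<longleftrightarrow> (\<forall>i<j. Q (y @ as i @ w))"
        using conj_along_sequence_dfn[OF Q', of j as] las by auto
      have "\<not> \<sigma> (\<lambda>y. P (y @ ?L @ w) \<and> Q (y @ as 0 @ w))"
      proof
        assume "\<sigma> (\<lambda>y. P (y @ ?L @ w) \<and> Q (y @ as 0 @ w))"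
        then have "\<sigma> (\<lambda>y. \<forall>i<j. Q (y @ as i @ w))"
          by (rule small_mono) (use P(2) False in auto)
        then show False using IH by blast
      qed
      then have "\<not> \<sigma> (\<lambda>y. P (y @ ?L @ w) \<and> Q (y @ as j @ w))"
      \<comment> \<open>The conjunction over the first \<open>j\<close> entries takes the part of
        \<open>P\<close>, with all these entries and \<open>w\<close> as its parameter.\<close>
      proof (rule wide_amalgamation[OF \<sigma> \<sigma>' M _ _ Q(1) P(1) Q', rotated 2])
        show "eqv S M (as j) (as 0)"
          using Suc.prems[of j] Suc.prems[of 0] eqv_trans eqv_sym by blast
        show "wide S n' \<sigma>' (M \<union> set (?L @ w)) (as j)"
          by (rule wide_mono[of S n' \<sigma>' "M \<union> (\<Union>t<j. set (as t))"]) (use Suc.prems[of j] Q(1) in auto)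
      qed
      moreover have "P (y @ ?L @ w) \<and> Q (y @ as j @ w) \<longleftrightarrow> (\<forall>i<Suc j. Q (y @ as i @ w))"
        if "length y = n" for y
        using P(2)[OF that] by (auto simp: less_Suc_eq)
      ultimately show ?thesis
        using small_cong[of "\<lambda>y. P (y @ ?L @ w) \<and> Q (y @ as j @ w)" "\<lambda>y. \<forall>i<Suc j. Q (y @ as i @ w)"] by blast
    qed
  qed
qed

text \<open>The two given pairs have entries of the same types over \<open>M\<close> but possibly
  different joint types; the order of appearance of two tuples decides which pair they copy. A new
  tuple must copy a pair with all earlier partners at once, and \<open>wide_conj\<close> makes this
  demand non-small.\<close>

lemma alternating_sequence:
  assumes \<sigma>1: "S1_small S n1 \<sigma>1" and \<sigma>2: "S1_small S n2 \<sigma>2"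
    and M: "elementary_substructure S M" "sm M"
    and u0: "wide S n1 \<sigma>1 (M \<union> set v0) u0" and v0: "length v0 = n2"
    and v0': "wide S n2 \<sigma>2 (M \<union> set u0') v0'"
    and uu: "eqv S M u0 u0'" and vv: "eqv S M v0 v0'"
  shows "\<exists>f.
    (\<forall>i. wide S n1 \<sigma>1 (M \<union> prv f i) (fst (f i)) \<and>
      wide S n2 \<sigma>2 (M \<union> prv f i \<union> set (fst (f i))) (snd (f i))) \<and>
    (\<forall>i j. j < i \<longrightarrow> eqv S M (fst (f i) @ snd (f j)) (u0 @ v0)) \<and>
    (\<forall>i j. j \<le> i \<longrightarrow> eqv S M (snd (f i) @ fst (f j)) (v0' @ u0'))"
proof -
  have lu: "length u0 = n1" "length u0' = n1" using wide_length[OF u0] eqv_length[OF uu] by auto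
  define Q where "Q f i uv \<longleftrightarrow>
      wide S n1 \<sigma>1 (M \<union> prv f i) (fst uv) \<and> eqv S M (fst uv) u0 \<and>
      (\<forall>j<i. eqv S M (fst uv @ snd (f j)) (u0 @ v0)) \<and>
      wide S n2 \<sigma>2 (M \<union> prv f i \<union> set (fst uv)) (snd uv) \<and> eqv S M (snd uv) v0' \<and>
      (\<forall>j<i. eqv S M (snd uv @ fst (f j)) (v0' @ u0')) \<and> eqv S M (snd uv @ fst uv) (v0' @ u0')"
    for f :: "nat \<Rightarrow> 'm list \<times> 'm list" and i :: nat and uv
  have "\<exists>f. \<forall>i. Q f i (f i)"
  proof (rule dependent_wellorder_choice)
    fix uv and f g :: "nat \<Rightarrow> 'm list \<times> 'm list" and i :: nat
    assume "\<And>t. t < i \<Longrightarrow> f t = g t"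
    then show "Q f i uv = Q g i uv" using prv_cong[of i f g] by (simp add: Q_def)
  next
    fix i and f :: "nat \<Rightarrow> 'm list \<times> 'm list"
    assume IH: "\<And>t. t < i \<Longrightarrow> Q f t (f t)"
    have fl: "length (fst (f t)) = n1 \<and> length (snd (f t)) = n2" if "t < i" for t
      using IH[OF that] unfolding Q_def by (meson wide_length)
    have memb: "set (fst (f t)) \<subseteq> prv f i" "set (snd (f t)) \<subseteq> prv f i" if "t < i" for t
      using prv_memb[OF that, of f] by auto
    let ?X = "(\<lambda>t. snd (f t)) ` {..<i}"
    have v_ok: "eqv S M (snd (f t)) v0 \<and> wide S n2 \<sigma>2 (M \<union> (\<Union>s<t. set (snd (f s)))) (snd (f t))"
      if "t < i" for t
    proof
      show "eqv S M (snd (f t)) v0" using IH[OF that] eqv_trans eqv_sym[OF vv] by (auto simp: Q_def)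
      show "wide S n2 \<sigma>2 (M \<union> (\<Union>s<t. set (snd (f s)))) (snd (f t))"
        by (rule wide_mono[of S n2 \<sigma>2 "M \<union> prv f t \<union> set (fst (f t))"])
          (use IH[OF that] in \<open>auto simp: Q_def prv_def\<close>)
    qed
    obtain u where u: "wide S n1 \<sigma>1 (M \<union> prv f i) u" "eqv S M u u0" "\<And>b'. b' \<in> ?X \<Longrightarrow> eqv S M (u @ b') (u0 @ v0)"
    proof (rule wide_extension_pairs[OF \<sigma>1 wide_mono[OF u0, of M], of "M \<union> prv f i" ?X v0])
      show "sm (M \<union> prv f i)" using sm_prv[OF M(2)] .
      show "length b' = length v0 \<and> set b' \<subseteq> M \<union> prv f i" if "b' \<in> ?X" for b'
        using that fl memb v0 by fastforce
      show "\<not> \<sigma>1 (\<lambda>y. \<forall>b'\<in>?X. R (y @ b' @ w))"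
        if "set w \<subseteq> M" "dfn S (n1 + length v0 + length w) R" "R (u0 @ v0 @ w)" for R w
      proof -
        have "(\<lambda>y. \<forall>b'\<in>?X. R (y @ b' @ w)) = (\<lambda>y. \<forall>t<i. R (y @ snd (f t) @ w))"
          by (auto simp: fun_eq_iff)
        then show ?thesis using wide_conj[OF \<sigma>1 \<sigma>2 M, of i "\<lambda>t. snd (f t)", OF v_ok u0 v0 that] by simp
      qed
    qed auto
    \<comment> \<open>The new \<open>v\<close> is paired also with the \<open>u\<close> of its own
      step, so its partners are one more than those of \<open>u\<close>.\<close>
    define as where "as t = (if t < i then fst (f t) else u)" for t
    let ?Y = "as ` {..<Suc i}"
    have u_ok: "eqv S M (as t) u0' \<and> wide S n1 \<sigma>1 (M \<union> (\<Union>s<t. set (as s))) (as t)"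
      if "t < Suc i" for t
    proof
      show "eqv S M (as t) u0'"
        using IH[of t] u(2) eqv_trans[OF _ uu] by (auto simp: Q_def as_def)
      have sub: "(\<Union>s<t. set (as s)) \<subseteq> prv f t"
        using that by (auto simp: as_def prv_def)
      have "wide S n1 \<sigma>1 (M \<union> prv f t) (as t)"
        using IH[of t] u(1) that by (auto simp: Q_def as_def less_Suc_eq)
      then show "wide S n1 \<sigma>1 (M \<union> (\<Union>s<t. set (as s))) (as t)"
        by (rule wide_mono) (use sub in auto)
    qed
    obtain v where v: "wide S n2 \<sigma>2 (M \<union> prv f i \<union> set u) v" "eqv S M v v0'"
      "\<And>b'. b' \<in> ?Y \<Longrightarrow> eqv S M (v @ b') (v0' @ u0')"
    proof (rule wide_extension_pairs[OF \<sigma>2 wide_mono[OF v0', of M], of "M \<union> prv f i \<union> set u" ?Y u0'])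
      show "sm (M \<union> prv f i \<union> set u)" by (rule sm_Un[OF sm_prv[OF M(2)] sm_finite]) simp
      show "length b' = length u0' \<and> set b' \<subseteq> M \<union> prv f i \<union> set u" if b': "b' \<in> ?Y" for b'
      proof -
        obtain t where t: "t < Suc i" "b' = as t" using b' by blast
        show ?thesis
        proof (cases "t < i")
          case True
          then show ?thesis using fl[OF True] memb(1)[OF True] t lu by (auto simp: as_def)
        next
          case False
          then show ?thesis using wide_length[OF u(1)] t lu by (auto simp: as_def)
        qed
      qed
      show "\<not> \<sigma>2 (\<lambda>y. \<forall>b'\<in>?Y. R (y @ b' @ w))"
        if "set w \<subseteq> M" "dfn S (n2 + length u0' + length w) R" "R (v0' @ u0' @ w)" for R w
      proof -
        have "(\<lambda>y. \<forall>b'\<in>?Y. R (y @ b' @ w)) = (\<lambda>y. \<forall>t<Suc i. R (y @ as t @ w))"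
          by (auto simp: fun_eq_iff)
        then show ?thesis using wide_conj[OF \<sigma>2 \<sigma>1 M, of "Suc i" as, OF u_ok v0' lu(2) that] by simp
      qed
    qed auto
    have "Q f i (u, v)"
      unfolding Q_def fst_conv snd_conv
    proof (intro conjI allI impI u v)
      show "snd (f j) \<in> ?X" if "j < i" for j using that by simp
      show "fst (f j) \<in> ?Y" if "j < i" for j
        using that by (intro image_eqI[of _ _ j]) (auto simp: as_def)
      show "u \<in> ?Y" by (intro image_eqI[of _ _ i]) (auto simp: as_def)
    qed
    then show "\<exists>uv. Q f i uv" by blast
  qed
  then obtain f where f: "\<And>i. Q f i (f i)" by blast
  show ?thesis
  proof (intro exI[of _ f] conjI allI impI)
    show "eqv S M (snd (f i) @ fst (f j)) (v0' @ u0')" if "j \<le> i" for i j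
      using f[of i] that by (auto simp: Q_def le_less)
  qed (use f in \<open>auto simp: Q_def\<close>)
qed

end

section \<open>Trees and ladders\<close>

text \<open>Existence of a binary tree of height \<open>n\<close> with nodes in \<open>W\<close> and leaves in \<open>Z\<close>; a leaf satisfies
  \<open>\<rho> _ b\<close> for exactly those nodes \<open>b\<close> on its branch where the branch goes left.\<close>

primrec tree :: "('a \<Rightarrow> 'b \<Rightarrow> bool) \<Rightarrow> nat \<Rightarrow> 'a set \<Rightarrow> 'b set \<Rightarrow> bool" where
  "tree \<rho> 0 Z W \<longleftrightarrow> Z \<noteq> {}"
| "tree \<rho> (Suc n) Z W \<longleftrightarrow> (\<exists>b\<in>W. tree \<rho> n {a \<in> Z. \<rho> a b} W \<and> tree \<rho> n {a \<in> Z. \<not> \<rho> a b} W)"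

lemma tree_mono: "tree \<rho> n Z W \<Longrightarrow> Z \<subseteq> Z' \<Longrightarrow> W \<subseteq> W' \<Longrightarrow> tree \<rho> n Z' W'"
proof (induction n arbitrary: Z Z')
  case (Suc n)
  then obtain b where b: "b \<in> W" "tree \<rho> n {a \<in> Z. \<rho> a b} W" "tree \<rho> n {a \<in> Z. \<not> \<rho> a b} W" by auto
  have "tree \<rho> n {a \<in> Z'. \<rho> a b} W'"
    by (rule Suc.IH[OF b(2)]) (use Suc.prems in auto)
  moreover have "tree \<rho> n {a \<in> Z'. \<not> \<rho> a b} W'"
    by (rule Suc.IH[OF b(3)]) (use Suc.prems in auto)
  ultimately show ?case using b(1) Suc.prems(3) by auto
qed auto

lemma tree_nonempty: "tree \<rho> n Z W \<Longrightarrow> Z \<noteq> {}"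
proof (induction n arbitrary: Z)
  case (Suc n)
  then obtain b where "tree \<rho> n {a \<in> Z. \<rho> a b} W" by auto
  then show ?case using Suc.IH by blast
qed auto

text \<open>Pigeonhole for trees. If the root lies in \<open>W1\<close>, either both subtrees
  contain trees over \<open>W1\<close>, which the root joins to one of the required height, or one
  of them already contains the tree over \<open>W2\<close>. The other colour is symmetric.\<close>

lemma tree_split: "tree \<rho> (n + m) Z (W1 \<union> W2) \<Longrightarrow> tree \<rho> n Z W1 \<or> tree \<rho> m Z W2"
proof (induction "n + m" arbitrary: n m Z)
  case 0
  then show ?case by auto
next
  case (Suc k)
  show ?case
  proof (cases "n = 0 \<or> m = 0")
    case True
    then show ?thesis using tree_nonempty[OF Suc.prems] by auto
  next
    case False
    then obtain n' m' where nm: "n = Suc n'" "m = Suc m'" by (meson not0_implies_Suc)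
    have "tree \<rho> (Suc k) Z (W1 \<union> W2)" using Suc by simp
    then obtain b where b: "b \<in> W1 \<union> W2" and t: "tree \<rho> k {a \<in> Z. \<rho> a b} (W1 \<union> W2)"
      "tree \<rho> k {a \<in> Z. \<not> \<rho> a b} (W1 \<union> W2)" by auto
    show ?thesis
    proof (cases "b \<in> W1")
      case True
      have k: "k = n' + m" using Suc(2) nm by simp
      have "tree \<rho> n' {a \<in> Z. \<rho> a b} W1 \<or> tree \<rho> m {a \<in> Z. \<rho> a b} W2"
        "tree \<rho> n' {a \<in> Z. \<not> \<rho> a b} W1 \<or> tree \<rho> m {a \<in> Z. \<not> \<rho> a b} W2"
        using Suc(1)[OF k] t k by auto
      moreover have "tree \<rho> m Z W2" if "tree \<rho> m Z' W2" "Z' \<subseteq> Z" for Z'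
        using tree_mono[OF that] by blast
      moreover have "{a \<in> Z. \<rho> a b} \<subseteq> Z" "{a \<in> Z. \<not> \<rho> a b} \<subseteq> Z" by auto
      ultimately show ?thesis using True nm(1) by auto
    next
      case False
      then have "b \<in> W2" using b by blast
      have k: "k = n + m'" using Suc(2) nm by simp
      have "tree \<rho> n {a \<in> Z. \<rho> a b} W1 \<or> tree \<rho> m' {a \<in> Z. \<rho> a b} W2"
        "tree \<rho> n {a \<in> Z. \<not> \<rho> a b} W1 \<or> tree \<rho> m' {a \<in> Z. \<not> \<rho> a b} W2"
        using Suc(1)[OF k] t k by auto
      moreover have "tree \<rho> n Z W1" if "tree \<rho> n Z' W1" "Z' \<subseteq> Z" for Z'
        using tree_mono[OF that] by blast
      moreover have "{a \<in> Z. \<rho> a b} \<subseteq> Z" "{a \<in> Z. \<not> \<rho> a b} \<subseteq> Z" by auto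
      ultimately show ?thesis using \<open>b \<in> W2\<close> nm(2) by auto
    qed
  qed
qed

text \<open>Any ladder found in the smaller tree can be extended by \<open>(a, b)\<close>, at its beginning or at its end.\<close>

lemma tree_ladder_step:
  assumes "tree \<rho> (2 * h + 2) Z W"
  obtains a b where "a \<in> Z" "b \<in> W" "\<rho> a b"
    "tree \<rho> h {a' \<in> Z. \<not> \<rho> a' b} {b' \<in> W. \<rho> a b'} \<or> tree \<rho> h {a' \<in> Z. \<rho> a' b} {b' \<in> W. \<not> \<rho> a b'}"
proof -
  have "tree \<rho> (Suc (2 * h + 1)) Z W" using assms by simp
  then obtain b where b: "b \<in> W" "tree \<rho> (2 * h + 1) {a' \<in> Z. \<rho> a' b} W" by auto
  let ?Z = "{a' \<in> Z. \<rho> a' b}"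
  obtain a where a: "a \<in> ?Z" using tree_nonempty[OF b(2)] by blast
  \<comment> \<open>Below the root \<open>2 * h + 1\<close> levels remain. The nodes related to
    \<open>a\<close> are allotted one level more, because that case spends a further root.\<close>
  have "2 * h + 1 = Suc h + h" "W = {b' \<in> W. \<rho> a b'} \<union> {b' \<in> W. \<not> \<rho> a b'}" by auto
  then have "tree \<rho> (Suc h + h) ?Z ({b' \<in> W. \<rho> a b'} \<union> {b' \<in> W. \<not> \<rho> a b'})" using b(2) by metis
  then consider "tree \<rho> (Suc h) ?Z {b' \<in> W. \<rho> a b'}" | "tree \<rho> h ?Z {b' \<in> W. \<not> \<rho> a b'}"
    using tree_split by blast
  then show thesis
  proof cases
    case 1
    \<comment> \<open>The root of the subtree serves as the node \<open>c\<close> and its right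
      branch supplies the leaves, so \<open>(a, c)\<close> can precede any ladder found
      there.\<close>
    then obtain c where c: "c \<in> W" "\<rho> a c" "tree \<rho> h {a' \<in> ?Z. \<not> \<rho> a' c} {b' \<in> W. \<rho> a b'}" by auto
    have "tree \<rho> h {a' \<in> Z. \<not> \<rho> a' c} {b' \<in> W. \<rho> a b'}" by (rule tree_mono[OF c(3)]) auto
    then show thesis using that[of a c] a c by auto
  next
    case 2
    \<comment> \<open>All leaves lie on the left of the original root \<open>b\<close>, while the
      nodes are unrelated to \<open>a\<close>: \<open>(a, b)\<close> can follow any ladder found
      there.\<close>
    then show thesis using that[of a b] a b by auto
  qed
qed

lemma tree_ladder:
  "tree \<rho> (2 ^ (k + 1) - 2) Z W \<Longrightarrow> \<exists>as bs. length as = k \<and> length bs = k \<and> set as \<subseteq> Z \<and> set bs \<subseteq> W \<and>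
    (\<forall>i<k. \<forall>j<k. \<rho> (as ! i) (bs ! j) \<longleftrightarrow> i \<le> j)"
proof (induction k arbitrary: Z W)
  case 0
  then show ?case by simp
next
  case (Suc k)
  define h where "h = (2 :: nat) ^ (k + 1) - 2"
  have "(2 :: nat) ^ (k + 1) \<ge> 2" by simp
  moreover have "(2 :: nat) ^ (Suc k + 1) = 2 * 2 ^ (k + 1)" by simp
  ultimately have "(2 :: nat) ^ (Suc k + 1) - 2 = 2 * h + 2" unfolding h_def by linarith
  then have "tree \<rho> (2 * h + 2) Z W" using Suc.prems by simp
  then obtain a b where ab: "a \<in> Z" "b \<in> W" "\<rho> a b"
    and t: "tree \<rho> h {a' \<in> Z. \<not> \<rho> a' b} {b' \<in> W. \<rho> a b'} \<or> tree \<rho> h {a' \<in> Z. \<rho> a' b} {b' \<in> W. \<not> \<rho> a b'}"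
    using tree_ladder_step by blast
  from t show ?case
  proof
    assume "tree \<rho> h {a' \<in> Z. \<not> \<rho> a' b} {b' \<in> W. \<rho> a b'}"
    from Suc.IH[OF this[unfolded h_def]] obtain as bs where l: "length as = k" "length bs = k" "set as \<subseteq> {a' \<in> Z. \<not> \<rho> a' b}"
      "set bs \<subseteq> {b' \<in> W. \<rho> a b'}" "\<forall>i<k. \<forall>j<k. \<rho> (as ! i) (bs ! j) \<longleftrightarrow> i \<le> j"
      by blast
    have "as ! i \<in> {a' \<in> Z. \<not> \<rho> a' b}" "bs ! i \<in> {b' \<in> W. \<rho> a b'}" if "i < k" for i
      by (rule subsetD[OF l(3) nth_mem], use that l(1) in simp)
        (rule subsetD[OF l(4) nth_mem], use that l(2) in simp)
    then have "\<not> \<rho> (as ! i) b" "\<rho> a (bs ! i)" if "i < k" for i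
      using that by auto
    then have "\<rho> ((a # as) ! i) ((b # bs) ! j) \<longleftrightarrow> i \<le> j" if "i < Suc k" "j < Suc k" for i j
      using l(5) ab(3) that by (cases i; cases j) auto
    then show ?thesis using l ab by (intro exI[of _ "a # as"] exI[of _ "b # bs"]) auto
  next
    assume "tree \<rho> h {a' \<in> Z. \<rho> a' b} {b' \<in> W. \<not> \<rho> a b'}"
    from Suc.IH[OF this[unfolded h_def]] obtain as bs where l: "length as = k" "length bs = k" "set as \<subseteq> {a' \<in> Z. \<rho> a' b}"
      "set bs \<subseteq> {b' \<in> W. \<not> \<rho> a b'}" "\<forall>i<k. \<forall>j<k. \<rho> (as ! i) (bs ! j) \<longleftrightarrow> i \<le> j"
      by blast
    have "as ! i \<in> {a' \<in> Z. \<rho> a' b}" "bs ! i \<in> {b' \<in> W. \<not> \<rho> a b'}" if "i < k" for i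
      by (rule subsetD[OF l(3) nth_mem], use that l(1) in simp)
        (rule subsetD[OF l(4) nth_mem], use that l(2) in simp)
    then have "\<rho> (as ! i) b" "\<not> \<rho> a (bs ! i)" if "i < k" for i
      using that by auto
    then have "\<rho> ((as @ [a]) ! i) ((bs @ [b]) ! j) \<longleftrightarrow> i \<le> j" if "i < Suc k" "j < Suc k" for i j
      using l ab(3) that by (auto simp: nth_append less_Suc_eq)
    then show ?thesis using l ab by (intro exI[of _ "as @ [a]"] exI[of _ "bs @ [b]"]) auto
  qed
qed

section \<open>Small elementary substructures\<close>

text \<open>The cardinal bound is represented by a set, so that the size of a language can be given
  as a disjoint sum.\<close>

locale infinite_bound =
  fixes L :: "'l set"
  assumes infinite_L: "infinite L"
begin

definition le :: "'a set \<Rightarrow> bool" where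
  "le A \<longleftrightarrow> |A| \<le>o |L|"

lemma le_countable: "countable A \<Longrightarrow> le A"
proof -
  assume "countable A"
  then have "|A| \<le>o |UNIV :: nat set|"
    unfolding countable_def card_of_ordLeq[symmetric] by blast
  moreover have "|UNIV :: nat set| \<le>o |L|"
    using infinite_L infinite_iff_card_of_nat by blast
  ultimately show ?thesis unfolding le_def by (rule ordLeq_transitive)
qed

lemma le_UN: "le I \<Longrightarrow> (\<And>i. i \<in> I \<Longrightarrow> le (A i)) \<Longrightarrow> le (\<Union>i\<in>I. A i)"
  unfolding le_def using card_of_UNION_ordLeq_infinite[OF infinite_L] by blast

lemma le_image: "le A \<Longrightarrow> le (f ` A)"
  unfolding le_def using card_of_image ordLeq_transitive by blast

lemma le_subset: "le B \<Longrightarrow> A \<subseteq> B \<Longrightarrow> le A"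
  unfolding le_def using card_of_mono1 ordLeq_transitive by blast

lemma le_Un: "le A \<Longrightarrow> le B \<Longrightarrow> le (A \<union> B)"
  using le_UN[of "{A, B}" "\<lambda>X. X"] by (auto simp: le_countable countable_finite)

lemma le_Times: "le A \<Longrightarrow> le B \<Longrightarrow> le (A \<times> B)"
proof -
  assume "le A" "le B"
  then have "le (\<Union>a\<in>A. Pair a ` B)" by (intro le_UN le_image)
  moreover have "(\<Union>a\<in>A. Pair a ` B) = A \<times> B" by auto
  ultimately show ?thesis by simp
qed

lemma le_lists: "le A \<Longrightarrow> le (lists A)"
proof -
  assume A: "le A"
  have "le {l. set l \<subseteq> A \<and> length l = n}" for n
  proof (induction n)
    case 0
    have "{l. set l \<subseteq> A \<and> length l = 0} = {[]}" by auto
    then show ?case by (simp add: le_countable countable_finite)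
  next
    case (Suc n)
    have "{l. set l \<subseteq> A \<and> length l = Suc n} = (\<lambda>(a, l). a # l) ` (A \<times> {l. set l \<subseteq> A \<and> length l = n})"
      by (auto simp: length_Suc_conv image_iff)
    then show ?case using le_image[OF le_Times[OF A Suc]] by simp
  qed
  then have "le (\<Union>n :: nat. {l. set l \<subseteq> A \<and> length l = n})"
    by (intro le_UN) (simp_all add: le_countable)
  moreover have "(\<Union>n :: nat. {l. set l \<subseteq> A \<and> length l = n}) = lists A" by (auto simp: lists_eq_set)
  ultimately show ?thesis by simp
qed

lemma list_in_chain:
  assumes "mono X" "set l \<subseteq> (\<Union>n :: nat. X n)"
  obtains n where "set l \<subseteq> X n"
proof -
  have "\<exists>n. set l \<subseteq> X n"
    using assms(2)
  proof (induction l)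
    case (Cons a l)
    then obtain n n' where n: "set l \<subseteq> X n" "a \<in> X n'" by auto
    have "X n \<subseteq> X (max n n')" "X n' \<subseteq> X (max n n')" using monoD[OF assms(1)] by simp_all
    then show ?case using n by (intro exI[of _ "max n n'"]) auto
  qed simp
  then show thesis using that by blast
qed

text \<open>Terms are exhausted by an increasing sequence of stages of bounded size; a finite list
  of arguments always lies in one stage.\<close>

lemma le_terms:
  fixes S :: "('f, 'r, 'm) fo_structure"
  assumes "le (fun_syms S)"
  shows "le {t :: ('f, 'm) trm. wf_trm S t \<and> trm_params t = {}}"
proof -
  define X :: "nat \<Rightarrow> ('f, 'm) trm set" where
    "X = rec_nat (range Var) (\<lambda>_ A. A \<union> (\<lambda>(f, ts). Fn f ts) ` (fun_syms S \<times> lists A))"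
  have X: "X 0 = range Var" "X (Suc n) = X n \<union> (\<lambda>(f, ts). Fn f ts) ` (fun_syms S \<times> lists (X n))" for n
    by (simp_all add: X_def)
  have mono: "mono X" by (rule incseq_SucI) (simp add: X)
  have "le (X n)" for n
  proof (induction n)
    case 0
    show ?case unfolding X by (rule le_image) (simp add: le_countable)
  next
    case (Suc n)
    then show ?case unfolding X by (intro le_Un le_image le_Times le_lists assms)
  qed
  then have "le (\<Union>n. X n)" by (intro le_UN) (simp_all add: le_countable)
  moreover have "wf_trm S t \<Longrightarrow> trm_params t = {} \<Longrightarrow> t \<in> (\<Union>n. X n)" for t
  proof (induction t)
    case (Var v)
    have "Var v \<in> X 0" by (simp add: X)
    then show ?case by blast
  next
    case (Fn f ts)
    then have "set ts \<subseteq> (\<Union>n. X n)" by (auto simp: list_all_iff)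
    then obtain n where "set ts \<subseteq> X n" using list_in_chain[OF mono] by blast
    then have "Fn f ts \<in> X (Suc n)" using Fn.prems unfolding X by (auto simp: image_iff lists_eq_set)
    then show ?case by blast
  qed simp
  then have "{t. wf_trm S t \<and> trm_params t = {}} \<subseteq> (\<Union>n. X n)" by auto
  ultimately show ?thesis by (rule le_subset)
qed

lemma le_formulas:
  fixes S :: "('f, 'r, 'm) fo_structure"
  assumes "le (fun_syms S)" "le (rel_syms S)"
  shows "le (formulas S UNIV {} :: ('f, 'r, 'm) fml set)"
proof -
  let ?T = "{t :: ('f, 'm) trm. wf_trm S t \<and> trm_params t = {}}"
  define X :: "nat \<Rightarrow> ('f, 'r, 'm) fml set" where
    "X = rec_nat ({Bot} \<union> (\<lambda>(s, t). Eq s t) ` (?T \<times> ?T) \<union> (\<lambda>(r, ts). Rel r ts) ` (rel_syms S \<times> lists ?T))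
      (\<lambda>_ A. A \<union> Neg ` A \<union> (\<lambda>(\<psi>, \<theta>). Conj \<psi> \<theta>) ` (A \<times> A) \<union> (\<lambda>(v, \<psi>). Ex v \<psi>) ` (UNIV \<times> A))"
  have X: "X 0 = {Bot} \<union> (\<lambda>(s, t). Eq s t) ` (?T \<times> ?T) \<union> (\<lambda>(r, ts). Rel r ts) ` (rel_syms S \<times> lists ?T)"
    "X (Suc n) = X n \<union> Neg ` X n \<union> (\<lambda>(\<psi>, \<theta>). Conj \<psi> \<theta>) ` (X n \<times> X n) \<union> (\<lambda>(v, \<psi>). Ex v \<psi>) ` (UNIV \<times> X n)" for n
    by (simp_all add: X_def)
  have mono: "mono X" by (rule incseq_SucI) (auto simp: X(2))
  have Bot: "le {Bot :: ('f, 'r, 'm) fml}" by (simp add: le_countable)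
  have nat: "le (UNIV :: nat set)" by (simp add: le_countable)
  have "le (X n)" for n
  proof (induction n)
    case 0
    show ?case unfolding X by (intro le_Un le_image le_Times le_lists le_terms Bot assms)
  next
    case (Suc n)
    then show ?case unfolding X by (intro le_Un le_image le_Times nat)
  qed
  then have "le (\<Union>n. X n)" by (intro le_UN nat)
  moreover have "wf_fml S \<psi> \<Longrightarrow> params \<psi> = {} \<Longrightarrow> \<psi> \<in> (\<Union>n. X n)" for \<psi>
  proof (induction \<psi>)
    case Bot
    have "Bot \<in> X 0" by (simp add: X)
    then show ?case by blast
  next
    case (Eq s t)
    then have "Eq s t \<in> X 0" by (auto simp: X(1))
    then show ?case by blast
  next
    case (Rel r ts)
    then have "Rel r ts \<in> X 0" by (auto simp: X(1) list_all_iff lists_eq_set image_iff)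
    then show ?case by blast
  next
    case (Neg \<psi>)
    then obtain n where "\<psi> \<in> X n" by auto
    then have "Neg \<psi> \<in> X (Suc n)" by (simp add: X(2))
    then show ?case by blast
  next
    case (Conj \<psi> \<theta>)
    then have "set [\<psi>, \<theta>] \<subseteq> (\<Union>n. X n)" by simp
    then obtain n where "set [\<psi>, \<theta>] \<subseteq> X n" using list_in_chain[OF mono] by blast
    then have "Conj \<psi> \<theta> \<in> X (Suc n)" by (simp add: X(2) image_iff)
    then show ?case by blast
  next
    case (Ex v \<psi>)
    then obtain n where "\<psi> \<in> X n" by auto
    then have "Ex v \<psi> \<in> X (Suc n)" by (simp add: X(2) image_iff)
    then show ?case by blast
  qed
  then have "formulas S UNIV {} \<subseteq> (\<Union>n. X n)" by (auto simp: formulas_def)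
  ultimately show ?thesis by (rule le_subset)
qed

text \<open>Downward Loewenheim-Skolem. The hull of \<open>m0\<close> is closed under witnesses
  chosen in \<open>M\<close>, so that it is elementary in \<open>M\<close> and, through
  \<open>M\<close>, in the monster.\<close>

lemma le_elementary_substructure:
  fixes S :: "('f, 'r, 'm) fo_structure"
  assumes syms: "le (fun_syms S)" "le (rel_syms S)" and M: "elementary_substructure S M"
  obtains M0 where "M0 \<subseteq> M" "elementary_substructure S M0" "le M0"
proof -
  obtain m0 where m0: "m0 \<in> M" using M by (auto simp: elementary_substructure_def)
  \<comment> \<open>Environments are coded by finite lists, to keep the number of witnesses within
    the bound; \<open>m0\<close> fills up the rest.\<close>
  define ext :: "'m list \<Rightarrow> nat \<Rightarrow> 'm" where "ext l i = (if i < length l then l ! i else m0)" for l i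
  define wit where "wit \<psi> v l =
      (if \<exists>d\<in>M. sat_in S M ((ext l)(v := d)) \<psi> then SOME d. d \<in> M \<and> sat_in S M ((ext l)(v := d)) \<psi> else m0)"
    for \<psi> :: "('f, 'r, 'm) fml" and v l
  have wit: "wit \<psi> v l \<in> M" "\<exists>d\<in>M. sat_in S M ((ext l)(v := d)) \<psi> \<Longrightarrow> sat_in S M ((ext l)(v := wit \<psi> v l)) \<psi>"
    for \<psi> v l
  proof -
    have "wit \<psi> v l \<in> M \<and> ((\<exists>d\<in>M. sat_in S M ((ext l)(v := d)) \<psi>) \<longrightarrow> sat_in S M ((ext l)(v := wit \<psi> v l)) \<psi>)"
    proof (cases "\<exists>d\<in>M. sat_in S M ((ext l)(v := d)) \<psi>")
      case True
      then have "\<exists>d. d \<in> M \<and> sat_in S M ((ext l)(v := d)) \<psi>" by blast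
      from someI_ex[OF this] True show ?thesis by (simp add: wit_def)
    next
      case False
      then show ?thesis using m0 by (simp add: wit_def)
    qed
    then show "wit \<psi> v l \<in> M" "\<exists>d\<in>M. sat_in S M ((ext l)(v := d)) \<psi> \<Longrightarrow> sat_in S M ((ext l)(v := wit \<psi> v l)) \<psi>"
      by blast+
  qed
  let ?F = "formulas S UNIV {} :: ('f, 'r, 'm) fml set"
  define step :: "'m set \<Rightarrow> 'm set" where
    "step A = A \<union> (\<lambda>(\<psi>, v, l). wit \<psi> v l) ` (?F \<times> UNIV \<times> lists A) \<union>
      (\<lambda>(f, l). fun_int S f l) ` {(f, l). f \<in> fun_syms S \<and> l \<in> lists A \<and> length l = fun_arity S f}" for A
  define X where "X = rec_nat {m0} (\<lambda>_. step)"
  have X: "X 0 = {m0}" "X (Suc n) = step (X n)" for n by (simp_all add: X_def)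
  have mono: "mono X" by (rule incseq_SucI) (auto simp: X(2) step_def)
  have XM: "X n \<subseteq> M" for n
  proof (induction n)
    case 0
    then show ?case using m0 by (simp add: X)
  next
    case (Suc n)
    have "fun_int S f l \<in> M" if "f \<in> fun_syms S" "l \<in> lists (X n)" "length l = fun_arity S f" for f l
      using M that Suc unfolding elementary_substructure_def lists_eq_set by blast
    then show ?case using Suc wit(1) by (auto simp: X(2) step_def)
  qed
  have "le (X n)" for n
  proof (induction n)
    case 0
    then show ?case by (simp add: X le_countable)
  next
    case (Suc n)
    have 1: "le (UNIV :: nat set)" by (simp add: le_countable)
    have 2: "le {(f, l). f \<in> fun_syms S \<and> l \<in> lists (X n) \<and> length l = fun_arity S f}"
      by (rule le_subset[OF le_Times[OF syms(1) le_lists[OF Suc]]]) auto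
    show ?case
      unfolding X(2) step_def by (intro le_Un le_image le_Times le_lists le_formulas syms Suc 1 2)
  qed
  then have le: "le (\<Union>n. X n)" by (intro le_UN) (simp_all add: le_countable)
  let ?M0 = "\<Union>n. X n"
  have sub: "?M0 \<subseteq> M" using XM by blast
  have sat: "sat_in S ?M0 e \<psi> \<longleftrightarrow> sat_in S M e \<psi>" if "\<psi> \<in> ?F" "range e \<subseteq> ?M0" for e \<psi>
    using that
  proof (induction \<psi> arbitrary: e)
    case (Neg \<psi>)
    then show ?case by (simp add: formulas_def)
  next
    case (Conj \<psi> \<theta>)
    then show ?case by (simp add: formulas_def)
  next
    case (Ex v \<psi>)
    have \<psi>: "\<psi> \<in> ?F" using Ex.prems(1) by (simp add: formulas_def)
    have IH: "sat_in S ?M0 (e(v := d)) \<psi> \<longleftrightarrow> sat_in S M (e(v := d)) \<psi>" if "d \<in> ?M0" for d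
      by (rule Ex.IH[OF \<psi>]) (use Ex.prems(2) that in auto)
    have h2: "\<exists>d\<in>?M0. sat_in S M (e(v := d)) \<psi>" if ex: "\<exists>d\<in>M. sat_in S M (e(v := d)) \<psi>"
    proof -
      \<comment> \<open>Only the values of \<open>e\<close> at the free variables matter, so a
        finite part of \<open>e\<close> suffices and lies in one stage.\<close>
      obtain N where N: "\<And>u. u \<in> fv \<psi> \<Longrightarrow> u < N"
        using finite_fv[of \<psi>] by (meson finite_nat_set_iff_bounded)
      let ?l = "map e [0..<N]"
      have ag: "sat_in S M ((ext ?l)(v := d)) \<psi> \<longleftrightarrow> sat_in S M (e(v := d)) \<psi>" for d
        by (rule sat_in_cong) (use N in \<open>auto simp: ext_def\<close>)
      have "set ?l \<subseteq> ?M0" using Ex.prems(2) by auto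
      then obtain n where "set ?l \<subseteq> X n" using list_in_chain[OF mono] by blast
      then have "wit \<psi> v ?l \<in> X (Suc n)"
        unfolding X(2) step_def using \<psi> by (intro UnI1 UnI2) (force simp: lists_eq_set)
      moreover have "sat_in S M (e(v := wit \<psi> v ?l)) \<psi>"
        using wit(2)[of ?l v \<psi>] ex ag by blast
      ultimately show ?thesis by blast
    qed
    have h1: "(\<exists>d\<in>?M0. sat_in S ?M0 (e(v := d)) \<psi>) \<longleftrightarrow> (\<exists>d\<in>?M0. sat_in S M (e(v := d)) \<psi>)"
      using IH by (rule bex_cong[OF refl])
    have h3: "\<exists>d\<in>M. sat_in S M (e(v := d)) \<psi>" if M0: "\<exists>d\<in>?M0. sat_in S M (e(v := d)) \<psi>"
    proof -
      obtain d where "d \<in> ?M0" "sat_in S M (e(v := d)) \<psi>" by (rule bexE[OF M0])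
      then show ?thesis using subsetD[OF sub] by blast
    qed
    show ?case unfolding sat_in.simps h1 by (rule iffI[OF h3 h2])
  qed simp_all
  have fun_closed: "fun_int S f l \<in> ?M0" if f: "f \<in> fun_syms S" "length l = fun_arity S f" "set l \<subseteq> ?M0" for f l
  proof -
    obtain n where "set l \<subseteq> X n" using list_in_chain[OF mono f(3)] by blast
    then have "fun_int S f l \<in> X (Suc n)"
      unfolding X(2) step_def using f by (intro UnI2) (force simp: lists_eq_set)
    then show ?thesis by blast
  qed
  have "elementary_substructure S ?M0"
    unfolding elementary_substructure_def
  proof (intro conjI ballI allI impI)
    show "?M0 \<noteq> {}" using X(1) by blast
    show "fun_int S f l \<in> ?M0" if "f \<in> fun_syms S" "length l = fun_arity S f \<and> set l \<subseteq> ?M0" for f l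
      using fun_closed that by blast
    fix \<psi> and e :: "nat \<Rightarrow> 'm" assume *: "\<psi> \<in> ?F" "range e \<subseteq> ?M0"
    have "range e \<subseteq> M" using *(2) sub by (rule subset_trans)
    then have "sat_in S M e \<psi> \<longleftrightarrow> sat_in S UNIV e \<psi>"
      using M *(1) unfolding elementary_substructure_def by blast
    then show "sat_in S ?M0 e \<psi> \<longleftrightarrow> sat_in S UNIV e \<psi>" using sat[OF *] by simp
  qed
  then show thesis using that sub le by blast
qed

end

context monster
begin

lemma small_elementary_substructure:
  assumes "elementary_substructure S M" "|fun_syms S| <o \<kappa>" "|rel_syms S| <o \<kappa>"
  obtains M0 where "M0 \<subseteq> M" "elementary_substructure S M0" "sm M0"
proof -
  \<comment> \<open>The natural numbers make the sum infinite, and each summand is smaller than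
    \<open>\<kappa>\<close>.\<close>
  define L where "L = (UNIV :: nat set) <+> (fun_syms S <+> rel_syms S)"
  have "|UNIV :: nat set| <o \<kappa>" using card_of_nat natLeq_\<kappa> ordIso_ordLess_trans by blast
  then have L: "|L| <o \<kappa>"
    unfolding L_def using assms(2,3) by (intro card_of_Plus_ordLess_infinite_Field infinite_Field Card_\<kappa>)
  interpret infinite_bound L
    by standard (simp add: L_def finite_Plus_iff)
  have "|fun_syms S| \<le>o |L|" "|rel_syms S| \<le>o |L|"
    unfolding L_def by (rule ordLeq_transitive[OF card_of_Plus1 card_of_Plus2],
      rule ordLeq_transitive[OF card_of_Plus2 card_of_Plus2])
  then have syms: "le (fun_syms S)" "le (rel_syms S)" by (simp_all add: le_def)
  obtain M0 where M0: "M0 \<subseteq> M" "elementary_substructure S M0" "le M0"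
    by (rule le_elementary_substructure[OF syms assms(1)])
  have "sm M0" using ordLeq_ordLess_trans[OF M0(3)[unfolded le_def] L] by (simp add: sm_def)
  then show thesis by (rule that[OF M0(1,2)])
qed

end

section \<open>Independent ladders\<close>

lemma entries_append: "entries (s @ t) = entries s \<union> entries t"
  by (simp add: entries_def)

lemma independent_snoc:
  "independent S x y Ix Iy M (s @ [t]) \<longleftrightarrow> independent S x y Ix Iy M s \<and>
    (case t of Inl a \<Rightarrow> wide_tuple S x Ix (M \<union> entries s) a | Inr b \<Rightarrow> wide_tuple S y Iy (M \<union> entries s) b)"
proof -
  let ?W = "\<lambda>A t. case t of Inl a \<Rightarrow> wide_tuple S x Ix A a | Inr b \<Rightarrow> wide_tuple S y Iy A b"
  have "independent S x y Ix Iy M (s @ [t]) \<longleftrightarrow>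
      (\<forall>i<Suc (length s). ?W (M \<union> entries (take i (s @ [t]))) ((s @ [t]) ! i))"
    by (simp add: independent_def)
  also have "\<dots> \<longleftrightarrow> ?W (M \<union> entries (take (length s) (s @ [t]))) ((s @ [t]) ! length s) \<and>
      (\<forall>i<length s. ?W (M \<union> entries (take i (s @ [t]))) ((s @ [t]) ! i))"
    by (rule All_less_Suc)
  also have "(\<forall>i<length s. ?W (M \<union> entries (take i (s @ [t]))) ((s @ [t]) ! i)) \<longleftrightarrow>
      independent S x y Ix Iy M s"
    unfolding independent_def by (intro all_cong) (simp add: nth_append split: sum.split)
  finally have *: "independent S x y Ix Iy M (s @ [t]) \<longleftrightarrow>
      ?W (M \<union> entries (take (length s) (s @ [t]))) ((s @ [t]) ! length s) \<and> independent S x y Ix Iy M s" .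
  have "take (length s) (s @ [t]) = s" "(s @ [t]) ! length s = t" by simp_all
  with * show ?thesis by (simp only: conj_commute)
qed

lemma independent_pairs:
  fixes p q :: "nat \<Rightarrow> 'm list + 'm list"
  defines "s \<equiv> \<lambda>k. concat (map (\<lambda>i. [p i, q i]) [0..<k])"
  assumes "\<And>i. i < k \<Longrightarrow> independent S x y Ix Iy M (s i) \<Longrightarrow> independent S x y Ix Iy M ((s i @ [p i]) @ [q i])"
  shows "independent S x y Ix Iy M (s k)"
  using assms(2)
proof (induction k)
  case 0
  then show ?case by (simp add: s_def independent_def)
next
  case (Suc k)
  have "s (Suc k) = (s k @ [p k]) @ [q k]" by (simp add: s_def)
  moreover have "independent S x y Ix Iy M (s k)" using Suc by simp
  ultimately show ?case using Suc.prems[of k] by simp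
qed

text \<open>Ladders are indexed from 1 and constructions from 0, hence the shift.\<close>

lemma independent_ladder_seq:
  assumes "\<And>i. i < k \<Longrightarrow> wide_tuple S x Ix (M \<union> prv f i) (fst (f i)) \<and>
    wide_tuple S y Iy (M \<union> prv f i \<union> set (fst (f i))) (snd (f i))"
  shows "independent S x y Ix Iy M (ladder_seq k (\<lambda>i. fst (f (i - 1))) (\<lambda>i. snd (f (i - 1))))"
proof -
  let ?s = "\<lambda>k. concat (map (\<lambda>i. [Inl (fst (f i)), Inr (snd (f i))]) [0..<k])"
  have ent: "entries (?s i) = prv f i" for i
    by (induction i) (auto simp: entries_def prv_def less_Suc_eq)
  have "independent S x y Ix Iy M (?s k)"
  proof (rule independent_pairs)
    fix i assume i: "i < k" "independent S x y Ix Iy M (?s i)"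
    have e: "entries (?s i @ [Inl (fst (f i))]) = prv f i \<union> set (fst (f i))"
      unfolding entries_append ent by (simp add: entries_def)
    show "independent S x y Ix Iy M ((?s i @ [Inl (fst (f i))]) @ [Inr (snd (f i))])"
      unfolding independent_snoc e ent using i(2) assms[OF i(1)] by (simp add: Un_assoc)
  qed
  moreover have "ladder_seq k (\<lambda>i. fst (f (i - 1))) (\<lambda>i. snd (f (i - 1))) = ?s k"
  proof -
    have "[1..<Suc k] = map Suc [0..<k]" by (simp add: map_Suc_upt del: upt_Suc)
    then show ?thesis by (simp add: ladder_seq_def comp_def del: upt_Suc)
  qed
  ultimately show ?thesis by simp
qed

text \<open>The reversed sequence opens with the entries of index \<open>k\<close>, so step
  \<open>i\<close> of the construction supplies index \<open>k - i\<close>, and the tuple in the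
  sort of \<open>y\<close> comes first.\<close>

lemma independent_rev_ladder_seq:
  assumes "\<And>i. i < k \<Longrightarrow> wide_tuple S y Iy (M \<union> prv f i) (fst (f i)) \<and>
    wide_tuple S x Ix (M \<union> prv f i \<union> set (fst (f i))) (snd (f i))"
  shows "independent S x y Ix Iy M (rev (ladder_seq k (\<lambda>i. snd (f (k - i))) (\<lambda>i. fst (f (k - i)))))"
proof -
  let ?s = "\<lambda>k. concat (map (\<lambda>i. [Inr (fst (f i)), Inl (snd (f i))]) [0..<k])"
  have ent: "entries (?s i) = prv f i" for i
    by (induction i) (auto simp: entries_def prv_def less_Suc_eq)
  have "independent S x y Ix Iy M (?s k)"
  proof (rule independent_pairs)
    fix i assume i: "i < k" "independent S x y Ix Iy M (?s i)"
    have e: "entries (?s i @ [Inr (fst (f i))]) = prv f i \<union> set (fst (f i))"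
      unfolding entries_append ent by (simp add: entries_def)
    show "independent S x y Ix Iy M ((?s i @ [Inr (fst (f i))]) @ [Inl (snd (f i))])"
      unfolding independent_snoc e ent using i(2) assms[OF i(1)] by (simp add: Un_assoc)
  qed
  moreover have "rev (ladder_seq k (\<lambda>i. snd (f (k - i))) (\<lambda>i. fst (f (k - i)))) = ?s k"
  proof -
    have r: "rev [1..<Suc k] = map (\<lambda>i. k - i) [0..<k]"
      by (rule nth_equalityI) (auto simp: rev_nth simp del: upt_Suc)
    have "rev (ladder_seq k (\<lambda>i. snd (f (k - i))) (\<lambda>i. fst (f (k - i)))) =
        concat (map (\<lambda>i. [Inr (fst (f (k - i))), Inl (snd (f (k - i)))]) (rev [1..<Suc k]))"
      unfolding ladder_seq_def rev_concat rev_map[symmetric] map_map by (simp add: comp_def del: upt_Suc)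
    also have "\<dots> = ?s k"
      unfolding r map_map comp_def by (rule arg_cong[where f = concat]) (rule map_cong, auto)
    finally show ?thesis .
  qed
  ultimately show ?thesis by simp
qed

lemma stable_of_ladderD:
  assumes "stable_of_ladder S x y Ix Iy \<phi> k" "elementary_substructure S M"
    and "\<forall>i\<in>{1..k}. length (a i) = length x \<and> length (b i) = length y"
    and "independent S x y Ix Iy M (ladder_seq k a b) \<or> independent S x y Ix Iy M (rev (ladder_seq k a b))"
    and "\<forall>i\<in>{1..k}. \<forall>j\<in>{1..k}. holds S (x @ y) (a i @ b j) \<phi> \<longleftrightarrow> i \<le> j"
  shows False
  using assms unfolding stable_of_ladder_def by blast

section \<open>Stationarity of stable formulas\<close>

text \<open>The model fixed here is the small one; the space of types may later be formed over a
  larger model.\<close>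

locale stable_formula = monster S \<kappa>
  for S :: "('f, 'r, 'm) fo_structure" and \<kappa> :: "'k rel" +
  fixes x y :: "nat list" and Ix Iy :: "('f, 'r, 'm) fml set" and \<phi> :: "('f, 'r, 'm) fml"
    and k :: nat and M :: "'m set"
  assumes vars: "distinct x" "distinct y" "set x \<inter> set y = {}"
    and Ix: "S1_ideal S x {} Ix" and Iy: "S1_ideal S y {} Iy"
    and \<phi>: "\<phi> \<in> formulas S (set x \<union> set y) {}"
    and stable: "stable_of_ladder S x y Ix Iy \<phi> k"
    and M: "elementary_substructure S M" "sm M"
begin

abbreviation "\<sigma>x \<equiv> small_of S x Ix"
abbreviation "\<sigma>y \<equiv> small_of S y Iy"
abbreviation "nx \<equiv> length x"
abbreviation "ny \<equiv> length y"
abbreviation "widex \<equiv> wide S nx \<sigma>x"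
abbreviation "widey \<equiv> wide S ny \<sigma>y"
abbreviation "\<Phi> a b \<equiv> holds S (x @ y) (a @ b) \<phi>"

lemmas \<sigma>x = S1_ideal_small[OF Ix vars(1)]
lemmas \<sigma>y = S1_ideal_small[OF Iy vars(2)]

lemma \<Phi>_dfn: "dfn S (nx + ny) (\<lambda>l. holds S (x @ y) l \<phi>)"
proof -
  have "distinct (x @ y)" "\<phi> \<in> formulas S (set (x @ y)) {}" using vars \<phi> by auto
  then obtain c P where c: "set c \<subseteq> {}" and P: "dfn S (length (x @ y) + length c) P"
    and h: "\<And>a. length a = length (x @ y) \<Longrightarrow> holds S (x @ y) a \<phi> \<longleftrightarrow> P (a @ c)"
    using formula_dfn by metis
  have "c = []" using c by simp
  then show ?thesis using P h dfn_cong[of "nx + ny" "\<lambda>l. holds S (x @ y) l \<phi>" P S] by simp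
qed

lemma \<Phi>_cong: "eqv S M (a @ b) (a' @ b') \<Longrightarrow> length a = nx \<Longrightarrow> length b = ny \<Longrightarrow> \<Phi> a b \<longleftrightarrow> \<Phi> a' b'"
  using eqvD0[of S M "a @ b" "a' @ b'" "\<lambda>l. holds S (x @ y) l \<phi>"] \<Phi>_dfn by simp

lemma no_ladder:
  assumes "\<And>i. i < k \<Longrightarrow> widex (M \<union> prv f i) (fst (f i)) \<and> widey (M \<union> prv f i \<union> set (fst (f i))) (snd (f i))"
    and ord: "\<And>i j. i < k \<Longrightarrow> j < k \<Longrightarrow> \<Phi> (fst (f i)) (snd (f j)) \<longleftrightarrow> i \<le> j"
  shows False
proof -
  let ?a = "\<lambda>i. fst (f (i - 1))" and ?b = "\<lambda>i. snd (f (i - 1))"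
  have "independent S x y Ix Iy M (ladder_seq k ?a ?b)"
    by (rule independent_ladder_seq) (simp add: wide_tuple_iff vars assms(1))
  moreover have "length (?a i) = nx \<and> length (?b i) = ny" if "i \<in> {1..k}" for i
    using assms(1)[of "i - 1"] that wide_length by fastforce
  moreover have "\<Phi> (?a i) (?b j) \<longleftrightarrow> i \<le> j" if "i \<in> {1..k}" "j \<in> {1..k}" for i j
  proof -
    have "i - 1 < k" "j - 1 < k" "i - 1 \<le> j - 1 \<longleftrightarrow> i \<le> j" using that by auto
    then show ?thesis using ord by simp
  qed
  ultimately show False by (intro stable_of_ladderD[OF stable M(1), of ?a ?b]) auto
qed

lemma no_rev_ladder:
  assumes "\<And>i. i < k \<Longrightarrow> widey (M \<union> prv f i) (fst (f i)) \<and> widex (M \<union> prv f i \<union> set (fst (f i))) (snd (f i))"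
    and ord: "\<And>i j. i < k \<Longrightarrow> j < k \<Longrightarrow> \<Phi> (snd (f i)) (fst (f j)) \<longleftrightarrow> j \<le> i"
  shows False
proof -
  let ?a = "\<lambda>i. snd (f (k - i))" and ?b = "\<lambda>i. fst (f (k - i))"
  have "independent S x y Ix Iy M (rev (ladder_seq k ?a ?b))"
    by (rule independent_rev_ladder_seq) (simp add: wide_tuple_iff vars assms(1))
  moreover have "length (?a i) = nx \<and> length (?b i) = ny" if "i \<in> {1..k}" for i
    using assms(1)[of "k - i"] that wide_length by fastforce
  moreover have "\<Phi> (?a i) (?b j) \<longleftrightarrow> i \<le> j" if "i \<in> {1..k}" "j \<in> {1..k}" for i j
  proof -
    have "k - i < k" "k - j < k" "k - j \<le> k - i \<longleftrightarrow> i \<le> j" using that by auto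
    then show ?thesis using ord by simp
  qed
  ultimately show False by (intro stable_of_ladderD[OF stable M(1), of ?a ?b]) auto
qed

text \<open>A sequence that alternates between copies of the two pairs turns a disagreement into a
  ladder, because the order of appearance of two entries then decides \<open>\<Phi>\<close>.\<close>

lemma stationary_flip:
  assumes a: "widex (M \<union> set b) a" "length b = ny" and b': "widey (M \<union> set a') b'" "length a' = nx"
    and eq: "eqv S M a a'" "eqv S M b b'"
  shows "\<Phi> a b \<longleftrightarrow> \<Phi> a' b'"
proof (rule ccontr)
  assume "\<not> ?thesis"
  then consider "\<Phi> a b" "\<not> \<Phi> a' b'" | "\<not> \<Phi> a b" "\<Phi> a' b'" by blast
  then show False
  proof cases
    case 1
    \<comment> \<open>\<open>\<Phi>\<close> is to hold when the entry in the sort of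
      \<open>y\<close> appears first. Hence the sequence begins in this sort and yields the reversed
      ladder.\<close>
    obtain f where F: "(\<forall>i. widey (M \<union> prv f i) (fst (f i)) \<and>
        widex (M \<union> prv f i \<union> set (fst (f i))) (snd (f i))) \<and>
      (\<forall>i j. j < i \<longrightarrow> eqv S M (fst (f i) @ snd (f j)) (b' @ a')) \<and>
      (\<forall>i j. j \<le> i \<longrightarrow> eqv S M (snd (f i) @ fst (f j)) (a @ b))"
      by (rule exE[OF alternating_sequence[OF \<sigma>y \<sigma>x M b' a(1) eqv_sym[OF eq(2)] eqv_sym[OF eq(1)]]])
    have f: "widey (M \<union> prv f i) (fst (f i))" "widex (M \<union> prv f i \<union> set (fst (f i))) (snd (f i))"
      "j < i \<Longrightarrow> eqv S M (fst (f i) @ snd (f j)) (b' @ a')"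
      "j \<le> i \<Longrightarrow> eqv S M (snd (f i) @ fst (f j)) (a @ b)" for i j
      using F by simp_all
    have l: "length (snd (f i)) = nx" "length (fst (f i)) = ny" for i
      using wide_length[OF f(2)] wide_length[OF f(1)] by auto
    have ord: "\<Phi> (snd (f i)) (fst (f j)) \<longleftrightarrow> j \<le> i" for i j
    proof (cases "j \<le> i")
      case True
      then show ?thesis using \<Phi>_cong[OF f(4)[OF True] l] 1(1) by blast
    next
      case False
      then have e: "eqv S M (fst (f j) @ snd (f i)) (b' @ a')" using f(3)[of i j] by simp
      have lb: "length b' = ny" using wide_length[OF b'(1)] .
      have "seln (length (fst (f j) @ snd (f i))) (nx + ny) (\<lambda>l :: 'm list. drop ny l @ take ny l)"
        using seln_append[OF seln_drop[OF seln_id] seln_take[OF seln_id], of ny "ny + nx" ny]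
        by (simp add: l add.commute)
      from eqv_sel[OF e this] have "eqv S M (snd (f i) @ fst (f j)) (a' @ b')" by (simp add: l lb)
      from \<Phi>_cong[OF this l] show ?thesis using False 1(2) by blast
    qed
    show False by (rule no_rev_ladder[of f]) (simp_all add: f(1,2) ord)
  next
    case 2
    \<comment> \<open>\<open>\<Phi>\<close> is to hold when the entry in the sort of
      \<open>x\<close> appears first, which gives the ladder in its direct order.\<close>
    obtain f where F: "(\<forall>i. widex (M \<union> prv f i) (fst (f i)) \<and>
        widey (M \<union> prv f i \<union> set (fst (f i))) (snd (f i))) \<and>
      (\<forall>i j. j < i \<longrightarrow> eqv S M (fst (f i) @ snd (f j)) (a @ b)) \<and>
      (\<forall>i j. j \<le> i \<longrightarrow> eqv S M (snd (f i) @ fst (f j)) (b' @ a'))"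
      by (rule exE[OF alternating_sequence[OF \<sigma>x \<sigma>y M a b'(1) eq]])
    have f: "widex (M \<union> prv f i) (fst (f i))" "widey (M \<union> prv f i \<union> set (fst (f i))) (snd (f i))"
      "j < i \<Longrightarrow> eqv S M (fst (f i) @ snd (f j)) (a @ b)"
      "j \<le> i \<Longrightarrow> eqv S M (snd (f i) @ fst (f j)) (b' @ a')" for i j
      using F by simp_all
    have l: "length (snd (f i)) = ny" "length (fst (f i)) = nx" for i
      using wide_length[OF f(2)] wide_length[OF f(1)] by auto
    have ord: "\<Phi> (fst (f i)) (snd (f j)) \<longleftrightarrow> i \<le> j" for i j
    proof (cases "i \<le> j")
      case True
      have e: "eqv S M (snd (f j) @ fst (f i)) (b' @ a')" using f(4)[OF True] .
      have lb: "length b' = ny" using wide_length[OF b'(1)] .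
      have "seln (length (snd (f j) @ fst (f i))) (nx + ny) (\<lambda>l :: 'm list. drop ny l @ take ny l)"
        using seln_append[OF seln_drop[OF seln_id] seln_take[OF seln_id], of ny "ny + nx" ny]
        by (simp add: l add.commute)
      from eqv_sel[OF e this] have "eqv S M (fst (f i) @ snd (f j)) (a' @ b')" by (simp add: l lb)
      from \<Phi>_cong[OF this l(2,1)] show ?thesis using True 2(2) by blast
    next
      case False
      then have "eqv S M (fst (f i) @ snd (f j)) (a @ b)" using f(3)[of j i] by simp
      from \<Phi>_cong[OF this l(2,1)] show ?thesis using False 2(1) by blast
    qed
    show False by (rule no_ladder[of f]) (simp_all add: f(1,2) ord)
  qed
qed

definition indep :: "'m list \<Rightarrow> 'm list \<Rightarrow> bool" where
  "indep a b \<longleftrightarrow> widex M a \<and> widey M b \<and> (widex (M \<union> set b) a \<or> widey (M \<union> set a) b)"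

text \<open>\<open>stationary_flip\<close> compares pairs whose wide members lie in different sorts.
  If they lie in the same sort, a third pair with the same types and the other member wide
  mediates.\<close>

lemma stationary:
  assumes i: "indep a b" "indep a' b'" and eq: "eqv S M a a'" "eqv S M b b'"
  shows "\<Phi> a b \<longleftrightarrow> \<Phi> a' b'"
proof -
  have w: "widex M a" "widey M b" "widex M a'" "widey M b'" using i by (auto simp: indep_def)
  note l = w[THEN wide_length]
  consider "widex (M \<union> set b) a" "widey (M \<union> set a') b'" | "widey (M \<union> set a) b" "widex (M \<union> set b') a'"
    | "widex (M \<union> set b) a" "widex (M \<union> set b') a'" | "widey (M \<union> set a) b" "widey (M \<union> set a') b'"
    using i by (auto simp: indep_def)
  then show ?thesis
  proof cases
    case 1
    then show ?thesis using stationary_flip l eq by blast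
  next
    case 2
    then show ?thesis using stationary_flip[OF 2(2) l(4) 2(1) l(1)] eq eqv_sym by blast
  next
    case 3
    have "sm (M \<union> set a)" by (rule sm_Un[OF M(2) sm_finite]) simp
    then obtain b2 where b2: "widey (M \<union> set a) b2" "eqv S M b2 b"
      using wide_extension[OF \<sigma>y w(2), of "M \<union> set a"] by blast
    have "\<Phi> a b \<longleftrightarrow> \<Phi> a b2"
      by (rule stationary_flip[OF 3(1) l(2) b2(1) l(1) eqv_refl eqv_sym[OF b2(2)]])
    moreover have "\<Phi> a' b' \<longleftrightarrow> \<Phi> a b2"
      by (rule stationary_flip[OF 3(2) l(4) b2(1) l(1) eqv_sym[OF eq(1)]])
        (rule eqv_trans[OF eqv_sym[OF eq(2)] eqv_sym[OF b2(2)]])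
    ultimately show ?thesis by simp
  next
    case 4
    have "sm (M \<union> set b)" by (rule sm_Un[OF M(2) sm_finite]) simp
    then obtain a2 where a2: "widex (M \<union> set b) a2" "eqv S M a2 a"
      using wide_extension[OF \<sigma>x w(1), of "M \<union> set b"] by blast
    have "\<Phi> a2 b \<longleftrightarrow> \<Phi> a b"
      by (rule stationary_flip[OF a2(1) l(2) 4(1) l(1) a2(2) eqv_refl])
    moreover have "\<Phi> a2 b \<longleftrightarrow> \<Phi> a' b'"
      by (rule stationary_flip[OF a2(1) l(2) 4(2) l(3) eqv_trans[OF a2(2) eq(1)] eq(2)])
    ultimately show ?thesis by simp
  qed
qed

text \<open>\<open>rho a b\<close> is the truth value of \<open>\<phi>\<close> on independent realizations of \<open>tp(a/M)\<close> and \<open>tp(b/M)\<close>.\<close>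

definition rho :: "'m list \<Rightarrow> 'm list \<Rightarrow> bool" where
  "rho a b \<longleftrightarrow> (\<exists>a'. eqv S M a' a \<and> widex (M \<union> set b) a' \<and> \<Phi> a' b)"

text \<open>Stationarity makes the choice of independent realizations immaterial, and
  \<open>wide_extension\<close> supplies one.\<close>

lemma rho_iff:
  assumes "widex M a" "widey M b" "indep a' b'" "eqv S M a' a" "eqv S M b' b"
  shows "rho a b \<longleftrightarrow> \<Phi> a' b'"
proof -
  have ind: "indep a2 b" if "widex (M \<union> set b) a2" for a2
    using that assms(2) wide_mono[OF that, of M] by (simp add: indep_def)
  have eq: "\<Phi> a2 b \<longleftrightarrow> \<Phi> a' b'" if "eqv S M a2 a" "widex (M \<union> set b) a2" for a2
    by (rule stationary[OF ind[OF that(2)] assms(3) eqv_trans[OF that(1) eqv_sym[OF assms(4)]] eqv_sym[OF assms(5)]])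
  have "sm (M \<union> set b)" by (rule sm_Un[OF M(2) sm_finite]) simp
  then obtain a2 where "widex (M \<union> set b) a2" "eqv S M a2 a"
    using wide_extension[OF \<sigma>x assms(1), of "M \<union> set b"] by blast
  then show ?thesis unfolding rho_def using eq by blast
qed

text \<open>Only the types of single tuples are prescribed, so repeated extension suffices; the
  values of \<open>\<Phi>\<close> on pairs will then follow from stationarity.\<close>

lemma independent_realization:
  assumes as: "\<And>i. i < k \<Longrightarrow> widex M (as i)" and bs: "\<And>i. i < k \<Longrightarrow> widey M (bs i)"
  shows "\<exists>f. \<forall>i<k. widex (M \<union> prv f i) (fst (f i)) \<and> eqv S M (fst (f i)) (as i) \<and>
      widey (M \<union> prv f i \<union> set (fst (f i))) (snd (f i)) \<and> eqv S M (snd (f i)) (bs i)"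
proof -
  define Q where "Q f i ab \<longleftrightarrow> (i < k \<longrightarrow> widex (M \<union> prv f i) (fst ab) \<and> eqv S M (fst ab) (as i) \<and>
      widey (M \<union> prv f i \<union> set (fst ab)) (snd ab) \<and> eqv S M (snd ab) (bs i))"
    for f :: "nat \<Rightarrow> 'm list \<times> 'm list" and i :: nat and ab
  have "\<exists>f. \<forall>i. Q f i (f i)"
  proof (rule dependent_wellorder_choice)
    fix ab and f g :: "nat \<Rightarrow> 'm list \<times> 'm list" and i :: nat
    assume "\<And>t. t < i \<Longrightarrow> f t = g t"
    then show "Q f i ab = Q g i ab" using prv_cong[of i f g] by (simp add: Q_def)
  next
    fix i and f :: "nat \<Rightarrow> 'm list \<times> 'm list"
    show "\<exists>ab. Q f i ab"
    proof (cases "i < k")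
      case True
      have sm1: "sm (M \<union> prv f i)" using sm_prv[OF M(2)] .
      obtain a where a: "widex (M \<union> prv f i) a" "eqv S M a (as i)"
        using wide_extension[OF \<sigma>x as[OF True] _ sm1] by blast
      have sm2: "sm (M \<union> prv f i \<union> set a)" by (rule sm_Un[OF sm1 sm_finite]) simp
      have sub: "M \<subseteq> M \<union> prv f i \<union> set a" by blast
      obtain b where b: "widey (M \<union> prv f i \<union> set a) b" "eqv S M b (bs i)"
        using wide_extension[OF \<sigma>y bs[OF True] sub sm2] by blast
      show ?thesis using a b by (intro exI[of _ "(a, b)"]) (simp add: Q_def)
    next
      case False
      then show ?thesis by (simp add: Q_def)
    qed
  qed
  then show ?thesis by (auto simp: Q_def)
qed

text \<open>Hodges' argument produces a ladder for \<open>rho\<close>. Its types are realized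
  independently in the direct order, and stationarity turns \<open>rho\<close> into
  \<open>\<Phi>\<close> on the realizations.\<close>

lemma no_tree: "\<not> tree rho (2 ^ (k + 1) - 2) {a. widex M a} {b. widey M b}"
proof
  assume "tree rho (2 ^ (k + 1) - 2) {a. widex M a} {b. widey M b}"
  from tree_ladder[OF this] obtain as bs where l: "length as = k" "length bs = k"
    and sub: "set as \<subseteq> {a. widex M a}" "set bs \<subseteq> {b. widey M b}"
    and ord: "\<forall>i<k. \<forall>j<k. rho (as ! i) (bs ! j) \<longleftrightarrow> i \<le> j"
    by blast
  have wa: "widex M (as ! i)" and wb: "widey M (bs ! i)" if "i < k" for i
    using that l subsetD[OF sub(1) nth_mem, of i] subsetD[OF sub(2) nth_mem, of i] by simp_all
  obtain f where f: "\<forall>i<k. widex (M \<union> prv f i) (fst (f i)) \<and> eqv S M (fst (f i)) (as ! i) \<and>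
      widey (M \<union> prv f i \<union> set (fst (f i))) (snd (f i)) \<and> eqv S M (snd (f i)) (bs ! i)"
    by (rule exE[OF independent_realization[of "(!) as" "(!) bs", OF wa wb]])
  have f1: "widex (M \<union> prv f i) (fst (f i))" and f2: "widey (M \<union> prv f i \<union> set (fst (f i))) (snd (f i))"
    and f3: "eqv S M (fst (f i)) (as ! i)" and f4: "eqv S M (snd (f i)) (bs ! i)" if "i < k" for i
    using f that by simp_all
  have ord': "\<Phi> (fst (f i)) (snd (f j)) \<longleftrightarrow> i \<le> j" if ij: "i < k" "j < k" for i j
  proof -
    have wi: "widex M (fst (f i))" "widey M (snd (f j))"
      by (rule wide_mono[OF f1[OF ij(1)]], blast, rule wide_mono[OF f2[OF ij(2)]], blast)
    \<comment> \<open>Whichever of the two entries appears later is wide over the other one;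
      \<open>indep\<close> asks for no particular side.\<close>
    have "widex (M \<union> set (snd (f j))) (fst (f i)) \<or> widey (M \<union> set (fst (f i))) (snd (f j))"
    proof (cases "i \<le> j")
      case True
      have "set (fst (f i)) \<subseteq> prv f j \<union> set (fst (f j))"
        using True prv_memb[of i j f] by (cases "i = j") auto
      then have "M \<union> set (fst (f i)) \<subseteq> M \<union> prv f j \<union> set (fst (f j))" by blast
      then have "widey (M \<union> set (fst (f i))) (snd (f j))" by (rule wide_mono[OF f2[OF ij(2)]])
      then show ?thesis ..
    next
      case False
      then have "set (snd (f j)) \<subseteq> prv f i" using prv_memb[of j i f] by auto
      then have "M \<union> set (snd (f j)) \<subseteq> M \<union> prv f i" by blast
      then have "widex (M \<union> set (snd (f j))) (fst (f i))" by (rule wide_mono[OF f1[OF ij(1)]])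
      then show ?thesis ..
    qed
    then have "indep (fst (f i)) (snd (f j))" using wi by (simp add: indep_def)
    then have "rho (as ! i) (bs ! j) \<longleftrightarrow> \<Phi> (fst (f i)) (snd (f j))"
      by (rule rho_iff[OF wa[OF ij(1)] wb[OF ij(2)] _ f3[OF ij(1)] f4[OF ij(2)]])
    then show ?thesis using ord ij by blast
  qed
  show False by (rule no_ladder[of f]) (simp_all add: f1 f2 ord')
qed

end

section \<open>The space of wide types\<close>

lemma holds_Neg: "holds S x a (Neg \<psi>) \<longleftrightarrow> \<not> holds S x a \<psi>"
  and holds_Conj: "holds S x a (Conj \<psi> \<theta>) \<longleftrightarrow> holds S x a \<psi> \<and> holds S x a \<theta>"
  and holds_Bot: "\<not> holds S x a Bot"
  by (simp_all add: holds_def)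

section \<open>Maximal consistent sets of Boolean combinations\<close>

lemma consistentD:
  "consistent S x p \<Longrightarrow> finite q \<Longrightarrow> q \<subseteq> p \<Longrightarrow> \<exists>a. length a = length x \<and> (\<forall>\<psi>\<in>q. holds S x a \<psi>)"
  by (simp add: consistent_def)

context
  fixes S :: "('f, 'r, 'm) fo_structure" and x :: "nat list" and B p :: "('f, 'r, 'm) fml set"
  assumes sub: "p \<subseteq> boolean_combinations B" and cons: "consistent S x p"
    and max: "\<And>q. p \<subseteq> q \<Longrightarrow> q \<subseteq> boolean_combinations B \<Longrightarrow> consistent S x q \<Longrightarrow> q = p"
begin

lemma complete_closed:
  assumes "\<psi> \<in> boolean_combinations B" "finite q" "q \<subseteq> p"
    and imp: "\<And>a. length a = length x \<Longrightarrow> \<forall>\<theta>\<in>q. holds S x a \<theta> \<Longrightarrow> holds S x a \<psi>"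
  shows "\<psi> \<in> p"
proof -
  have "consistent S x (insert \<psi> p)"
    unfolding consistent_def
  proof (intro allI impI)
    fix r assume r: "finite r \<and> r \<subseteq> insert \<psi> p"
    then have "finite ((r - {\<psi>}) \<union> q)" "(r - {\<psi>}) \<union> q \<subseteq> p" using assms(2,3) by auto
    from consistentD[OF cons this] obtain a
      where a: "length a = length x" "\<forall>\<theta>\<in>(r - {\<psi>}) \<union> q. holds S x a \<theta>"
      by blast
    have "holds S x a \<psi>" by (rule imp[OF a(1)]) (use a(2) in simp)
    then have "\<forall>\<theta>\<in>r. holds S x a \<theta>" using a(2) by auto
    then show "\<exists>a. length a = length x \<and> (\<forall>\<theta>\<in>r. holds S x a \<theta>)" using a(1) by auto
  qed
  then have "insert \<psi> p = p" using max[of "insert \<psi> p"] sub assms(1) by blast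
  then show ?thesis by blast
qed

lemma complete_Bot: "Bot \<notin> p"
proof
  assume "Bot \<in> p"
  then have "finite {Bot :: ('f, 'r, 'm) fml}" "{Bot} \<subseteq> p" by auto
  from consistentD[OF cons this] show False by (auto simp: holds_Bot)
qed

lemma complete_Neg:
  assumes "\<psi> \<in> boolean_combinations B"
  shows "Neg \<psi> \<in> p \<longleftrightarrow> \<psi> \<notin> p"
proof
  assume "Neg \<psi> \<in> p"
  show "\<psi> \<notin> p"
  proof
    assume "\<psi> \<in> p"
    then have "finite {\<psi>, Neg \<psi>}" "{\<psi>, Neg \<psi>} \<subseteq> p" using \<open>Neg \<psi> \<in> p\<close> by auto
    from consistentD[OF cons this] show False by (auto simp: holds_Neg)
  qed
next
  assume "\<psi> \<notin> p"
  then have "\<not> consistent S x (insert \<psi> p)" using max[of "insert \<psi> p"] sub assms by blast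
  then obtain r where r: "finite r" "r \<subseteq> insert \<psi> p"
    "\<And>a. length a = length x \<Longrightarrow> \<exists>\<theta>\<in>r. \<not> holds S x a \<theta>"
    by (auto simp: consistent_def)
  show "Neg \<psi> \<in> p"
  proof (rule complete_closed)
    show "Neg \<psi> \<in> boolean_combinations B" using assms by (rule boolean_combinations.neg)
    show "finite (r - {\<psi>})" "r - {\<psi>} \<subseteq> p" using r by auto
    fix a :: "'m list" assume "length a = length x" "\<forall>\<theta>\<in>r - {\<psi>}. holds S x a \<theta>"
    then show "holds S x a (Neg \<psi>)" using r(3)[of a] unfolding holds_Neg by auto
  qed
qed

lemma complete_Conj:
  assumes "\<psi> \<in> boolean_combinations B" "\<theta> \<in> boolean_combinations B"
  shows "Conj \<psi> \<theta> \<in> p \<longleftrightarrow> \<psi> \<in> p \<and> \<theta> \<in> p"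
proof
  assume c: "Conj \<psi> \<theta> \<in> p"
  show "\<psi> \<in> p \<and> \<theta> \<in> p"
  proof
    show "\<psi> \<in> p" by (rule complete_closed[of _ "{Conj \<psi> \<theta>}"]) (use assms c in \<open>auto simp: holds_Conj\<close>)
    show "\<theta> \<in> p" by (rule complete_closed[of _ "{Conj \<psi> \<theta>}"]) (use assms c in \<open>auto simp: holds_Conj\<close>)
  qed
next
  assume "\<psi> \<in> p \<and> \<theta> \<in> p"
  then show "Conj \<psi> \<theta> \<in> p"
    by (intro complete_closed[of _ "{\<psi>, \<theta>}"] boolean_combinations.conj assms) (auto simp: holds_Conj)
qed

end

text \<open>By maximality, membership commutes with negation and conjunction, so it is determined on
  the generating instances.\<close>

lemma wide_points_eqI:
  assumes p: "p \<in> wide_points S x y Ix Iy \<phi> M" and q: "q \<in> wide_points S x y Ix Iy \<phi> M"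
    and eq: "\<And>\<psi>. \<psi> \<in> wide_instances S y Iy \<phi> M \<Longrightarrow> \<psi> \<in> p \<longleftrightarrow> \<psi> \<in> q"
  shows "p = q"
proof -
  let ?B = "wide_instances S y Iy \<phi> M"
  have P: "p \<subseteq> boolean_combinations ?B" "consistent S x p"
    "\<And>r. p \<subseteq> r \<Longrightarrow> r \<subseteq> boolean_combinations ?B \<Longrightarrow> consistent S x r \<Longrightarrow> r = p"
    using p by (auto simp: wide_points_def)
  have Q: "q \<subseteq> boolean_combinations ?B" "consistent S x q"
    "\<And>r. q \<subseteq> r \<Longrightarrow> r \<subseteq> boolean_combinations ?B \<Longrightarrow> consistent S x r \<Longrightarrow> r = q"
    using q by (auto simp: wide_points_def)
  have "\<psi> \<in> p \<longleftrightarrow> \<psi> \<in> q" if "\<psi> \<in> boolean_combinations ?B" for \<psi>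
    using that
  proof induction
    case (base \<psi>)
    then show ?case by (rule eq)
  next
    case bot
    show ?case using complete_Bot[OF P] complete_Bot[OF Q] by simp
  next
    case (neg \<psi>)
    then show ?case using complete_Neg[OF P neg(1)] complete_Neg[OF Q neg(1)] by simp
  next
    case (conj \<psi> \<theta>)
    then show ?case using complete_Conj[OF P conj(1,2)] complete_Conj[OF Q conj(1,2)] by simp
  qed
  then show ?thesis using P(1) Q(1) by blast
qed

lemma wide_points_Neg:
  assumes "p \<in> wide_points S x y Ix Iy \<phi> M" "\<psi> \<in> boolean_combinations (wide_instances S y Iy \<phi> M)"
  shows "Neg \<psi> \<in> p \<longleftrightarrow> \<psi> \<notin> p"
  by (rule complete_Neg[of p "wide_instances S y Iy \<phi> M" S x]) (use assms in \<open>auto simp: wide_points_def\<close>)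

text \<open>\<open>Neg Bot\<close> belongs to every point, so a single generating set is already the
  whole space.\<close>

lemma topspace_wide_space: "topspace (wide_space S x y Ix Iy \<phi> M) = wide_points S x y Ix Iy \<phi> M"
proof -
  let ?W = "wide_instances S y Iy \<phi> M"
  have b: "Bot \<in> boolean_combinations ?W" "Neg Bot \<in> boolean_combinations ?W"
    by (auto intro: boolean_combinations.intros)
  have "Neg Bot \<in> p" if p: "p \<in> wide_points S x y Ix Iy \<phi> M" for p
  proof -
    have "Bot \<notin> p" by (rule complete_Bot[of p ?W S x]) (use p in \<open>auto simp: wide_points_def\<close>)
    then show ?thesis using wide_points_Neg[OF p b(1)] by blast
  qed
  then show ?thesis unfolding wide_space_def topology_generated_by_topspace using b(2) by blast
qed

text \<open>A pair \<open>(b, t)\<close> codes the instance at \<open>b\<close> or its negation.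
  Such lists will record the branches of a tree.\<close>

lemma openin_literals:
  assumes "\<And>b t. (b, t) \<in> set l \<Longrightarrow> wide_tuple S y Iy M b"
  shows "openin (wide_space S x y Ix Iy \<phi> M)
    {p \<in> wide_points S x y Ix Iy \<phi> M. \<forall>(b, t)\<in>set l. inst y b \<phi> \<in> p \<longleftrightarrow> t}"
  using assms
proof (induction l)
  case Nil
  then show ?case using openin_topspace[of "wide_space S x y Ix Iy \<phi> M"] by (simp add: topspace_wide_space)
next
  case (Cons bt l)
  obtain b t where bt: "bt = (b, t)" by fastforce
  let ?X = "wide_space S x y Ix Iy \<phi> M" and ?W = "wide_points S x y Ix Iy \<phi> M"
  define \<psi> where "\<psi> = (if t then inst y b \<phi> else Neg (inst y b \<phi>))"
  have "inst y b \<phi> \<in> wide_instances S y Iy \<phi> M"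
    using Cons.prems[of b t] bt by (auto simp: wide_instances_def)
  then have i: "inst y b \<phi> \<in> boolean_combinations (wide_instances S y Iy \<phi> M)"
    by (rule boolean_combinations.base)
  then have "\<psi> \<in> boolean_combinations (wide_instances S y Iy \<phi> M)"
    by (auto simp: \<psi>_def intro: boolean_combinations.neg)
  then have 1: "openin ?X {p \<in> ?W. \<psi> \<in> p}"
    unfolding wide_space_def by (intro topology_generated_by_Basis) blast
  have 2: "openin ?X {p \<in> ?W. \<forall>(b, t)\<in>set l. inst y b \<phi> \<in> p \<longleftrightarrow> t}"
    by (rule Cons.IH) (use Cons.prems in auto)
  have "\<psi> \<in> p \<longleftrightarrow> (inst y b \<phi> \<in> p \<longleftrightarrow> t)" if "p \<in> ?W" for p
    using wide_points_Neg[OF that i] by (auto simp: \<psi>_def)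
  then have "{p \<in> ?W. \<forall>(b, t)\<in>set (bt # l). inst y b \<phi> \<in> p \<longleftrightarrow> t} =
      {p \<in> ?W. \<psi> \<in> p} \<inter> {p \<in> ?W. \<forall>(b, t)\<in>set l. inst y b \<phi> \<in> p \<longleftrightarrow> t}"
    using bt by auto
  then show ?case using openin_Int[OF 1 2] by simp
qed

section \<open>Cantor-Bendixson derivatives and trees\<close>

lemma cb_derivative_Suc:
  "(cb_derivative X ^^ Suc n) A = (cb_derivative X ^^ n) A \<inter> X derived_set_of ((cb_derivative X ^^ n) A)"
proof -
  have "(cb_derivative X ^^ Suc n) A = cb_derivative X ((cb_derivative X ^^ n) A)" by simp
  also have "\<dots> = (cb_derivative X ^^ n) A \<inter> X derived_set_of ((cb_derivative X ^^ n) A)"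
    by (rule cb_derivative_def)
  finally show ?thesis .
qed

context stable_formula
begin

text \<open>Only the finitely many parameters in \<open>l\<close> are added to \<open>M\<close>, so
  saturation applies even if \<open>N\<close> is large. The realization is wide over
  \<open>M\<close> and all of them; hence it is independent from each \<open>b\<close>, and
  \<open>rho\<close> reads off the literals.\<close>

lemma wide_type_realization:
  assumes p: "p \<in> wide_points S x y Ix Iy \<phi> N" and N: "M \<subseteq> N"
    and lits: "\<And>b t. (b, t) \<in> set l \<Longrightarrow> wide_tuple S y Iy N b \<and> (inst y b \<phi> \<in> p \<longleftrightarrow> t)"
  obtains a where "widex M a" "\<And>b t. (b, t) \<in> set l \<Longrightarrow> rho a b \<longleftrightarrow> t"
proof -
  have wb: "widey M b" if "(b, t) \<in> set l" for b t
    using lits[OF that] wide_tuple_iff[OF vars(2)] wide_mono[OF _ N] by blast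
  have lb: "length b = ny" if "(b, t) \<in> set l" for b t using wide_length[OF wb[OF that]] .
  let ?A = "M \<union> (\<Union>bt\<in>set l. set (fst bt))"
  define \<Gamma> where "\<Gamma> = (\<lambda>(b, t). (\<lambda>v. holds S (x @ y) v \<phi> \<longleftrightarrow> t, b)) ` set l"
  define lit where "lit bt = (if snd bt then inst y (fst bt) \<phi> else Neg (inst y (fst bt) \<phi>))" for bt :: "'m list \<times> bool"
  have lit_p: "lit bt \<in> p" if "bt \<in> set l" for bt
  proof -
    obtain b t where bt: "bt = (b, t)" by fastforce
    have "inst y b \<phi> \<in> boolean_combinations (wide_instances S y Iy \<phi> N)"
      using lits[of b t] that bt by (intro boolean_combinations.base) (auto simp: wide_instances_def)
    then show ?thesis using wide_points_Neg[OF p] lits[of b t] that bt by (auto simp: lit_def)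
  qed
  have lit_holds: "holds S x a (lit (b, t)) \<longleftrightarrow> (\<Phi> a b \<longleftrightarrow> t)" if "(b, t) \<in> set l" "length a = nx" for a b t
    using holds_inst[OF vars(3) that(2) lb[OF that(1)] vars(1,2), of S \<phi>] by (simp add: lit_def holds_Neg)
  have "\<exists>a. wide S nx \<sigma>x ?A a \<and> (\<forall>P c. (P, c) \<in> \<Gamma> \<longrightarrow> P (a @ c))"
  proof (rule ext[OF \<sigma>x])
    show "sm ?A" by (rule sm_Un[OF M(2) sm_finite]) simp
    show "set c \<subseteq> ?A \<and> dfn S (nx + length c) P" if Pc: "(P, c) \<in> \<Gamma>" for P c
    proof -
      obtain t where t: "(c, t) \<in> set l" "P = (\<lambda>v. holds S (x @ y) v \<phi> \<longleftrightarrow> t)"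
        using Pc by (auto simp: \<Gamma>_def)
      have "dfn S (nx + ny) P" using \<Phi>_dfn dfn_neg[OF \<Phi>_dfn] t(2) by (cases t) auto
      moreover have "set c \<subseteq> (\<Union>bt\<in>set l. set (fst bt))" using t(1) by force
      ultimately show ?thesis using lb[OF t(1)] by auto
    qed
    fix \<Delta> assume \<Delta>: "\<Delta> \<subseteq> \<Gamma>"
    show "\<not> \<sigma>x (\<lambda>a. \<forall>(P, c)\<in>\<Delta>. P (a @ c))"
    proof
      assume "\<sigma>x (\<lambda>a. \<forall>(P, c)\<in>\<Delta>. P (a @ c))"
      then obtain \<theta> where \<theta>: "\<theta> \<in> Ix"
        "\<And>a. length a = nx \<Longrightarrow> \<forall>(P, c)\<in>\<Delta>. P (a @ c) \<Longrightarrow> holds S x a \<theta>"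
        by (auto simp: small_of_def)
      have "holds S x a \<theta>" if a: "length a = nx" "\<forall>\<psi>\<in>lit ` set l. holds S x a \<psi>" for a
      proof (rule \<theta>(2)[OF a(1)])
        have "\<forall>(P, c)\<in>\<Gamma>. P (a @ c)" using a lit_holds by (auto simp: \<Gamma>_def)
        then show "\<forall>(P, c)\<in>\<Delta>. P (a @ c)" using \<Delta> by blast
      qed
      then have "implies S x p \<theta>"
        unfolding implies_def using lit_p by (intro exI[of _ "lit ` set l"]) auto
      then show False using p \<theta>(1) by (auto simp: wide_points_def wide_type_def)
    qed
  qed
  then obtain a where a: "wide S nx \<sigma>x ?A a" "\<And>P c. (P, c) \<in> \<Gamma> \<Longrightarrow> P (a @ c)" by blast
  have wa: "widex M a" by (rule wide_mono[OF a(1)]) blast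
  have "rho a b \<longleftrightarrow> t" if bt: "(b, t) \<in> set l" for b t
  proof -
    have "widex (M \<union> set b) a" by (rule wide_mono[OF a(1)]) (use bt in force)
    then have "indep a b" using wa wb[OF bt] by (simp add: indep_def)
    then have "rho a b \<longleftrightarrow> \<Phi> a b" by (rule rho_iff[OF wa wb[OF bt] _ eqv_refl eqv_refl])
    moreover have "((\<lambda>v. holds S (x @ y) v \<phi> \<longleftrightarrow> t), b) \<in> \<Gamma>" using bt by (auto simp: \<Gamma>_def)
    ultimately show ?thesis using a(2) by blast
  qed
  then show thesis using that wa by blast
qed

text \<open>Each derivative buys one level. The literals of the branch so far define a neighbourhood
  of \<open>p\<close>, which contains another point of the previous derivative; an instance
  separating the two points becomes the node.\<close>

lemma derivative_tree:
  assumes N: "M \<subseteq> N"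
  defines "X \<equiv> wide_space S x y Ix Iy \<phi> N"
  shows "p \<in> (cb_derivative X ^^ n) (topspace X) \<Longrightarrow>
    (\<And>b t. (b, t) \<in> set l \<Longrightarrow> wide_tuple S y Iy N b \<and> (inst y b \<phi> \<in> p \<longleftrightarrow> t)) \<Longrightarrow>
    tree rho n {a. widex M a \<and> (\<forall>(b, t)\<in>set l. rho a b \<longleftrightarrow> t)} {b. widey M b}"
proof (induction n arbitrary: p l)
  case 0
  then have "p \<in> wide_points S x y Ix Iy \<phi> N" by (simp add: X_def topspace_wide_space)
  then obtain a where "widex M a" "\<And>b t. (b, t) \<in> set l \<Longrightarrow> rho a b \<longleftrightarrow> t"
    using wide_type_realization[OF _ N 0(2)] by blast
  then show ?case by auto
next
  case (Suc n)
  let ?D = "(cb_derivative X ^^ n) (topspace X)" and ?W = "wide_points S x y Ix Iy \<phi> N"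
  let ?O = "{p \<in> ?W. \<forall>(b, t)\<in>set l. inst y b \<phi> \<in> p \<longleftrightarrow> t}"
  have p: "p \<in> ?D" "p \<in> X derived_set_of ?D" using Suc.prems(1) unfolding cb_derivative_Suc by auto
  have pW: "p \<in> ?W" using p(2) by (simp add: derived_set_of_def X_def topspace_wide_space)
  have opO: "openin X ?O" unfolding X_def by (rule openin_literals) (use Suc.prems(2) in blast)
  have pO: "p \<in> ?O" using pW Suc.prems(2) by auto
  have "\<forall>T. p \<in> T \<and> openin X T \<longrightarrow> (\<exists>q\<noteq>p. q \<in> ?D \<and> q \<in> T)"
    using p(2) unfolding derived_set_of_def mem_Collect_eq by (rule conjunct2)
  from mp[OF spec[OF this, of ?O] conjI[OF pO opO]]
  obtain q where q: "q \<noteq> p" "q \<in> ?D" "q \<in> ?O" by (elim exE conjE)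
  have "\<exists>\<psi>\<in>wide_instances S y Iy \<phi> N. (\<psi> \<in> p) \<noteq> (\<psi> \<in> q)"
  proof (rule ccontr)
    assume no: "\<not> ?thesis"
    have "q \<in> ?W" using q(3) by simp
    then have "p = q"
    proof (rule wide_points_eqI[OF pW])
      show "\<psi> \<in> p \<longleftrightarrow> \<psi> \<in> q" if "\<psi> \<in> wide_instances S y Iy \<phi> N" for \<psi>
        using no that by blast
    qed
    then show False using q(1) by simp
  qed
  then obtain \<psi> where \<psi>: "\<psi> \<in> wide_instances S y Iy \<phi> N" "(\<psi> \<in> p) \<noteq> (\<psi> \<in> q)" by (rule bexE)
  then obtain b where "wide_tuple S y Iy N b" "\<psi> = inst y b \<phi>"
    unfolding wide_instances_def by blast
  then have b: "wide_tuple S y Iy N b" "(inst y b \<phi> \<in> p) \<noteq> (inst y b \<phi> \<in> q)"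
    using \<psi>(2) by simp_all
  let ?t = "inst y b \<phi> \<in> p" and ?Z = "{a. widex M a \<and> (\<forall>(b, t)\<in>set l. rho a b \<longleftrightarrow> t)}"
  have "tree rho n {a. widex M a \<and> (\<forall>(b, t)\<in>set ((b, ?t) # l). rho a b \<longleftrightarrow> t)} {b. widey M b}"
    by (rule Suc.IH[OF p(1)]) (use b(1) Suc.prems(2) in auto)
  moreover have "{a. widex M a \<and> (\<forall>(b, t)\<in>set ((b, ?t) # l). rho a b \<longleftrightarrow> t)} = {a \<in> ?Z. rho a b \<longleftrightarrow> ?t}" by auto
  \<comment> \<open>The neighbour \<open>q\<close> keeps the literals in \<open>l\<close> and takes
    the other value at \<open>b\<close>, so it supplies the opposite branch.\<close>
  moreover have "tree rho n {a. widex M a \<and> (\<forall>(b, t)\<in>set ((b, \<not> ?t) # l). rho a b \<longleftrightarrow> t)} {b. widey M b}"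
    by (rule Suc.IH[OF q(2)]) (use b q(3) Suc.prems(2) in auto)
  moreover have "{a. widex M a \<and> (\<forall>(b, t)\<in>set ((b, \<not> ?t) # l). rho a b \<longleftrightarrow> t)} = {a \<in> ?Z. rho a b \<longleftrightarrow> \<not> ?t}" by auto
  ultimately have t: "tree rho n {a \<in> ?Z. rho a b \<longleftrightarrow> ?t} {b. widey M b}"
    "tree rho n {a \<in> ?Z. rho a b \<longleftrightarrow> \<not> ?t} {b. widey M b}" by simp_all
  have "widey M b" using b(1) wide_tuple_iff[OF vars(2)] wide_mono[OF _ N] by blast
  moreover have "tree rho n {a \<in> ?Z. rho a b} {b. widey M b} \<and> tree rho n {a \<in> ?Z. \<not> rho a b} {b. widey M b}"
    using t by (cases ?t) simp_all
  ultimately show ?case unfolding tree.simps by blast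
qed

end

text \<open>Once a derivative is empty, so are all later ones. Every point then has rank at most
  \<open>n - 1\<close>, and for positive \<open>n\<close> the supremum stays strictly below
  \<open>n\<close>.\<close>

lemma cb_rank_lessI:
  assumes "(cb_derivative X ^^ n) (topspace X) = {}" "n > 0"
  shows "cb_rank X < enat n"
proof -
  have anti: "(cb_derivative X ^^ (n + m)) (topspace X) = {}" for m
  proof (induction m)
    case (Suc m)
    then show ?case by (simp only: add_Suc_right cb_derivative_Suc Int_empty_left)
  qed (simp add: assms(1))
  have "cb_rank_at X p \<le> enat (n - 1)" for p
    unfolding cb_rank_at_def
  proof (rule Sup_least)
    fix e assume "e \<in> {enat m | m. p \<in> (cb_derivative X ^^ m) (topspace X)}"
    then obtain m where m: "e = enat m" "p \<in> (cb_derivative X ^^ m) (topspace X)" by blast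
    have "m < n"
    proof (rule ccontr)
      assume "\<not> m < n"
      then have "m = n + (m - n)" by simp
      then show False using anti[of "m - n"] m(2) by simp
    qed
    then show "e \<le> enat (n - 1)" using m(1) by simp
  qed
  then have "cb_rank X \<le> enat (n - 1)" unfolding cb_rank_def by (intro SUP_least)
  also have "enat (n - 1) < enat n" using assms(2) by simp
  finally show ?thesis .
qed

theorem theorem4p7:
  fixes \<MM> :: "('f, 'r, 'm) fo_structure"
    and T :: "('f, 'r, 'm) fml set"
    and \<kappa> :: "'k rel"
    and x y :: "nat list"
    and I\<^sub>x I\<^sub>y :: "('f, 'r, 'm) fml set"
    and \<phi> :: "('f, 'r, 'm) fml"
    and M :: "'m set"
    and k :: nat
  assumes "complete_theory \<MM> T"
    and "monster_model \<MM> T \<kappa>"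
    and "distinct x" and "distinct y" and "set x \<inter> set y = {}"
    and "S1_ideal \<MM> x {} I\<^sub>x"
    and "S1_ideal \<MM> y {} I\<^sub>y"
    and "\<phi> \<in> formulas \<MM> (set x \<union> set y) {}"
    and "stable_of_ladder \<MM> x y I\<^sub>x I\<^sub>y \<phi> k"
    and "elementary_substructure \<MM> M"
  shows "cb_rank (wide_space \<MM> x y I\<^sub>x I\<^sub>y \<phi> M) < enat (2 ^ (k + 1) - 2)"
proof -
  have mon: "saturated \<MM> \<kappa>" "Card_order \<kappa>" "natLeq <o \<kappa>" "|fun_syms \<MM>| <o \<kappa>" "|rel_syms \<MM>| <o \<kappa>"
    using assms(2) by (simp_all add: monster_model_def)
  interpret monster \<MM> \<kappa> by standard (rule mon)+
  obtain M0 where M0: "M0 \<subseteq> M" "elementary_substructure \<MM> M0" "sm M0"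
    using small_elementary_substructure[OF assms(10) mon(4,5)] by blast
  interpret stable_formula \<MM> \<kappa> x y I\<^sub>x I\<^sub>y \<phi> k M0
    by standard (use assms M0 in auto)
  let ?X = "wide_space \<MM> x y I\<^sub>x I\<^sub>y \<phi> M"
  \<comment> \<open>The empty sequence is a ladder without rungs, so stability of ladder 0 is
    impossible; a strict bound needs this, as the bound at 0 would be 0.\<close>
  have "k \<noteq> 0"
  proof
    assume "k = 0"
    then have "independent \<MM> x y I\<^sub>x I\<^sub>y M (ladder_seq k a b)" for a b
      by (simp add: ladder_seq_def independent_def)
    then show False using assms(9,10) \<open>k = 0\<close> unfolding stable_of_ladder_def by auto
  qed
  then have "(2 :: nat) ^ 2 \<le> 2 ^ (k + 1)" by (intro power_increasing) auto
  then have pos: "(2 :: nat) ^ (k + 1) - 2 > 0" by simp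
  \<comment> \<open>The empty list of literals puts no condition on the leaves, so any point of this
    derivative would give the tree excluded by \<open>no_tree\<close>.\<close>
  have "(cb_derivative ?X ^^ (2 ^ (k + 1) - 2)) (topspace ?X) = {}"
    using derivative_tree[OF M0(1), of _ "2 ^ (k + 1) - 2" "[]"] no_tree by auto
  then show ?thesis using cb_rank_lessI pos by blast
qed

end
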